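(* Let $\omega\in\widehat{\mathcal{D}}$. Then there is a radial weight $\nu$ such that $P_\omega: L^\infty_{\widehat{\nu}}\to H^\infty_{\widehat{\nu}}$ is bounded if and only if $\omega\in\check{\mathcal{D}}$. In particular, if $\omega\in\widehat{\mathcal{D}}\setminus\check{\mathcal{D}}$ and $\nu$ is a radial weight, then $P_\omega$ is not bounded from $L^\infty_{\widehat{\nu}}$ to $H^\infty_{\widehat{\nu}}$.
   Context: Let $\mathbb{D}$ be the open unit disc of $\mathbb{C}$, $\mathcal{H}(\mathbb{D})$ the space of analytic functions in $\mathbb{D}$, and $dA(z)=\frac{dx\,dy}{\pi}$ the normalized area measure. A radial weight is a nonnegative function $\omega\in L^1([0,1))$, extended to $\mathbb{D}$ by $\omega(z)=\omega(|z|)$. Write $\widehat{\omega}(z)=\widehat{\omega}(|z|)=\int_{|z|}^1\omega(s)\,ds$; it is assumed throughout that $\widehat{\omega}(z)>0$ for all $z\in\mathbb{D}$. The moments are $\omega_x=\int_0^1 r^x\omega(r)\,dr$, $x\ge0$. A radial weight $\omega$ belongs to $\widehat{\mathcal{D}}$ if there is $C>0$ such that $\widehat{\omega}(r)\le C\,\widehat{\omega}\left(\frac{1+r}{2}\right)$ as $r\to1^-$ (i.e. for all $r<1$ close enough to $1$). It belongs to $\check{\mathcal{D}}$ if there are $K>1$ and $C>1$ such that $\widehat{\omega}(r)\ge C\,\widehat{\omega}\left(1-\frac{1-r}{K}\right)$ as $r\to1^-$. For a radial weight $\omega$, the Bergman projection is $$P_\omega(f)(z)=\int_{\mathbb{D}}f(\zeta)\,\overline{B^\omega_z(\zeta)}\,\omega(\zeta)\,dA(\zeta),\qquad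 B^\omega_z(\zeta)=\sum_{n=0}^\infty\frac{(\overline{z}\zeta)^n}{2\omega_{2n+1}},$$ where $B^\omega_z$ is the reproducing kernel of the Bergman space $A^2_\omega=L^2(\mathbb{D},\omega\,dA)\cap\mathcal{H}(\mathbb{D})$. For a radial weight $\nu$, $L^\infty_{\widehat{\nu}}$ is the space of measurable $f:\mathbb{D}\to\mathbb{C}$ with $\|f\|_{\infty,\widehat{\nu}}=\operatorname{ess\,sup}_{z\in\mathbb{D}}|f(z)|\widehat{\nu}(z)<\infty$, and $H^\infty_{\widehat{\nu}}=L^\infty_{\widehat{\nu}}\cap\mathcal{H}(\mathbb{D})$. Boundedness of $P_\omega:X\to Y$ means that for every $f\in X$ the integral $\int_{\mathbb{D}}f(\zeta)\,\overline{B^\omega_z(\zeta)}\,\omega(\zeta)\,dA(\zeta)$, as a function of $z\in\mathbb{D}$, defines an element of $Y$, and $\|P_\omega f\|_Y\le C\|f\|_X$ with $C$ independent of $f$. *)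

theory Defs
  imports "HOL-Complex_Analysis.Complex_Analysis" "HOL-Probability.Essential_Supremum"
begin

abbreviation unit_disc :: "complex set" where
  "unit_disc \<equiv> ball 0 1"

definition disc_area :: "complex measure" where
  "disc_area = density (lebesgue_on unit_disc) (\<lambda>_. ennreal (1 / pi))"

text \<open>A radial weight is represented by its radial profile on \<open>[0,1)\<close>; its value at a point
  \<open>z\<close> of the disc is the value of the profile at \<open>cmod z\<close>. Values of the profile outside
  \<open>[0,1)\<close> are irrelevant.\<close>

definition tail_integral :: "(real \<Rightarrow> real) \<Rightarrow> real \<Rightarrow> real" where
  "tail_integral \<omega> r = (LINT s:{r..<1}|lebesgue. \<omega> s)"

definition moment :: "(real \<Rightarrow> real) \<Rightarrow> real \<Rightarrow> real" where
  "moment \<omega> x = (LINT r:{0..<1}|lebesgue. r powr x * \<omega> r)"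

text \<open>The positivity of all tail integrals is a standing assumption on radial weights.\<close>

definition radial_weight :: "(real \<Rightarrow> real) \<Rightarrow> bool" where
  "radial_weight \<omega> \<longleftrightarrow>
     (\<forall>r\<in>{0..<1}. 0 \<le> \<omega> r) \<and>
     set_integrable lebesgue {0..<1} \<omega> \<and>
     (\<forall>r\<in>{0..<1}. 0 < tail_integral \<omega> r)"

definition D_hat :: "(real \<Rightarrow> real) set" where
  "D_hat = {\<omega>. radial_weight \<omega> \<and>
     (\<exists>C>0. \<forall>\<^sub>F r in at_left 1. tail_integral \<omega> r \<le> C * tail_integral \<omega> ((1 + r) / 2))}"

definition D_check :: "(real \<Rightarrow> real) set" where
  "D_check = {\<omega>. radial_weight \<omega> \<and>
     (\<exists>K>1. \<exists>C>1. \<forall>\<^sub>F r in at_left 1.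
        tail_integral \<omega> r \<ge> C * tail_integral \<omega> (1 - (1 - r) / K))}"

definition bergman_kernel :: "(real \<Rightarrow> real) \<Rightarrow> complex \<Rightarrow> complex \<Rightarrow> complex" where
  "bergman_kernel \<omega> z \<zeta> =
     (\<Sum>n. (cnj z * \<zeta>) ^ n / complex_of_real (2 * moment \<omega> (2 * real n + 1)))"

definition bergman_integrand ::
  "(real \<Rightarrow> real) \<Rightarrow> (complex \<Rightarrow> complex) \<Rightarrow> complex \<Rightarrow> complex \<Rightarrow> complex" where
  "bergman_integrand \<omega> f z \<zeta> =
     f \<zeta> * cnj (bergman_kernel \<omega> z \<zeta>) * complex_of_real (\<omega> (cmod \<zeta>))"

definition bergman_projection ::
  "(real \<Rightarrow> real) \<Rightarrow> (complex \<Rightarrow> complex) \<Rightarrow> complex \<Rightarrow> complex" where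
  "bergman_projection \<omega> f z = (LINT \<zeta>|disc_area. bergman_integrand \<omega> f z \<zeta>)"

definition weighted_sup_norm :: "(real \<Rightarrow> real) \<Rightarrow> (complex \<Rightarrow> complex) \<Rightarrow> ereal" where
  "weighted_sup_norm \<nu> f =
     esssup disc_area (\<lambda>z. ereal (cmod (f z) * tail_integral \<nu> (cmod z)))"

definition L_inf :: "(real \<Rightarrow> real) \<Rightarrow> (complex \<Rightarrow> complex) set" where
  "L_inf \<nu> = {f. f \<in> borel_measurable disc_area \<and> weighted_sup_norm \<nu> f < \<infinity>}"

definition H_inf :: "(real \<Rightarrow> real) \<Rightarrow> (complex \<Rightarrow> complex) set" where
  "H_inf \<nu> = {f \<in> L_inf \<nu>. f holomorphic_on unit_disc}"

text \<open>Integrability is required explicitly, since the Bochner integral of a non-integrable function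
  is \<open>0\<close> by convention.\<close>

definition bergman_projection_bounded :: "(real \<Rightarrow> real) \<Rightarrow> (real \<Rightarrow> real) \<Rightarrow> bool" where
  "bergman_projection_bounded \<omega> \<nu> \<longleftrightarrow>
     (\<forall>f\<in>L_inf \<nu>.
        (\<forall>z\<in>unit_disc. integrable disc_area (bergman_integrand \<omega> f z)) \<and>
        bergman_projection \<omega> f \<in> H_inf \<nu>) \<and>
     (\<exists>C\<ge>0. \<forall>f\<in>L_inf \<nu>.
        weighted_sup_norm \<nu> (bergman_projection \<omega> f) \<le> ereal C * weighted_sup_norm \<nu> f)"

end

theory Submission
  imports Defs
begin

text \<open>Put \<open>a n = 1 / (2 \<omega>\<^bsub>2n+1\<^esub>)\<close>, so that the kernel is \<open>\<Sum> a n w^n\<close> at \<open>w = cnj z \<zeta>\<close>.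

  If \<open>P\<^sub>\<omega>\<close> is bounded, test it at the point \<open>\<rho>\<close> against \<open>\<phi>(\<rho>\<zeta>)\<close> restricted to \<open>|\<zeta>| \<ge> \<rho>\<close>, where
  \<open>\<phi>(u) = \<Sum> (u^n - cnj u^n) / n\<close> is bounded. Monotonicity of the tail of \<open>\<nu>\<close> eliminates \<open>\<nu>\<close> and leaves
  \<open>H(\<rho>) \<Sum> a n \<rho>^(4n) / n \<le> B\<close> for the tail \<open>H\<close> of \<open>\<omega>\<close>. Since \<open>a n\<close> dominates \<open>1 / H(1 - 1/n)\<close> by the
  doubling condition, the terms with \<open>1 / (1 - r) \<le> n \<le> K / (1 - r)\<close> give
  \<open>H(1 - (1 - r) / K) ln K \<le> B' H(r)\<close>, which is the condition defining \<open>D_check\<close> once \<open>K\<close> is large.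

  Conversely, \<open>D_check\<close> makes \<open>(1 - r) powr (- a)\<close> integrable against \<open>\<omega>\<close> with
  \<open>\<integral> r^n (1 - r) powr (- a) \<omega> \<le> C n powr a \<omega>\<^sub>n\<close> for some small \<open>a > 0\<close>. The kernel is cut into dyadic blocks
  of coefficients; by Parseval the circular \<open>L\<^sup>1\<close> mean of the block at \<open>n \<approx> j\<close> is at most \<open>C a j |w|^(2j)\<close>.
  Summing the blocks, \<open>\<integral> |B\<^sub>z(\<zeta>)| (1 - |\<zeta>|) powr (- a) \<omega>(\<zeta>)\<close> is at most
  \<open>C \<Sum> (2^i) powr a |z|^(2^i) \<le> C' (1 - |z|) powr (- a)\<close>, so a weight \<open>\<nu>\<close> with tail \<open>(1 - r) powr a\<close> works.\<close>

subsection \<open>Area measure of the disc\<close>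

text \<open>Parseval controls square means, whereas boundedness on weighted sup spaces asks for
  \<open>L^1\<close> means of the kernel. Passing from \<open>L^2\<close> to \<open>L^1\<close>
  loses only a constant on a piece of the series whose coefficients are of comparable size and vary
  slowly: a block of length about \<open>j\<close> behaves like a bump on an arc of length about
  \<open>1 / j\<close>, which is what Cauchy--Schwarz against \<open>1 / (1 - \<rho> w)\<close> with
  \<open>\<rho> = 1 - 1 / j\<close> detects. Doubling of the moments supplies both properties of the
  coefficients, and the blocks are cut out by piecewise linear profiles so that the slow variation
  is kept. The exponent \<open>a\<close> is restricted twice: \<open>K powr a\<close> has to stay
  below the constant of the reverse doubling condition, and \<open>a < 1\<close> lets the elementary
  bound \<open>m x^m (1 - x) \<le> 1\<close> handle the dyadic sum. Integration over the disc rests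
  on two facts: rotation invariance, which makes monomials orthogonal for every radial density, and
  the distribution of the modulus, which reduces radial integrals to the line.\<close>

lemma measurable_Complex_prod [measurable]:
  "(\<lambda>p. Complex (fst p) (snd p)) \<in> borel_measurable (borel :: (real \<times> real) measure)"
  by (intro borel_measurable_continuous_onI) (simp add: Complex_eq continuous_intros)

text \<open>\<open>lborel\<close> is determined by its values on boxes. The identification opens
  Fubini in the real and imaginary parts, on which the shears act.\<close>

lemma lborel_complex_eq_distr: "distr (lborel :: (real \<times> real) measure) borel (\<lambda>(x, y). Complex x y) = lborel"
proof (rule lborel_eqI[symmetric])
  show "sets (distr (lborel :: (real \<times> real) measure) borel (\<lambda>(x, y). Complex x y)) = sets borel"
    by simp
next
  have m [measurable]: "(\<lambda>(x, y). Complex x y) \<in> borel_measurable (lborel :: (real \<times> real) measure)"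
    unfolding case_prod_beta by simp
  fix l u :: complex
  assume le: "\<And>b. b \<in> Basis \<Longrightarrow> l \<bullet> b \<le> u \<bullet> b"
  have "(\<lambda>(x, y). Complex x y) -` box l u = box (Re l, Im l) (Re u, Im u)"
    by (auto simp: box_def Basis_complex_def Basis_prod_def inner_complex_def)
  then have "emeasure (distr (lborel :: (real \<times> real) measure) borel (\<lambda>(x, y). Complex x y)) (box l u)
      = emeasure lborel (box (Re l, Im l) (Re u, Im u))"
    by (subst emeasure_distr) (auto simp: space_pair_measure)
  also have "\<dots> = ennreal ((Re u - Re l) * (Im u - Im l))"
  proof -
    have "Re l \<le> Re u" "Im l \<le> Im u"
      using le[of 1] le[of \<i>] by (auto simp: Basis_complex_def)
    then show ?thesis
      by (subst emeasure_lborel_box) (auto simp: Basis_prod_def prod.union_disjoint)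
  qed
  also have "(Re u - Re l) * (Im u - Im l) = (\<Prod>b\<in>Basis. (u - l) \<bullet> b)"
    by (simp add: Basis_complex_def)
  finally show "emeasure (distr (lborel :: (real \<times> real) measure) borel (\<lambda>(x, y). Complex x y)) (box l u)
      = ennreal (\<Prod>b\<in>Basis. (u - l) \<bullet> b)" .
qed

lemma measurable_Complex [measurable (raw)]:
  assumes "f \<in> borel_measurable M" "g \<in> borel_measurable M"
  shows "(\<lambda>x. Complex (f x) (g x)) \<in> borel_measurable M"
  using assms by (simp add: Complex_eq)

lemma nn_integral_complex:
  assumes [measurable]: "h \<in> borel_measurable borel"
  shows "(\<integral>\<^sup>+z. h z \<partial>lborel) = (\<integral>\<^sup>+x. \<integral>\<^sup>+y. h (Complex x y) \<partial>lborel \<partial>lborel)"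
    and "(\<integral>\<^sup>+z. h z \<partial>lborel) = (\<integral>\<^sup>+y. \<integral>\<^sup>+x. h (Complex x y) \<partial>lborel \<partial>lborel)"
proof -
  have "(\<integral>\<^sup>+z. h z \<partial>lborel) = (\<integral>\<^sup>+p. h (case p of (x, y) \<Rightarrow> Complex x y) \<partial>(lborel \<Otimes>\<^sub>M lborel))"
    by (subst lborel_complex_eq_distr[symmetric], subst nn_integral_distr)
       (simp_all add: case_prod_beta lborel_prod)
  then show "(\<integral>\<^sup>+z. h z \<partial>lborel) = (\<integral>\<^sup>+x. \<integral>\<^sup>+y. h (Complex x y) \<partial>lborel \<partial>lborel)"
    by (simp add: case_prod_beta lborel.nn_integral_fst[symmetric])
  then show "(\<integral>\<^sup>+z. h z \<partial>lborel) = (\<integral>\<^sup>+y. \<integral>\<^sup>+x. h (Complex x y) \<partial>lborel \<partial>lborel)"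
    using lborel_pair.Fubini'[of "\<lambda>x y. h (Complex x y)"] by (simp add: case_prod_beta)
qed

lemma nn_integral_shear_Re:
  assumes [measurable]: "h \<in> borel_measurable borel"
  shows "(\<integral>\<^sup>+z. h (Complex (Re z + a * Im z) (Im z)) \<partial>lborel) = (\<integral>\<^sup>+z. h z \<partial>lborel)"
proof -
  have "(\<integral>\<^sup>+x. h (Complex (x + a * y) y) \<partial>lborel) = (\<integral>\<^sup>+x. h (Complex x y) \<partial>lborel)" for y
    using nn_integral_real_affine[of "\<lambda>x. h (Complex x y)" 1 "a * y"] by (simp add: add.commute)
  then show ?thesis
    by (simp add: nn_integral_complex(2))
qed

lemma nn_integral_shear_Im:
  assumes [measurable]: "h \<in> borel_measurable borel"
  shows "(\<integral>\<^sup>+z. h (Complex (Re z) (Im z + a * Re z)) \<partial>lborel) = (\<integral>\<^sup>+z. h z \<partial>lborel)"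
proof -
  have "(\<integral>\<^sup>+y. h (Complex x (y + a * x)) \<partial>lborel) = (\<integral>\<^sup>+y. h (Complex x y) \<partial>lborel)" for x
    using nn_integral_real_affine[of "\<lambda>y. h (Complex x y)" 1 "a * x"] by (simp add: add.commute)
  then show ?thesis
    by (simp add: nn_integral_complex(1))
qed

text \<open>Every rotation other than \<open>z \<mapsto> - z\<close> is a product of three shears.\<close>

lemma nn_integral_rotation:
  assumes [measurable]: "h \<in> borel_measurable borel" and c: "cmod c = 1" "c \<noteq> -1"
  shows "(\<integral>\<^sup>+z. h (c * z) \<partial>lborel) = (\<integral>\<^sup>+z. h z \<partial>lborel)"
proof -
  \<comment> \<open>For \<open>c = cis \<theta>\<close> this is \<open>- tan (\<theta> / 2)\<close>.
    The rotation is the horizontal shear by \<open>t\<close>, then the vertical one by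
    \<open>Im c\<close>, then the horizontal one by \<open>t\<close> again; at \<open>c = -1\<close>
    the parameter has a pole.\<close>
  define t where "t = - Im c / (1 + Re c)"
  have eq: "(Re c)\<^sup>2 + (Im c)\<^sup>2 = 1"
    using c(1) by (metis cmod_power2 one_power2)
  have ne: "1 + Re c \<noteq> 0"
  proof
    assume "1 + Re c = 0"
    then have "Re c = -1" by simp
    moreover from this eq have "Im c = 0" by simp
    ultimately show False using c(2) by (simp add: complex_eq_iff)
  qed
  have 1: "1 + t * Im c = Re c"
    using ne eq by (simp add: t_def field_simps power2_eq_square)
  have 2: "t * Re c + t = - Im c"
    unfolding t_def using ne by (simp add: divide_simps) (simp add: algebra_simps)
  define h1 where "h1 z = h (Complex (Re z + t * Im z) (Im z))" for z
  define h2 where "h2 z = h1 (Complex (Re z) (Im z + Im c * Re z))" for z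
  have [measurable]: "h1 \<in> borel_measurable borel" "h2 \<in> borel_measurable borel"
    unfolding h2_def h1_def by measurable
  have "h (c * z) = h2 (Complex (Re z + t * Im z) (Im z))" for z
  proof -
    have "Re z + t * Im z + t * (Im z + Im c * (Re z + t * Im z))
        = (1 + t * Im c) * Re z + (t * (1 + t * Im c) + t) * Im z"
      by (simp add: algebra_simps)
    also have "\<dots> = Re (c * z)"
      unfolding 1 2 by simp
    finally have re: "Re z + t * Im z + t * (Im z + Im c * (Re z + t * Im z)) = Re (c * z)" .
    have "Im z + Im c * (Re z + t * Im z) = Im c * Re z + (1 + t * Im c) * Im z"
      by (simp add: algebra_simps)
    also have "\<dots> = Im (c * z)"
      unfolding 1 by simp
    finally have im: "Im z + Im c * (Re z + t * Im z) = Im (c * z)" .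
    show ?thesis
      unfolding h2_def h1_def complex.sel by (simp only: im re[unfolded im] complex_surj)
  qed
  then have "(\<integral>\<^sup>+z. h (c * z) \<partial>lborel) = (\<integral>\<^sup>+z. h2 z \<partial>lborel)"
    by (simp add: nn_integral_shear_Re)
  also have "\<dots> = (\<integral>\<^sup>+z. h1 z \<partial>lborel)"
    unfolding h2_def by (simp add: nn_integral_shear_Im)
  also have "\<dots> = (\<integral>\<^sup>+z. h z \<partial>lborel)"
    unfolding h1_def by (simp add: nn_integral_shear_Re)
  finally show ?thesis .
qed

lemma space_disc_area [simp]: "space disc_area = unit_disc"
  by (simp add: disc_area_def)

lemma sets_disc_area: "sets disc_area = sets (lebesgue_on unit_disc)"
  by (simp add: disc_area_def)

lemma borel_measurable_disc_area [measurable (raw)]: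
  assumes "h \<in> borel_measurable borel"
  shows "h \<in> borel_measurable disc_area"
proof -
  have "h \<in> borel_measurable lebesgue"
    using assms by (simp add: measurable_completion)
  then show ?thesis
    unfolding disc_area_def by (simp add: measurable_restrict_space1)
qed

lemma nn_integral_disc_area:
  assumes [measurable]: "h \<in> borel_measurable borel"
  shows "(\<integral>\<^sup>+z. h z \<partial>disc_area) = (\<integral>\<^sup>+z. ennreal (1 / pi) * (h z * indicator unit_disc z) \<partial>lborel)"
proof -
  have [measurable]: "h \<in> borel_measurable lebesgue"
    by (simp add: measurable_completion)
  have "(\<integral>\<^sup>+z. h z \<partial>disc_area) = (\<integral>\<^sup>+z. ennreal (1 / pi) * h z \<partial>lebesgue_on unit_disc)"
    unfolding disc_area_def by (subst nn_integral_density) (auto intro: measurable_restrict_space1)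
  also have "\<dots> = (\<integral>\<^sup>+z. ennreal (1 / pi) * h z * indicator unit_disc z \<partial>lebesgue)"
    by (subst nn_integral_restrict_space) (auto simp: ac_simps)
  also have "\<dots> = (\<integral>\<^sup>+z. ennreal (1 / pi) * (h z * indicator unit_disc z) \<partial>lborel)"
    by (subst nn_integral_completion) (simp_all add: ac_simps)
  finally show ?thesis .
qed

text \<open>Both the planar measure and the indicator of the disc are invariant under
  \<open>c\<close>. The images are compared on Borel sets only, which avoids discussing rotations on
  the completed sigma-algebra carried by \<open>disc_area\<close>.\<close>

lemma distr_disc_area_rotation:
  assumes c: "cmod c = 1" "c \<noteq> -1"
  shows "distr disc_area borel ((*) c) = distr disc_area borel (\<lambda>z. z)"
proof (rule measure_eqI)
  fix A :: "complex set" assume "A \<in> sets (distr disc_area borel ((*) c))"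
  then have [measurable]: "A \<in> sets borel" "unit_disc \<in> sets borel" by simp_all
  have [measurable]: "(*) c \<in> borel_measurable disc_area" "(\<lambda>z. z) \<in> borel_measurable disc_area"
    by (rule borel_measurable_disc_area, simp)+
  have "emeasure (distr disc_area borel ((*) c)) A = (\<integral>\<^sup>+z. indicator A z \<partial>distr disc_area borel ((*) c))"
    by simp
  also have "\<dots> = (\<integral>\<^sup>+z. indicator A (c * z) \<partial>disc_area)"
    by (subst nn_integral_distr) simp_all
  also have "\<dots> = (\<integral>\<^sup>+z. ennreal (1 / pi) * (indicator A (c * z) * indicator unit_disc (c * z)) \<partial>lborel)"
    by (subst nn_integral_disc_area) (auto intro!: nn_integral_cong simp: indicator_def norm_mult c)
  also have "\<dots> = (\<integral>\<^sup>+z. ennreal (1 / pi) * (indicator A z * indicator unit_disc z) \<partial>lborel)"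
    by (rule nn_integral_rotation[OF _ c]) simp
  also have "\<dots> = (\<integral>\<^sup>+z. indicator A z \<partial>disc_area)"
    by (subst nn_integral_disc_area) simp_all
  also have "\<dots> = (\<integral>\<^sup>+z. indicator A z \<partial>distr disc_area borel (\<lambda>z. z))"
    by (subst nn_integral_distr) simp_all
  finally show "emeasure (distr disc_area borel ((*) c)) A = emeasure (distr disc_area borel (\<lambda>z. z)) A"
    by simp
qed simp

lemma integral_disc_area_rotation:
  fixes h :: "complex \<Rightarrow> 'b :: {banach, second_countable_topology}"
  assumes [measurable]: "h \<in> borel_measurable borel" and c: "cmod c = 1" "c \<noteq> -1"
  shows "(LINT z|disc_area. h (c * z)) = (LINT z|disc_area. h z)"
proof -
  have [measurable]: "(*) c \<in> borel_measurable disc_area" "(\<lambda>z. z) \<in> borel_measurable disc_area"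
    by (rule borel_measurable_disc_area, simp)+
  have "(LINT z|disc_area. h (c * z)) = (LINT z|distr disc_area borel ((*) c). h z)"
    by (subst integral_distr) simp_all
  also have "\<dots> = (LINT z|disc_area. h z)"
    unfolding distr_disc_area_rotation[OF c] by (subst integral_distr) simp_all
  finally show ?thesis .
qed

lemma emeasure_disc_area:
  assumes [measurable]: "A \<in> sets borel" and "A \<subseteq> unit_disc"
  shows "emeasure disc_area A = ennreal (1 / pi) * emeasure lborel A"
proof -
  have A: "A \<in> sets disc_area"
    using assms(2) by (auto simp: sets_disc_area sets_restrict_space_iff)
  have "emeasure disc_area A = (\<integral>\<^sup>+z. indicator A z \<partial>disc_area)"
    using A by simp
  also have "\<dots> = (\<integral>\<^sup>+z. ennreal (1 / pi) * (indicator A z * indicator unit_disc z) \<partial>lborel)"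
    by (rule nn_integral_disc_area) simp
  also have "\<dots> = (\<integral>\<^sup>+z. ennreal (1 / pi) * indicator A z \<partial>lborel)"
    using assms(2) by (intro nn_integral_cong) (auto simp: indicator_def)
  finally show ?thesis
    by (simp add: nn_integral_cmult)
qed

lemma emeasure_disc_area_annulus:
  assumes "0 \<le> x" "x \<le> 1"
  shows "emeasure disc_area {z. x < cmod z \<and> cmod z < 1} = ennreal (1 - x\<^sup>2)"
proof -
  have "{z. x < cmod z \<and> cmod z < 1} = unit_disc - cball 0 x"
    by auto
  moreover have "emeasure lborel (unit_disc - cball 0 x) = ennreal pi - ennreal (pi * x\<^sup>2)"
  proof (cases "x < 1")
    case True
    then show ?thesis
      using assms by (subst emeasure_Diff)
        (auto simp: emeasure_ball emeasure_cball unit_ball_vol_2 emeasure_lborel_cball_finite)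
  next
    case False
    then have "x = 1" using assms by simp
    then have "unit_disc - cball 0 x = {}" by auto
    then show ?thesis unfolding \<open>x = 1\<close> by (simp only: emeasure_empty) simp
  qed
  moreover have "ennreal (1 / pi) * (ennreal pi - ennreal (pi * x\<^sup>2)) = ennreal (1 - x\<^sup>2)"
    using assms by (subst ennreal_minus, simp, subst ennreal_mult[symmetric]) (auto simp: field_simps power_le_one)
  ultimately show ?thesis
    by (subst emeasure_disc_area) auto
qed

text \<open>The radial half of polar coordinates, without a change of variables: the measure is
  determined by its values on the rays \<open>{x<..}\<close>, and for \<open>x\<close> in
  \<open>[0,1]\<close> the preimage of a ray is an annulus of area \<open>1 - x^2\<close>.\<close>

lemma distr_disc_area_cmod:
  "distr disc_area borel cmod = density lborel (\<lambda>r. ennreal (2 * r) * indicator {0..<1} r)"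
proof (rule measure_eqI_lessThan)
  have [measurable]: "cmod \<in> borel_measurable disc_area"
    by (rule borel_measurable_disc_area) simp
  have eq: "emeasure (distr disc_area borel cmod) {x<..} = ennreal (1 - (max 0 (min 1 x))\<^sup>2)"
    and fin: "emeasure (distr disc_area borel cmod) {x<..} < \<infinity>" for x
  proof -
    show eq: "emeasure (distr disc_area borel cmod) {x<..} = ennreal (1 - (max 0 (min 1 x))\<^sup>2)"
    proof (cases "x < 0")
      case True
      have "emeasure (distr disc_area borel cmod) {x<..} = emeasure disc_area (insert 0 {z. 0 < cmod z \<and> cmod z < 1})"
        using True by (subst emeasure_distr)
          (auto intro!: arg_cong[where f = "emeasure disc_area"] less_le_trans[OF _ norm_ge_zero])
      also have "\<dots> = emeasure disc_area {z. 0 < cmod z \<and> cmod z < 1}"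
      proof (subst (1 2) emeasure_disc_area)
        have "emeasure lborel (insert 0 {z. 0 < cmod z \<and> cmod z < 1}) = emeasure lborel {z. 0 < cmod z \<and> cmod z < 1}"
          by (rule emeasure_eq_AE) (use AE_lborel_singleton[of "0 :: complex"] in \<open>auto elim!: eventually_mono\<close>)
        then show "ennreal (1 / pi) * emeasure lborel (insert 0 {z. 0 < cmod z \<and> cmod z < 1}) =
           ennreal (1 / pi) * emeasure lborel {z. 0 < cmod z \<and> cmod z < 1}" by simp
      qed auto
      finally show ?thesis
        using True emeasure_disc_area_annulus[of 0] by (simp add: max_def)
    next
      case False
      have "emeasure (distr disc_area borel cmod) {x<..} = emeasure disc_area {z. min 1 x < cmod z \<and> cmod z < 1}"
        by (subst emeasure_distr) (auto intro!: arg_cong[where f = "emeasure disc_area"])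
      then show ?thesis
        using False emeasure_disc_area_annulus[of "min 1 x"] by (simp add: max_def)
    qed
    then show "emeasure (distr disc_area borel cmod) {x<..} < \<infinity>"
      by simp
  qed
  show "emeasure (distr disc_area borel cmod) {x<..} < \<infinity>" for x
    by (rule fin)
  show "emeasure (distr disc_area borel cmod) {x<..}
      = emeasure (density lborel (\<lambda>r. ennreal (2 * r) * indicator {0..<1} r)) {x<..}" for x
  proof -
    define y where "y = max 0 (min 1 x)"
    have y: "0 \<le> y" "y \<le> 1" by (auto simp: y_def)
    have "emeasure (density lborel (\<lambda>r. ennreal (2 * r) * indicator {0..<1} r)) {x<..}
        = (\<integral>\<^sup>+r. ennreal (2 * r) * indicator {0..<1} r * indicator {x<..} r \<partial>lborel)"
      by (rule emeasure_density) auto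
    also have "\<dots> = (\<integral>\<^sup>+r. ennreal (2 * r) * indicator {y..1} r \<partial>lborel)"
      using AE_lborel_singleton[of 1] AE_lborel_singleton[of x]
      by (intro nn_integral_cong_AE, eventually_elim) (auto simp: indicator_def y_def max_def min_def)
    also have "\<dots> = ennreal (1\<^sup>2 - y\<^sup>2)"
      using y by (intro nn_integral_FTC_Icc) (auto intro!: derivative_eq_intros)
    finally show ?thesis
      by (simp add: eq y_def)
  qed
qed simp_all

text \<open>The image of the area under \<open>cmod\<close> has a density with respect to
  \<open>lborel\<close>, so null sets of radii pull back to null sets. The exceptional set need not
  be Borel and is therefore first enclosed in a Borel null set \<open>N\<close>.\<close>

lemma AE_disc_area_cmod:
  assumes "AE r in lebesgue. r \<in> {0..<1} \<longrightarrow> Q r"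
  shows "AE z in disc_area. Q (cmod z)"
proof -
  have [measurable]: "cmod \<in> borel_measurable disc_area"
    by (rule borel_measurable_disc_area) simp
  have "AE r in lborel. r \<in> {0..<1} \<longrightarrow> Q r"
    using assms by (simp add: AE_completion_iff)
  then obtain N where N: "N \<in> null_sets lborel" "{r. \<not> (r \<in> {0..<1} \<longrightarrow> Q r)} \<subseteq> N"
    unfolding eventually_ae_filter by auto
  then have [measurable]: "N \<in> sets borel" by auto
  have "AE r in lborel. r \<notin> N"
    using N(1) by (rule AE_not_in)
  then have "AE r in density lborel (\<lambda>r. ennreal (2 * r) * indicator {0..<1} r). r \<notin> N"
    by (subst AE_density) (auto elim!: eventually_mono)
  then have "AE z in disc_area. cmod z \<notin> N"
    unfolding distr_disc_area_cmod[symmetric] by (subst (asm) AE_distr_iff) simp_all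
  then show ?thesis
  proof (rule AE_mp, intro AE_I2 impI)
    fix z assume "z \<in> space disc_area" "cmod z \<notin> N"
    then show "Q (cmod z)"
      using subsetD[OF N(2), of "cmod z"] by auto
  qed
qed

lemma
  fixes h :: "real \<Rightarrow> real"
  assumes [measurable]: "h \<in> borel_measurable borel"
  shows integrable_disc_area_radial_iff: "integrable disc_area (\<lambda>z. h (cmod z)) \<longleftrightarrow> set_integrable lborel {0..<1} (\<lambda>r. 2 * r * h r)"
    and integral_disc_area_radial: "(LINT z|disc_area. h (cmod z)) = (LINT r:{0..<1}|lborel. 2 * r * h r)"
proof -
  have [measurable]: "cmod \<in> borel_measurable disc_area"
    by (rule borel_measurable_disc_area) simp
  have eq: "(\<lambda>r. ennreal (2 * r) * indicator {0..<1} r) = (\<lambda>r. ennreal (2 * r * indicator {0..<1} r))"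
    by (auto simp: indicator_def)
  have "integrable disc_area (\<lambda>z. h (cmod z)) \<longleftrightarrow> integrable (distr disc_area borel cmod) h"
    by (subst integrable_distr_eq) simp_all
  also have "\<dots> \<longleftrightarrow> integrable lborel (\<lambda>r. (2 * r * indicator {0..<1} r) *\<^sub>R h r)"
    unfolding distr_disc_area_cmod eq by (subst integrable_density) (auto simp: indicator_def)
  finally show "integrable disc_area (\<lambda>z. h (cmod z)) \<longleftrightarrow> set_integrable lborel {0..<1} (\<lambda>r. 2 * r * h r)"
    unfolding set_integrable_def by (simp add: ac_simps)
  have "(LINT z|disc_area. h (cmod z)) = (LINT r|distr disc_area borel cmod. h r)"
    by (subst integral_distr) simp_all
  also have "\<dots> = (LINT r|lborel. (2 * r * indicator {0..<1} r) *\<^sub>R h r)"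
    unfolding distr_disc_area_cmod eq by (subst integral_density) (auto simp: indicator_def)
  finally show "(LINT z|disc_area. h (cmod z)) = (LINT r:{0..<1}|lborel. 2 * r * h r)"
    unfolding set_lebesgue_integral_def by (simp add: ac_simps)
qed

text \<open>Averaging over the circle is replaced by one well chosen rotation: it multiplies the
  integral by \<open>\<i>\<close> and also leaves it unchanged. Both facts hold as well when the
  integral has its default value \<open>0\<close>.\<close>

lemma integral_disc_area_orthogonal:
  fixes G :: "real \<Rightarrow> real"
  assumes [measurable]: "G \<in> borel_measurable borel" and ne: "p \<noteq> q"
  shows "(LINT z|disc_area. z ^ p * cnj z ^ q * complex_of_real (G (cmod z))) = 0"
proof -
  \<comment> \<open>The angle makes \<open>(p - q) t = pi / 2\<close>. As
    \<open>|p - q| \<ge> 1\<close>, it satisfies \<open>|t| \<le> pi / 2\<close>, which keeps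
    \<open>c\<close> away from \<open>-1\<close>, the value excluded in the rotation lemmas.\<close>
  define t where "t = pi / 2 / (real p - real q)"
  define c where "c = cis t"
  define I where "I = (LINT z|disc_area. z ^ p * cnj z ^ q * complex_of_real (G (cmod z)))"
  have c: "cmod c = 1" "c \<noteq> -1"
  proof -
    show "cmod c = 1" by (simp add: c_def)
    have "\<bar>t\<bar> = pi / 2 / \<bar>real p - real q\<bar>"
      unfolding t_def abs_divide by simp
    also have "\<dots> \<le> pi / 2 / 1"
      using ne by (intro divide_left_mono) auto
    finally have "cos t \<ge> 0"
      by (intro cos_ge_zero) auto
    then show "c \<noteq> -1"
      by (auto simp: c_def complex_eq_iff)
  qed
  have cc: "c ^ p * cnj c ^ q = \<i>"
  proof -
    have "c ^ p * cnj c ^ q = cis ((real p - real q) * t)"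
      by (simp add: c_def Complex.DeMoivre cis_cnj cis_mult algebra_simps)
    also have "(real p - real q) * t = pi / 2"
      unfolding t_def using ne by (intro nonzero_mult_div_cancel_left[of "real p - real q" "pi / 2", folded times_divide_eq_right]) auto
    finally show ?thesis by simp
  qed
  have [measurable]: "cnj \<in> borel_measurable borel"
    by (intro borel_measurable_continuous_onI continuous_intros)
  have "I = (LINT z|disc_area. (c * z) ^ p * cnj (c * z) ^ q * complex_of_real (G (cmod (c * z))))"
    unfolding I_def by (rule integral_disc_area_rotation[OF _ c, symmetric]) measurable
  also have "\<dots> = (LINT z|disc_area. (c ^ p * cnj c ^ q) * (z ^ p * cnj z ^ q * complex_of_real (G (cmod z))))"
    using c by (intro Bochner_Integration.integral_cong) (auto simp: power_mult_distrib norm_mult)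
  also have "\<dots> = \<i> * I"
    unfolding cc I_def by (rule integral_mult_right_zero)
  finally have "I * (1 - \<i>) = 0"
    by (simp add: algebra_simps)
  then have "I = 0"
    by (auto simp: complex_eq_iff)
  then show ?thesis
    by (simp add: I_def)
qed

section \<open>Parseval and \<open>L^1\<close> means of polynomials against a radial density\<close>

locale radial_density =
  fixes G :: "real \<Rightarrow> real"
  assumes G_borel [measurable]: "G \<in> borel_measurable borel"
    and G_nonneg: "\<And>r. 0 \<le> G r"
    and G_integrable: "integrable disc_area (\<lambda>z. G (cmod z))"
begin

lemma G_cmod_measurable [measurable]: "(\<lambda>z. G (cmod z)) \<in> borel_measurable disc_area"
  by (rule borel_measurable_disc_area) measurable

lemma integrable_mult_G:
  fixes h :: "complex \<Rightarrow> 'b :: {real_normed_field, banach, second_countable_topology}"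
  assumes [measurable]: "h \<in> borel_measurable disc_area" and "AE z in disc_area. norm (h z) \<le> B"
  shows "integrable disc_area (\<lambda>z. h z * of_real (G (cmod z)))"
proof (rule Bochner_Integration.integrable_bound)
  show "integrable disc_area (\<lambda>z. B * G (cmod z))"
    using G_integrable by simp
  show "(\<lambda>z. h z * of_real (G (cmod z))) \<in> borel_measurable disc_area"
    by measurable
  show "AE z in disc_area. norm (h z * of_real (G (cmod z))) \<le> norm (B * G (cmod z))"
    using assms(2)
  proof eventually_elim
    case (elim z)
    then have "norm (h z) * G (cmod z) \<le> B * G (cmod z)"
      using G_nonneg by (rule mult_right_mono)
    then show ?case
      using G_nonneg[of "cmod z"] by (simp add: norm_mult)
  qed
qed

lemma integrable_continuous_mult_G:
  fixes h :: "complex \<Rightarrow> 'b :: {real_normed_field, banach, second_countable_topology}"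
  assumes "continuous_on UNIV h"
  shows "integrable disc_area (\<lambda>z. h z * of_real (G (cmod z)))"
proof -
  have "compact (h ` cball 0 1)"
    using assms continuous_on_subset by (intro compact_continuous_image) auto
  then have "\<exists>B. \<forall>z\<in>cball 0 1. norm (h z) \<le> B"
    using compact_imp_bounded[of "h ` cball 0 1"] by (auto simp: bounded_iff)
  then obtain B where B: "\<And>z. z \<in> cball 0 1 \<Longrightarrow> norm (h z) \<le> B"
    by blast
  show ?thesis
  proof (rule integrable_mult_G)
    show "h \<in> borel_measurable disc_area"
      using assms by (intro borel_measurable_disc_area borel_measurable_continuous_onI)
    show "AE z in disc_area. norm (h z) \<le> B"
      using B by (intro AE_I2) auto
  qed
qed

text \<open>Orthogonality leaves only the diagonal of the double sum, and each diagonal moment is at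
  most the total mass because \<open>|b|\<close> and \<open>|z|\<close> are at most
  \<open>1\<close>.\<close>

lemma integral_norm_poly_sq_le:
  fixes p :: "nat \<Rightarrow> complex"
  assumes b: "cmod b \<le> 1"
  shows "(LINT z|disc_area. (cmod (\<Sum>n<N. p n * (b * z) ^ n))\<^sup>2 * G (cmod z))
     \<le> (\<Sum>n<N. (cmod (p n))\<^sup>2) * (LINT z|disc_area. G (cmod z))"
proof -
  define I where "I m n = (LINT z|disc_area. z ^ m * cnj z ^ n * complex_of_real (G (cmod z)))" for m n
  have int: "integrable disc_area (\<lambda>z. z ^ m * cnj z ^ n * complex_of_real (G (cmod z)))" for m n
    by (intro integrable_continuous_mult_G continuous_intros)
  have int': "integrable disc_area (\<lambda>z. cmod z ^ (2 * n) * G (cmod z))" for n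
    using integrable_continuous_mult_G[of "\<lambda>z. cmod z ^ (2 * n)"] by (simp add: continuous_intros)
  have diag: "I n n = of_real (LINT z|disc_area. cmod z ^ (2 * n) * G (cmod z))" for n
    unfolding I_def integral_complex_of_real[symmetric]
    by (intro Bochner_Integration.integral_cong)
       (simp_all add: power_mult_distrib[symmetric] complex_norm_square[symmetric] power_mult)
  have sq: "complex_of_real ((cmod (\<Sum>n<N. p n * (b * z) ^ n))\<^sup>2)
      = (\<Sum>m<N. \<Sum>n<N. (p m * cnj (p n) * b ^ m * cnj b ^ n) * (z ^ m * cnj z ^ n))" for z
    unfolding complex_norm_square cnj_sum sum_product
    by (intro sum.cong refl) (simp add: power_mult_distrib)
  have "complex_of_real (LINT z|disc_area. (cmod (\<Sum>n<N. p n * (b * z) ^ n))\<^sup>2 * G (cmod z))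
     = (LINT z|disc_area. (\<Sum>m<N. \<Sum>n<N. (p m * cnj (p n) * b ^ m * cnj b ^ n) *
          (z ^ m * cnj z ^ n * complex_of_real (G (cmod z)))))"
    unfolding integral_complex_of_real[symmetric] of_real_mult sq
    by (simp add: sum_distrib_right mult.assoc)
  also have "\<dots> = (\<Sum>m<N. \<Sum>n<N. (p m * cnj (p n) * b ^ m * cnj b ^ n) * I m n)"
    using int by (simp add: I_def integral_sum)
  also have "\<dots> = (\<Sum>m<N. \<Sum>n<N. if n = m then (p m * cnj (p m) * b ^ m * cnj b ^ m) * I m m else 0)"
    by (intro sum.cong refl) (auto simp: I_def integral_disc_area_orthogonal)
  also have "\<dots> = (\<Sum>m<N. (p m * cnj (p m) * b ^ m * cnj b ^ m) * I m m)"
    by (simp add: sum.delta)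
  also have "\<dots> = of_real (\<Sum>m<N. (cmod (p m))\<^sup>2 * (cmod b ^ (2 * m) * (LINT z|disc_area. cmod z ^ (2 * m) * G (cmod z))))"
    unfolding diag of_real_sum
  proof (intro sum.cong refl)
    fix m
    have "cmod b ^ (2 * m) = (cmod (b ^ m))\<^sup>2"
      by (simp add: norm_power flip: power_mult) (simp add: mult.commute)
    then have eq: "p m * cnj (p m) * b ^ m * cnj b ^ m = complex_of_real ((cmod (p m))\<^sup>2 * cmod b ^ (2 * m))"
      by (simp only: of_real_mult complex_norm_square complex_cnj_power mult.assoc)
    show "p m * cnj (p m) * b ^ m * cnj b ^ m * complex_of_real (LINT z|disc_area. cmod z ^ (2 * m) * G (cmod z))
       = complex_of_real ((cmod (p m))\<^sup>2 * (cmod b ^ (2 * m) * (LINT z|disc_area. cmod z ^ (2 * m) * G (cmod z))))"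
      unfolding eq of_real_mult by (rule mult.assoc)
  qed
  finally have "(LINT z|disc_area. (cmod (\<Sum>n<N. p n * (b * z) ^ n))\<^sup>2 * G (cmod z))
      = (\<Sum>m<N. (cmod (p m))\<^sup>2 * (cmod b ^ (2 * m) * (LINT z|disc_area. cmod z ^ (2 * m) * G (cmod z))))"
    unfolding of_real_eq_iff .
  also have "\<dots> \<le> (\<Sum>m<N. (cmod (p m))\<^sup>2 * (1 * (LINT z|disc_area. G (cmod z))))"
  proof (intro sum_mono mult_left_mono mult_mono)
    fix m
    show "(LINT z|disc_area. cmod z ^ (2 * m) * G (cmod z)) \<le> (LINT z|disc_area. G (cmod z))"
      using G_nonneg by (intro integral_mono int' G_integrable) (auto intro!: mult_left_le_one_le power_le_one)
  qed (use b G_nonneg in \<open>auto intro!: power_le_one\<close>)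
  finally show ?thesis
    by (simp add: sum_distrib_right)
qed

text \<open>Parseval in the limit: the partial sums of the geometric series have the common majorant
  \<open>1 / (1 - \<rho>)\<close>, and the squares of their coefficients \<open>\<rho> ^ n\<close>
  sum to at most \<open>1 / (1 - \<rho>^2)\<close>.\<close>

lemma integral_geometric_le:
  assumes b: "cmod b \<le> 1" and \<rho>: "0 \<le> \<rho>" "\<rho> < 1"
  shows "integrable disc_area (\<lambda>z. 1 / (cmod (1 - of_real \<rho> * (b * z)))\<^sup>2 * G (cmod z))"
    and "(LINT z|disc_area. 1 / (cmod (1 - of_real \<rho> * (b * z)))\<^sup>2 * G (cmod z))
     \<le> 1 / (1 - \<rho>\<^sup>2) * (LINT z|disc_area. G (cmod z))"
proof -
  define S where "S N z = (\<Sum>n<N. complex_of_real (\<rho> ^ n) * (b * z) ^ n)" for N z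
  have bz: "cmod (b * z) \<le> 1" if "z \<in> unit_disc" for z
    using b that by (auto simp: norm_mult intro!: mult_le_one)
  have sm: "cmod (of_real \<rho> * (b * z)) \<le> \<rho>" if "z \<in> unit_disc" for z
    using bz[OF that] \<rho> by (simp add: norm_mult mult_left_le)
  have S_eq: "S N z = (\<Sum>n<N. (of_real \<rho> * (b * z)) ^ n)" for N z
    by (simp add: S_def power_mult_distrib)
  have lim: "(\<lambda>N. (cmod (S N z))\<^sup>2 * G (cmod z)) \<longlonglongrightarrow> 1 / (cmod (1 - of_real \<rho> * (b * z)))\<^sup>2 * G (cmod z)"
    if "z \<in> unit_disc" for z
  proof -
    have "(\<lambda>n. (of_real \<rho> * (b * z)) ^ n) sums (1 / (1 - of_real \<rho> * (b * z)))"
      using sm[OF that] \<rho> by (intro geometric_sums) auto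
    then have "(\<lambda>N. S N z) \<longlonglongrightarrow> 1 / (1 - of_real \<rho> * (b * z))"
      by (simp add: S_eq sums_def)
    then have "(\<lambda>N. (cmod (S N z))\<^sup>2 * G (cmod z)) \<longlonglongrightarrow> (cmod (1 / (1 - of_real \<rho> * (b * z))))\<^sup>2 * G (cmod z)"
      by (intro tendsto_intros)
    then show ?thesis
      by (simp add: norm_divide power_divide)
  qed
  have bound: "cmod (S N z) \<le> 1 / (1 - \<rho>)" if "z \<in> unit_disc" for N z
  proof -
    have "cmod (S N z) \<le> (\<Sum>n<N. \<rho> ^ n)"
      unfolding S_eq using sm[OF that] by (intro sum_norm_le) (auto simp: norm_power intro: power_mono)
    also have "\<dots> \<le> (\<Sum>n. \<rho> ^ n)"
      using \<rho> by (intro sum_le_suminf) auto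
    also have "\<dots> = 1 / (1 - \<rho>)"
      using \<rho> by (intro suminf_geometric) auto
    finally show ?thesis .
  qed
  have S_cont: "continuous_on UNIV (S N)" for N
    unfolding S_def by (intro continuous_intros)
  have [measurable]: "S N \<in> borel_measurable disc_area" for N
    by (intro borel_measurable_disc_area borel_measurable_continuous_onI S_cont)
  have [measurable]: "(\<lambda>z. 1 / (cmod (1 - of_real \<rho> * (b * z)))\<^sup>2 * G (cmod z)) \<in> borel_measurable disc_area"
    by (rule borel_measurable_disc_area) measurable
  have dom_int: "integrable disc_area (\<lambda>z. (1 / (1 - \<rho>))\<^sup>2 * G (cmod z))"
    using G_integrable by simp
  have ae_lim: "AE z in disc_area. (\<lambda>N. (cmod (S N z))\<^sup>2 * G (cmod z))
      \<longlonglongrightarrow> 1 / (cmod (1 - of_real \<rho> * (b * z)))\<^sup>2 * G (cmod z)"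
    by (intro AE_I2 lim) simp
  have ae_bound: "AE z in disc_area. norm ((cmod (S N z))\<^sup>2 * G (cmod z)) \<le> (1 / (1 - \<rho>))\<^sup>2 * G (cmod z)" for N
    using G_nonneg bound by (intro AE_I2) (auto simp: abs_mult intro!: mult_right_mono power_mono)
  show "integrable disc_area (\<lambda>z. 1 / (cmod (1 - of_real \<rho> * (b * z)))\<^sup>2 * G (cmod z))"
    by (rule integrable_dominated_convergence[OF _ _ dom_int ae_lim ae_bound]) measurable
  have conv: "(\<lambda>N. LINT z|disc_area. (cmod (S N z))\<^sup>2 * G (cmod z))
      \<longlonglongrightarrow> (LINT z|disc_area. 1 / (cmod (1 - of_real \<rho> * (b * z)))\<^sup>2 * G (cmod z))"
    by (rule integral_dominated_convergence[OF _ _ dom_int ae_lim ae_bound]) measurable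
  show "(LINT z|disc_area. 1 / (cmod (1 - of_real \<rho> * (b * z)))\<^sup>2 * G (cmod z))
     \<le> 1 / (1 - \<rho>\<^sup>2) * (LINT z|disc_area. G (cmod z))"
  proof (rule LIMSEQ_le_const2[OF conv], intro exI allI impI)
    fix N
    have \<rho>2: "norm (\<rho>\<^sup>2) < 1"
      using \<rho> by (simp add: power_less_one_iff abs_square_less_1)
    have "(\<Sum>n<N. (cmod (complex_of_real (\<rho> ^ n)))\<^sup>2) = (\<Sum>n<N. (\<rho>\<^sup>2) ^ n)"
      using \<rho> by (intro sum.cong) (auto simp: norm_power power_mult[symmetric] mult.commute)
    also have "\<dots> \<le> (\<Sum>n. (\<rho>\<^sup>2) ^ n)"
      using \<rho>2 by (intro sum_le_suminf summable_geometric) auto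
    also have "\<dots> = 1 / (1 - \<rho>\<^sup>2)"
      using \<rho>2 by (rule suminf_geometric)
    finally have "(\<Sum>n<N. (cmod (complex_of_real (\<rho> ^ n)))\<^sup>2) \<le> 1 / (1 - \<rho>\<^sup>2)" .
    then show "(LINT z|disc_area. (cmod (S N z))\<^sup>2 * G (cmod z)) \<le> 1 / (1 - \<rho>\<^sup>2) * (LINT z|disc_area. G (cmod z))"
      unfolding S_def using G_nonneg
      by (intro order.trans[OF integral_norm_poly_sq_le[OF b]] mult_right_mono) auto
  qed
qed

text \<open>Cauchy--Schwarz with the weight \<open>1 - \<rho>w\<close>: multiplication by it turns the coefficients into
  \<open>e n - \<rho> e (n-1)\<close>, and Parseval applies both to the product and to the geometric series
  \<open>1 / (1 - \<rho>w)\<close>.\<close>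

lemma integral_norm_poly_le:
  fixes e :: "nat \<Rightarrow> real"
  assumes b: "cmod b \<le> 1" and \<rho>: "0 \<le> \<rho>" "\<rho> < 1" and \<tau>: "\<tau> > 0"
    and e: "\<bar>e 0\<bar> \<le> X" "\<And>n. \<bar>e (Suc n) - \<rho> * e n\<bar> \<le> X" "\<And>n. n \<ge> M \<Longrightarrow> e n = 0"
  shows "(LINT z|disc_area. cmod (\<Sum>n<M. of_real (e n) * (b * z) ^ n) * G (cmod z))
     \<le> (\<tau> * (real (Suc M) * X\<^sup>2) + 1 / (\<tau> * (1 - \<rho>\<^sup>2))) / 2 * (LINT z|disc_area. G (cmod z))"
proof -
  define R where "R w = (\<Sum>n<M. complex_of_real (e n) * w ^ n)" for w
  \<comment> \<open>These are the coefficients of \<open>(1 - \<rho> w) R w\<close>. The range grows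
    to \<open>Suc M\<close> because the product has one degree more than \<open>R\<close>.\<close>
  define d where "d n = (case n of 0 \<Rightarrow> e 0 | Suc m \<Rightarrow> e (Suc m) - \<rho> * e m)" for n
  have R_mult: "(1 - of_real \<rho> * w) * R w = (\<Sum>n<Suc M. complex_of_real (d n) * w ^ n)" for w
  proof -
    have "(\<Sum>n<Suc M. complex_of_real (d n) * w ^ n)
        = (\<Sum>n<Suc M. complex_of_real (e n) * w ^ n) - of_real \<rho> * w * R w"
      unfolding sum.lessThan_Suc_shift
      by (simp add: d_def R_def sum_subtractf sum_distrib_left algebra_simps)
    also have "(\<Sum>n<Suc M. complex_of_real (e n) * w ^ n) = R w"
      using e(3) by (simp add: R_def)
    finally show ?thesis
      by (simp add: algebra_simps)
  qed
  have d_le: "\<bar>d n\<bar> \<le> X" for n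
    using e by (simp add: d_def split: nat.split)
  define A where "A z = (cmod (\<Sum>n<Suc M. complex_of_real (d n) * (b * z) ^ n))\<^sup>2 * G (cmod z)" for z
  define B where "B z = 1 / (cmod (1 - of_real \<rho> * (b * z)))\<^sup>2 * G (cmod z)" for z
  have A_int: "integrable disc_area A"
    unfolding A_def using integrable_continuous_mult_G[of "\<lambda>z. (cmod (\<Sum>n<Suc M. complex_of_real (d n) * (b * z) ^ n))\<^sup>2"]
    by (simp add: continuous_intros del: sum.lessThan_Suc)
  have B_int: "integrable disc_area B"
    unfolding B_def by (rule integral_geometric_le(1)[OF b \<rho>])
  have R_int: "integrable disc_area (\<lambda>z. cmod (R (b * z)) * G (cmod z))"
    unfolding R_def using integrable_continuous_mult_G[of "\<lambda>z. cmod (\<Sum>n<M. complex_of_real (e n) * (b * z) ^ n)"]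
    by (simp add: continuous_intros)
  have "(LINT z|disc_area. A z) \<le> (\<Sum>n<Suc M. (cmod (complex_of_real (d n)))\<^sup>2) * (LINT z|disc_area. G (cmod z))"
    unfolding A_def by (rule integral_norm_poly_sq_le[OF b])
  also have "\<dots> \<le> (\<Sum>n<Suc M. X\<^sup>2) * (LINT z|disc_area. G (cmod z))"
    using power_mono[OF d_le, of _ 2] G_nonneg by (intro mult_right_mono sum_mono) auto
  finally have A_le: "(LINT z|disc_area. A z) \<le> real (Suc M) * X\<^sup>2 * (LINT z|disc_area. G (cmod z))"
    by simp
  have B_le: "(LINT z|disc_area. B z) \<le> 1 / (1 - \<rho>\<^sup>2) * (LINT z|disc_area. G (cmod z))"
    unfolding B_def by (rule integral_geometric_le(2)[OF b \<rho>])
  have "(LINT z|disc_area. cmod (R (b * z)) * G (cmod z)) \<le> (LINT z|disc_area. (\<tau> * A z + B z / \<tau>) / 2)"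
  proof (rule integral_mono[OF R_int])
    show "integrable disc_area (\<lambda>z. (\<tau> * A z + B z / \<tau>) / 2)"
      using A_int B_int by simp
    fix z assume "z \<in> space disc_area"
    then have "cmod z < 1" by simp
    define D where "D = cmod (1 - of_real \<rho> * (b * z))"
    have "cmod (of_real \<rho> * (b * z)) < 1"
    proof -
      have "cmod (b * z) \<le> 1"
        using b \<open>cmod z < 1\<close> by (auto simp: norm_mult intro!: mult_le_one)
      then have "\<rho> * cmod (b * z) \<le> \<rho> * 1"
        using \<rho> by (intro mult_left_mono)
      then show ?thesis
        using \<rho> by (simp add: norm_mult)
    qed
    then have D: "D > 0"
      by (auto simp: D_def)
    have sq: "(\<Sum>n<Suc M. complex_of_real (d n) * (b * z) ^ n) = (1 - of_real \<rho> * (b * z)) * R (b * z)"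
      by (rule R_mult[symmetric])
    \<comment> \<open>Cauchy--Schwarz in pointwise form,
      \<open>2 x y \<le> \<tau> x^2 + y^2 / \<tau>\<close> with \<open>x = D |R|\<close> and
      \<open>y = 1 / D\<close>. The free \<open>\<tau>\<close> is chosen later to balance the two
      integrals.\<close>
    have "0 \<le> (\<tau> * (D * cmod (R (b * z))) - 1 / D)\<^sup>2 / \<tau>"
      using \<tau> by simp
    also have "\<dots> = \<tau> * (D * cmod (R (b * z)))\<^sup>2 + 1 / D\<^sup>2 / \<tau> - 2 * cmod (R (b * z))"
      using \<tau> D by (simp add: power2_diff field_simps power2_eq_square)
    finally have "cmod (R (b * z)) * G (cmod z) \<le> (\<tau> * (D * cmod (R (b * z)))\<^sup>2 + 1 / D\<^sup>2 / \<tau>) / 2 * G (cmod z)"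
      using G_nonneg by (intro mult_right_mono) auto
    then show "cmod (R (b * z)) * G (cmod z) \<le> (\<tau> * A z + B z / \<tau>) / 2"
      unfolding A_def B_def sq norm_mult D_def[symmetric] by (simp add: algebra_simps add_divide_distrib)
  qed
  also have "\<dots> = (\<tau> * (LINT z|disc_area. A z) + (LINT z|disc_area. B z) / \<tau>) / 2"
    using A_int B_int by simp
  also have "\<dots> \<le> (\<tau> * (real (Suc M) * X\<^sup>2 * (LINT z|disc_area. G (cmod z))) + 1 / (1 - \<rho>\<^sup>2) * (LINT z|disc_area. G (cmod z)) / \<tau>) / 2"
    using A_le B_le \<tau> by (intro divide_right_mono add_mono mult_left_mono) auto
  also have "\<dots> = (\<tau> * (real (Suc M) * X\<^sup>2) + 1 / (\<tau> * (1 - \<rho>\<^sup>2))) / 2 * (LINT z|disc_area. G (cmod z))"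
    by (simp add: algebra_simps add_divide_distrib)
  finally show ?thesis
    by (simp add: R_def)
qed

end

subsection \<open>Tails and moments of radial weights\<close>

text \<open>Compare \<open>n\<close> copies of \<open>s ^ n\<close> with the geometric sum
  \<open>\<Sum>i<n. s ^ i\<close>, whose product with \<open>1 - s\<close> is
  \<open>1 - s ^ n\<close>. This is the source of every gain \<open>1 / n\<close> below.\<close>

lemma power_mult_one_minus_le:
  fixes s :: real
  assumes "0 \<le> s" "s \<le> 1"
  shows "real n * (s ^ n * (1 - s)) \<le> 1"
proof -
  have "real n * s ^ n \<le> (\<Sum>i<n. s ^ i)"
    using sum_mono[of "{..<n}" "\<lambda>_. s ^ n" "\<lambda>i. s ^ i"] assms by (simp add: power_decreasing)
  then have "real n * s ^ n * (1 - s) \<le> (\<Sum>i<n. s ^ i) * (1 - s)"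
    using assms by (intro mult_right_mono) auto
  also have "\<dots> = 1 - s ^ n"
    by (metis mult.commute one_diff_power_eq)
  also have "\<dots> \<le> 1"
    using assms by simp
  finally show ?thesis
    by (simp add: mult.assoc)
qed

text \<open>A Borel profile that is nonnegative on the whole line: integrals can be taken over
  \<open>lborel\<close>, and pointwise comparisons need no care outside \<open>[0,1)\<close>. A
  general weight is reduced to this case by changing it on a null set of
  \<open>[0,1)\<close>.\<close>

locale borel_weight =
  fixes \<omega> :: "real \<Rightarrow> real"
  assumes borel [measurable]: "\<omega> \<in> borel_measurable borel"
    and nonneg: "\<And>r. 0 \<le> \<omega> r"
    and radial: "radial_weight \<omega>"
begin

abbreviation H :: "real \<Rightarrow> real" where "H \<equiv> tail_integral \<omega>"

lemma integrable_unit: "set_integrable lborel {0..<1} \<omega>"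
  using radial unfolding radial_weight_def set_integrable_def
  by (subst integrable_completion[symmetric]) auto

lemma integrable_sub:
  assumes "A \<subseteq> {0..<1}" "A \<in> sets borel"
  shows "set_integrable lborel A \<omega>"
  using set_integrable_subset[OF integrable_unit] assms by simp

lemma integrable_mult:
  assumes "A \<subseteq> {0..<1}" "A \<in> sets borel" "g \<in> borel_measurable borel"
    and "\<And>r. r \<in> A \<Longrightarrow> \<bar>g r\<bar> \<le> B"
  shows "set_integrable lborel A (\<lambda>r. g r * \<omega> r)"
proof (rule set_integrable_bound)
  note [measurable] = assms(2,3)
  show "set_integrable lborel A (\<lambda>r. B * \<omega> r)"
    using integrable_sub[OF assms(1,2)] by simp
  show "set_borel_measurable lborel A (\<lambda>r. g r * \<omega> r)"
    unfolding set_borel_measurable_def by measurable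
  show "AE x in lborel. x \<in> A \<longrightarrow> norm (g x * \<omega> x) \<le> norm (B * \<omega> x)"
  proof (intro AE_I2 impI)
    fix x assume "x \<in> A"
    then have "\<bar>g x\<bar> * \<omega> x \<le> B * \<omega> x"
      using nonneg assms(4) by (intro mult_right_mono) auto
    then show "norm (g x * \<omega> x) \<le> norm (B * \<omega> x)"
      using nonneg[of x] mult_right_mono[OF abs_ge_self[of B], of "\<omega> x"] by (simp add: abs_mult)
  qed
qed

lemma tail_eq: "H r = (LINT s:{r..<1}|lborel. \<omega> s)"
  unfolding tail_integral_def set_lebesgue_integral_def
  by (rule integral_completion) measurable

lemma tail_pos: "0 \<le> r \<Longrightarrow> r < 1 \<Longrightarrow> 0 < H r"
  using radial by (simp add: radial_weight_def)

lemma tail_antimono: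
  assumes "0 \<le> r" "r \<le> s"
  shows "H s \<le> H r"
  unfolding tail_eq set_lebesgue_integral_def
proof (rule integral_mono)
  have "{r..<1} \<subseteq> {0..<1}" "{s..<1} \<subseteq> {0..<1}"
    using assms by auto
  then show "integrable lborel (\<lambda>x. indicat_real {r..<1} x *\<^sub>R \<omega> x)"
      "integrable lborel (\<lambda>x. indicat_real {s..<1} x *\<^sub>R \<omega> x)"
    using integrable_sub unfolding set_integrable_def by auto
qed (use assms nonneg in \<open>auto simp: indicator_def\<close>)

text \<open>Natural powers replace \<open>powr\<close>. The two differ at \<open>r = 0\<close> with
  exponent \<open>0\<close>, where \<open>0 powr 0 = 0\<close> but \<open>0 ^ 0 = 1\<close>; the
  kernel uses only odd exponents.\<close>

definition mom :: "nat \<Rightarrow> real" where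
  "mom n = (LINT r:{0..<1}|lborel. r ^ n * \<omega> r)"

lemma moment_eq: "n > 0 \<Longrightarrow> moment \<omega> (real n) = mom n"
proof -
  assume n: "n > 0"
  have "moment \<omega> (real n) = (LINT r:{0..<1}|lebesgue. r ^ n * \<omega> r)"
    unfolding moment_def set_lebesgue_integral_def using n
    by (intro Bochner_Integration.integral_cong refl)
       (auto simp: indicator_def powr_realpow' zero_power)
  also have "\<dots> = mom n"
    unfolding mom_def set_lebesgue_integral_def by (rule integral_completion) measurable
  finally show ?thesis .
qed

lemma integrable_power: 
  assumes "A \<subseteq> {0..<1}" "A \<in> sets borel"
  shows "set_integrable lborel A (\<lambda>r. r ^ n * \<omega> r)"
  using assms by (intro integrable_mult[where B = 1]) (auto intro!: power_le_one simp: subset_iff)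

lemma mom_ge:
  assumes "0 \<le> r" "r < 1"
  shows "r ^ n * H r \<le> mom n"
proof -
  have "r ^ n * H r = (LINT s:{r..<1}|lborel. r ^ n * \<omega> s)"
    by (simp add: tail_eq)
  also have "\<dots> \<le> mom n"
    unfolding mom_def set_lebesgue_integral_def
  proof (rule integral_mono)
    show "integrable lborel (\<lambda>x. indicat_real {r..<1} x *\<^sub>R (r ^ n * \<omega> x))"
      using assms integrable_mult[of "{r..<1}" "\<lambda>_. r ^ n" "r ^ n"] unfolding set_integrable_def by auto
    show "integrable lborel (\<lambda>x. indicat_real {0..<1} x *\<^sub>R (x ^ n * \<omega> x))"
      using integrable_power[of "{0..<1}"] unfolding set_integrable_def by auto
  qed (use assms nonneg in \<open>auto simp: indicator_def intro!: mult_right_mono power_mono\<close>)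
  finally show ?thesis .
qed

lemma mom_pos: "0 < mom n"
proof -
  have "0 < (1/2) ^ n * H (1/2)"
    using tail_pos[of "1/2"] by simp
  also have "\<dots> \<le> mom n"
    by (rule mom_ge) auto
  finally show ?thesis .
qed

lemma mom_antimono: "m \<le> n \<Longrightarrow> mom n \<le> mom m"
  unfolding mom_def set_lebesgue_integral_def
proof (rule integral_mono)
  show "integrable lborel (\<lambda>x. indicat_real {0..<1} x *\<^sub>R (x ^ n * \<omega> x))"
      "integrable lborel (\<lambda>x. indicat_real {0..<1} x *\<^sub>R (x ^ m * \<omega> x))"
    using integrable_power[of "{0..<1}"] unfolding set_integrable_def by auto
qed (use nonneg in \<open>auto simp: indicator_def intro!: mult_right_mono power_decreasing\<close>)

definition coeff :: "nat \<Rightarrow> real" where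
  "coeff n = 1 / (2 * mom (2 * n + 1))"

lemma coeff_pos: "0 < coeff n"
  using mom_pos by (simp add: coeff_def)

lemma coeff_mono: "m \<le> n \<Longrightarrow> coeff m \<le> coeff n"
  unfolding coeff_def using mom_pos
  by (intro divide_left_mono) (auto intro!: mult_pos_pos mom_antimono)

text \<open>Any \<open>r\<close> with \<open>s < r^2 < 1\<close> works: \<open>mom_ge\<close> at
  this fixed \<open>r\<close> makes \<open>coeff n\<close> at most a constant times
  \<open>1 / r ^ (2 * n)\<close>, which leaves a geometric series of ratio
  \<open>s / r^2\<close>.\<close>

lemma summable_coeff:
  assumes s: "0 \<le> s" "s < 1"
  shows "summable (\<lambda>n. coeff n * s ^ n)"
proof -
  obtain r where r: "sqrt s < r" "r < 1"
    using s dense[of "sqrt s" 1] by auto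
  have r0: "0 < r"
    using r s by (smt (verit) real_sqrt_ge_zero)
  have sr: "s < r\<^sup>2"
    using r s by (metis real_sqrt_less_iff real_sqrt_abs abs_of_pos r0)
  have "coeff n * s ^ n \<le> 1 / (2 * r * H r) * (s / r\<^sup>2) ^ n" for n
  proof -
    have "coeff n \<le> 1 / (2 * (r ^ (2 * n + 1) * H r))"
      unfolding coeff_def using mom_ge[of r "2 * n + 1"] r r0 tail_pos[of r] mom_pos
      by (intro divide_left_mono) auto
    then have "coeff n * s ^ n \<le> 1 / (2 * (r ^ (2 * n + 1) * H r)) * s ^ n"
      using s by (intro mult_right_mono) auto
    also have "\<dots> = 1 / (2 * r * H r) * (s / r\<^sup>2) ^ n"
      by (simp add: power_mult power_divide)
    finally show ?thesis .
  qed
  moreover have sum: "summable (\<lambda>n. 1 / (2 * r * H r) * (s / r\<^sup>2) ^ n)"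
    using s sr by (intro summable_mult summable_geometric) (auto simp: divide_less_eq)
  moreover have "norm (coeff n * s ^ n) = coeff n * s ^ n" for n
    using s less_imp_le[OF coeff_pos, of n] by simp
  ultimately have "norm (coeff n * s ^ n) \<le> 1 / (2 * r * H r) * (s / r\<^sup>2) ^ n" for n
    by simp
  then show ?thesis
    by (rule summable_comparison_test'[where N = 0, OF sum])
qed

end

section \<open>Doubling tails: moments, kernel coefficients and their increments\<close>

locale doubling_weight = borel_weight +
  fixes C :: real
  assumes C_ge_1: "1 \<le> C"
    and doubling: "\<And>r. 0 \<le> r \<Longrightarrow> r < 1 \<Longrightarrow> H r \<le> C * H ((1 + r) / 2)"
begin

text \<open>Each step doubles the distance to the boundary at the price of one factor
  \<open>C\<close>. The truncation at \<open>0\<close> stands for the whole interval once that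
  distance exceeds \<open>1\<close>.\<close>

lemma tail_doubling_iterate:
  assumes "0 < t" "t \<le> 1"
  shows "H (max 0 (1 - 2 ^ j * t)) \<le> C ^ j * H (1 - t)"
proof (induction j)
  case (Suc j)
  define u where "u = 2 ^ j * t"
  have u: "u > 0" "2 ^ Suc j * t = 2 * u"
    using assms by (auto simp: u_def)
  have "H (max 0 (1 - 2 * u)) \<le> C * H (max 0 (1 - u))"
  proof (cases "2 * u \<le> 1")
    case True
    have "(1 + (1 - 2 * u)) / 2 = 1 - u"
      by (simp add: field_simps)
    with doubling[of "1 - 2 * u"] have "H (1 - 2 * u) \<le> C * H (1 - u)"
      using u(1) True by (simp only:)
    then show ?thesis
      using u(1) True by (simp add: max_def)
  next
    case False
    then have "max 0 (1 - u) \<le> 1 / 2"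
      by (intro max.boundedI) auto
    then have "H (1 / 2) \<le> H (max 0 (1 - u))"
      by (intro tail_antimono) auto
    then have "C * H (1 / 2) \<le> C * H (max 0 (1 - u))"
      using C_ge_1 by (intro mult_left_mono) auto
    then show ?thesis
      using doubling[of 0] False by (simp add: max_def)
  qed
  then have "H (max 0 (1 - 2 ^ Suc j * t)) \<le> C * H (max 0 (1 - 2 ^ j * t))"
    unfolding u(2) by (simp only: u_def)
  also have "\<dots> \<le> C * (C ^ j * H (1 - t))"
    using Suc C_ge_1 by (intro mult_left_mono) auto
  finally show ?case
    by simp
qed (use assms in auto)

lemma summable_doubly_exponential: "summable (\<lambda>j. exp (- (2 ^ j)) * C ^ Suc j)"
proof (rule summable_ratio_test)
  show "1 / 2 < (1 :: real)" by simp
  fix n :: nat assume n: "nat \<lceil>ln (2 * C)\<rceil> \<le> n"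
  have "ln (2 * C) \<le> 2 ^ n"
    using n of_nat_less_two_power[of n, where 'a = real] by linarith
  then have "exp (- (2 ^ n)) \<le> exp (- ln (2 * C))"
    by simp
  also have "\<dots> = 1 / (2 * C)"
    using C_ge_1 by (simp add: exp_minus inverse_eq_divide)
  finally have *: "exp (- (2 ^ n)) * C \<le> 1 / 2"
    using C_ge_1 by (simp add: field_simps)
  have "exp (- (2 ^ Suc n)) * C ^ Suc (Suc n) = (exp (- (2 ^ n)) * C) * (exp (- (2 ^ n)) * C ^ Suc n)"
    by (simp add: exp_add[symmetric] algebra_simps)
  also have "\<dots> \<le> 1 / 2 * (exp (- (2 ^ n)) * C ^ Suc n)"
    using C_ge_1 by (intro mult_right_mono *) auto
  finally show "norm (exp (- (2 ^ Suc n)) * C ^ Suc (Suc n)) \<le> 1 / 2 * norm (exp (- (2 ^ n)) * C ^ Suc n)"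
    using C_ge_1 by simp
qed

definition mom_const :: real where
  "mom_const = 1 + (\<Sum>j. exp (- (2 ^ j)) * C ^ Suc j)"

lemma mom_const_ge_1: "1 \<le> mom_const"
proof -
  have "0 \<le> (\<Sum>j. exp (- (2 ^ j)) * C ^ Suc j)"
    using C_ge_1 by (intro suminf_nonneg summable_doubly_exponential) auto
  then show ?thesis
    by (simp add: mom_const_def)
qed

text \<open>Dyadic annuli around the boundary: where \<open>1 - r\<close> is about \<open>2^j / n\<close>, the power \<open>r^n\<close> is at most
  \<open>exp (- 2^j)\<close>, which beats the growth \<open>C^j\<close> of the tail.\<close>

lemma mom_le_tail:
  assumes n: "n > 0"
  shows "mom n \<le> mom_const * H (1 - 1 / real n)"
proof -
  define t where "t = 1 / real n"
  have t: "0 < t" "t \<le> 1" using n by (auto simp: t_def)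
  define A where "A j = {max 0 (1 - 2 ^ j * t)..<1}" for j
  have A: "A j \<subseteq> {0..<1}" "A j \<in> sets borel" for j
    by (auto simp: A_def)
  note int = integrable_power[OF A, unfolded set_integrable_def] integrable_sub[OF A, unfolded set_integrable_def]
  \<comment> \<open>Passing from \<open>A j\<close> to \<open>A (Suc j)\<close> costs at most
    \<open>exp (- (2 ^ j))\<close> times the full tail over \<open>A (Suc j)\<close>, and that tail
    is at most \<open>C ^ Suc j * H (1 - t)\<close>.\<close>
  have main: "(LINT r:A j|lborel. r ^ n * \<omega> r) \<le> (1 + (\<Sum>i<j. exp (- (2 ^ i)) * C ^ Suc i)) * H (1 - t)" for j
  proof (induction j)
    case 0
    have "(LINT r:A 0|lborel. r ^ n * \<omega> r) \<le> (LINT r:A 0|lborel. \<omega> r)"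
      unfolding set_lebesgue_integral_def
      using t nonneg by (intro integral_mono int)
        (auto simp: indicator_def A_def intro!: mult_left_le_one_le power_le_one)
    then show ?case
      using t by (simp add: A_def tail_eq)
  next
    case (Suc j)
    have "(LINT r:A (Suc j)|lborel. r ^ n * \<omega> r)
        \<le> (LINT r|lborel. indicator (A j) r *\<^sub>R (r ^ n * \<omega> r) + exp (- (2 ^ j)) * (indicator (A (Suc j)) r *\<^sub>R \<omega> r))"
      unfolding set_lebesgue_integral_def
    proof (rule integral_mono)
      fix r :: real
      show "indicat_real (A (Suc j)) r *\<^sub>R (r ^ n * \<omega> r)
         \<le> indicator (A j) r *\<^sub>R (r ^ n * \<omega> r) + exp (- (2 ^ j)) * (indicator (A (Suc j)) r *\<^sub>R \<omega> r)"
      proof (cases "r \<in> A (Suc j) \<and> r \<notin> A j")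
        case True
        then have r: "0 \<le> r" "r < 1" "r < 1 - 2 ^ j * t"
          by (auto simp: A_def)
        have "r ^ n \<le> exp (- (1 - r)) ^ n"
          using r exp_ge_add_one_self[of "- (1 - r)"] by (intro power_mono) auto
        also have "\<dots> = exp (- (real n * (1 - r)))"
          unfolding exp_of_nat_mult[symmetric] by (simp add: algebra_simps)
        also have "2 ^ j \<le> real n * (1 - r)"
          using r(3) n by (simp add: t_def field_simps)
        then have "exp (- (real n * (1 - r))) \<le> exp (- (2 ^ j))"
          by simp
        finally show ?thesis
          using True nonneg by (auto simp: indicator_def intro!: mult_right_mono)
      next
        case False
        have "0 \<le> r" if "r \<in> A j"
          using that by (auto simp: A_def)
        with False show ?thesis
          using nonneg by (auto simp: indicator_def)
      qed
    qed (use int in auto)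
    also have "\<dots> = (LINT r:A j|lborel. r ^ n * \<omega> r) + exp (- (2 ^ j)) * H (max 0 (1 - 2 ^ Suc j * t))"
    proof -
      have "H (max 0 (1 - 2 ^ Suc j * t)) = (LINT r|lborel. indicator (A (Suc j)) r *\<^sub>R \<omega> r)"
        by (simp only: tail_eq A_def set_lebesgue_integral_def)
      then show ?thesis
        unfolding set_lebesgue_integral_def using int
        by (subst Bochner_Integration.integral_add) (simp_all del: real_scaleR_def mult_scaleR_right)
    qed
    also have "\<dots> \<le> (1 + (\<Sum>i<j. exp (- (2 ^ i)) * C ^ Suc i)) * H (1 - t) + exp (- (2 ^ j)) * (C ^ Suc j * H (1 - t))"
      by (intro add_mono Suc mult_left_mono tail_doubling_iterate t) auto
    finally show ?case
      by (simp add: algebra_simps)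
  qed
  \<comment> \<open>After \<open>n\<close> steps the sets have exhausted \<open>[0,1)\<close>, so
    the finite induction already reaches the moment.\<close>
  have "real n \<le> 2 ^ n"
    using of_nat_less_two_power[of n, where 'a = real] by linarith
  then have "1 \<le> 2 ^ n * t"
    using n by (simp add: t_def)
  then have "A n = {0..<1}"
    by (simp add: A_def)
  then have "mom n \<le> (1 + (\<Sum>i<n. exp (- (2 ^ i)) * C ^ Suc i)) * H (1 - t)"
    using main[of n] by (simp add: mom_def)
  also have "\<dots> \<le> mom_const * H (1 - t)"
    unfolding mom_const_def using summable_doubly_exponential C_ge_1 tail_pos[of "1 - t"] t
    by (intro mult_right_mono add_left_mono sum_le_suminf) auto
  finally show ?thesis
    by (simp add: t_def)
qed

text \<open>At \<open>r = 1 - 1 / (2 n)\<close> Bernoulli gives \<open>r ^ n \<ge> 1 / 2\<close>,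
  hence \<open>r ^ (2 n) \<ge> 1 / 4\<close> and the factor \<open>4\<close>; one doubling step from
  \<open>1 - 1 / n\<close> to \<open>r\<close> gives the factor \<open>C\<close>. Together with
  \<open>mom_le_tail\<close> this transfers doubling from tails to moments.\<close>

lemma tail_le_mom:
  assumes n: "n > 0"
  shows "H (1 - 1 / real n) \<le> 4 * C * mom (2 * n)"
proof -
  define r where "r = 1 - 1 / (2 * real n)"
  have r: "0 \<le> r" "r < 1" using n by (auto simp: r_def field_simps)
  have "1 / 2 \<le> 1 + real n * (- (1 / (2 * real n)))"
    using n by simp
  also have "\<dots> \<le> (1 + (- (1 / (2 * real n)))) ^ n"
    using n by (intro Bernoulli_inequality) (auto simp: field_simps)
  finally have "1 / 2 \<le> r ^ n"
    by (simp add: r_def)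
  then have "(1 / 2)\<^sup>2 \<le> (r ^ n)\<^sup>2"
    by (intro power_mono) auto
  then have "1 / 4 \<le> r ^ (2 * n)"
    by (simp flip: power_mult add: mult.commute power_divide)
  then have "1 / 4 * H r \<le> r ^ (2 * n) * H r"
    using r tail_pos[of r] by (intro mult_right_mono) auto
  also have "\<dots> \<le> mom (2 * n)"
    using r by (rule mom_ge)
  finally have "H r \<le> 4 * mom (2 * n)"
    by simp
  moreover have "H (1 - 1 / real n) \<le> C * H r"
  proof -
    have "(1 + (1 - 1 / real n)) / 2 = r"
      by (simp add: r_def field_simps)
    then show ?thesis
      using doubling[of "1 - 1 / real n"] n by simp
  qed
  moreover have "C * H r \<le> C * (4 * mom (2 * n))"
    using C_ge_1 calculation(1) by (intro mult_left_mono) auto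
  ultimately show ?thesis
    by simp
qed

definition D :: real where "D = 4 * C * mom_const"

lemma D_ge_1: "1 \<le> D"
proof -
  have "1 * 1 \<le> (4 * C) * mom_const"
    using C_ge_1 mom_const_ge_1 by (intro mult_mono) auto
  then show ?thesis
    by (simp add: D_def)
qed

lemma mom_doubling:
  assumes n: "n > 0"
  shows "mom n \<le> D * mom (2 * n)"
proof -
  have "mom n \<le> mom_const * H (1 - 1 / real n)"
    using n by (rule mom_le_tail)
  also have "\<dots> \<le> mom_const * (4 * C * mom (2 * n))"
    using mom_const_ge_1 by (intro mult_left_mono tail_le_mom n) auto
  finally show ?thesis
    by (simp add: D_def ac_simps)
qed

lemma mom_doubling_iterate:
  assumes "n > 0"
  shows "mom n \<le> D ^ k * mom (2 ^ k * n)"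
proof (induction k)
  case (Suc k)
  have "D ^ k * mom (2 ^ k * n) \<le> D ^ k * (D * mom (2 * (2 ^ k * n)))"
    using D_ge_1 assms by (intro mult_left_mono mom_doubling) auto
  with Suc show ?case
    by (simp add: ac_simps)
qed simp

text \<open>Four doublings suffice, as
  \<open>2 n + 1 \<le> 16 j + 1 \<le> 2 ^ 4 * (2 j + 1)\<close>. The range \<open>8 * j\<close> is
  the upper end of the dyadic block attached to \<open>j\<close>.\<close>

lemma coeff_le:
  assumes "n \<le> 8 * j"
  shows "coeff n \<le> D ^ 4 * coeff j"
proof -
  have "mom (2 * j + 1) \<le> D ^ 4 * mom (2 ^ 4 * (2 * j + 1))"
    by (rule mom_doubling_iterate) simp
  also have "\<dots> \<le> D ^ 4 * mom (2 * n + 1)"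
    using assms D_ge_1 by (intro mult_left_mono mom_antimono) auto
  finally show ?thesis
    using mom_pos D_ge_1 by (simp add: coeff_def field_simps)
qed

text \<open>The coefficients vary at relative rate \<open>1 / n\<close>. The difference of the
  moments is the integral of \<open>r^(2n+1) (1 - r^2) \<omega>\<close>; its factor
  \<open>r^n (1 - r)\<close> is at most \<open>1 / n\<close>, and the remaining moment of order
  \<open>n + 1\<close> returns to order \<open>2 n + 3\<close> by two doublings.\<close>

lemma coeff_diff_le:
  assumes n: "n > 0"
  shows "coeff (Suc n) - coeff n \<le> 2 * D\<^sup>2 * coeff n / real n"
proof -
  have int: "integrable lborel (\<lambda>x. indicat_real {0..<1} x *\<^sub>R (x ^ n * \<omega> x))" for n
    using integrable_power[of "{0..<1}" n] unfolding set_integrable_def by auto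
  have "mom (2 * n + 1) - mom (2 * n + 3)
      = (LINT r|lborel. indicat_real {0..<1} r *\<^sub>R (r ^ (2 * n + 1) * \<omega> r) - indicat_real {0..<1} r *\<^sub>R (r ^ (2 * n + 3) * \<omega> r))"
    unfolding mom_def set_lebesgue_integral_def by (rule Bochner_Integration.integral_diff[symmetric]) (rule int)+
  also have "\<dots> \<le> (LINT r|lborel. 2 / real n * (indicat_real {0..<1} r *\<^sub>R (r ^ (n + 1) * \<omega> r)))"
  proof (rule integral_mono)
    fix r :: real
    show "indicat_real {0..<1} r *\<^sub>R (r ^ (2 * n + 1) * \<omega> r) - indicat_real {0..<1} r *\<^sub>R (r ^ (2 * n + 3) * \<omega> r)
       \<le> 2 / real n * (indicat_real {0..<1} r *\<^sub>R (r ^ (n + 1) * \<omega> r))"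
    proof (cases "r \<in> {0..<1}")
      case True
      have "real n * (r ^ n * (1 - r)) * (1 + r) \<le> 1 * 2"
        using True by (intro mult_mono power_mult_one_minus_le) auto
      then have "r ^ n * (1 - r) * (1 + r) \<le> 2 / real n"
        using n by (simp add: field_simps)
      then have "r ^ n * (1 - r) * (1 + r) * (r ^ (n + 1) * \<omega> r) \<le> 2 / real n * (r ^ (n + 1) * \<omega> r)"
        using True nonneg by (intro mult_right_mono) auto
      also have "r ^ n * (1 - r) * (1 + r) * (r ^ (n + 1) * \<omega> r) = r ^ (2 * n + 1) * \<omega> r - r ^ (2 * n + 3) * \<omega> r"
        unfolding mult_2 power_add power3_eq_cube by (simp add: algebra_simps)
      finally show ?thesis
        using True by simp
    qed simp
  qed (intro Bochner_Integration.integrable_diff integrable_mult_right int)+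
  also have "\<dots> = 2 / real n * mom (n + 1)"
    by (simp add: mom_def set_lebesgue_integral_def)
  also have "\<dots> \<le> 2 / real n * (D\<^sup>2 * mom (2 ^ 2 * (n + 1)))"
    by (intro mult_left_mono mom_doubling_iterate) auto
  also have "\<dots> \<le> 2 / real n * (D\<^sup>2 * mom (2 * n + 3))"
    by (intro mult_left_mono mom_antimono) auto
  finally have *: "mom (2 * n + 1) - mom (2 * n + 3) \<le> 2 * D\<^sup>2 / real n * mom (2 * n + 3)"
    by simp
  have "coeff (Suc n) - coeff n = (mom (2 * n + 1) - mom (2 * n + 3)) / (2 * mom (2 * n + 1) * mom (2 * n + 3))"
    using mom_pos[of "2 * n + 1"] mom_pos[of "2 * n + 3"]
    by (simp add: coeff_def field_simps numeral_3_eq_3)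
  also have "\<dots> \<le> (2 * D\<^sup>2 / real n * mom (2 * n + 3)) / (2 * mom (2 * n + 1) * mom (2 * n + 3))"
    using mom_pos[of "2 * n + 1"] mom_pos[of "2 * n + 3"] by (intro divide_right_mono *) auto
  also have "\<dots> = 2 * D\<^sup>2 * coeff n / real n"
    using mom_pos[of "2 * n + 3"] by (simp add: coeff_def)
  finally show ?thesis .
qed

end

text \<open>The condition in \<open>D_hat\<close> holds only near \<open>1\<close>. On the remaining
  interval \<open>[0,b]\<close> the quotient of the tails is at most
  \<open>H 0 / H ((1 + b) / 2)\<close>, so a larger constant makes it global.\<close>

lemma (in borel_weight) doubling_weightI:
  assumes "\<omega> \<in> D_hat"
  obtains C where "doubling_weight \<omega> C"
proof -
  obtain C0 where C0: "C0 > 0" "\<forall>\<^sub>F r in at_left 1. H r \<le> C0 * H ((1 + r) / 2)"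
    using assms by (auto simp: D_hat_def)
  then obtain b0 where b0: "b0 < 1" "\<And>r. b0 < r \<Longrightarrow> r < 1 \<Longrightarrow> H r \<le> C0 * H ((1 + r) / 2)"
    by (auto simp: eventually_at_left_field)
  define b where "b = max 0 b0"
  have b: "0 \<le> b" "b < 1" using b0 by (auto simp: b_def)
  define C where "C = max C0 (H 0 / H ((1 + b) / 2))"
  have Hb: "0 < H ((1 + b) / 2)"
    using b by (intro tail_pos) auto
  show thesis
  proof (rule that, unfold_locales)
    have "H ((1 + b) / 2) \<le> H 0"
      using b by (intro tail_antimono) auto
    then show "1 \<le> C"
      using Hb by (simp add: C_def le_max_iff_disj)
    fix r :: real assume r: "0 \<le> r" "r < 1"
    have H_pos: "0 < H ((1 + r) / 2)"
      using r by (intro tail_pos) auto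
    show "H r \<le> C * H ((1 + r) / 2)"
    proof (cases "b < r")
      case True
      then have "H r \<le> C0 * H ((1 + r) / 2)"
        using b0 r by (simp add: b_def)
      also have "\<dots> \<le> C * H ((1 + r) / 2)"
        using H_pos by (intro mult_right_mono) (auto simp: C_def)
      finally show ?thesis .
    next
      case False
      have "H r \<le> H 0"
        using r by (intro tail_antimono) auto
      also have "\<dots> = H 0 / H ((1 + b) / 2) * H ((1 + b) / 2)"
        using Hb by simp
      also have "\<dots> \<le> C * H ((1 + r) / 2)"
        using False r b Hb tail_pos[of 0]
        by (intro mult_mono tail_antimono) (auto simp: C_def le_max_iff_disj less_imp_le)
      finally show ?thesis .
    qed
  qed
qed

section \<open>Weighted tails under the reverse doubling condition\<close>

context borel_weight
begin

lemma integrable_truncated_powr: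
  assumes "A \<subseteq> {0..<c}" "A \<in> sets borel" "c < 1" "0 < a"
  shows "set_integrable lborel A (\<lambda>r. (1 - r) powr (- a) * \<omega> r)"
proof (rule integrable_mult)
  fix r assume "r \<in> A"
  then have "0 \<le> r" "r < c" using assms by auto
  then show "\<bar>(1 - r) powr (- a)\<bar> \<le> (1 - c) powr (- a)"
    using assms by (auto intro!: powr_mono2')
qed (use assms in auto)

text \<open>Peel off the layer from \<open>\<rho>\<close> to \<open>\<rho>'\<close> with
  \<open>1 - \<rho>' = (1 - \<rho>) / K\<close>: on it the power grows by at most
  \<open>K powr a\<close>, while the tail beyond it loses the factor \<open>L\<close>. The layers
  form a geometric series of ratio \<open>K powr a / L\<close>, and \<open>M\<close> is its sum, the
  solution of \<open>M = K powr a + M * (K powr a / L)\<close>. The truncation keeps the integrals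
  finite, as integrability up to \<open>1\<close> is still to be derived from this bound.\<close>

lemma truncated_weighted_tail_le:
  assumes K: "1 < K" and a: "0 < a" and L: "K powr a < L"
    and tail: "\<And>\<rho>. r0 \<le> \<rho> \<Longrightarrow> \<rho> < 1 \<Longrightarrow> L * H (1 - (1 - \<rho>) / K) \<le> H \<rho>"
    and M: "M = K powr a / (1 - K powr a / L)"
    and \<rho>: "0 \<le> r0" "r0 \<le> \<rho>" "\<rho> < 1"
  shows "(LINT r:{\<rho>..<1 - (1 - \<rho>) / K ^ m}|lborel. (1 - r) powr (- a) * \<omega> r) \<le> M * (1 - \<rho>) powr (- a) * H \<rho>"
  using \<rho>
proof (induction m arbitrary: \<rho>)
  case 0
  have "0 < K powr a"
    using K by simp
  with L have "0 < L" by linarith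
  then have "K powr a / L < 1"
    using L by simp
  then have "0 \<le> M"
    unfolding M using \<open>0 < K powr a\<close> by auto
  then show ?case
    using tail_pos[of \<rho>] 0 by (simp add: set_lebesgue_integral_def)
next
  case (Suc m)
  define \<rho>' where "\<rho>' = 1 - (1 - \<rho>) / K"
  define e where "e = 1 - (1 - \<rho>) / K ^ Suc m"
  have Kp: "0 < K powr a"
    using K by simp
  with L have L0: "0 < L" by linarith
  then have KL: "K powr a / L < 1"
    using L by simp
  have M0: "0 \<le> M"
    unfolding M using Kp KL by auto
  have "(1 - \<rho>) / K \<le> (1 - \<rho>) / 1"
    using K Suc.prems by (intro divide_left_mono) auto
  then have \<rho>': "\<rho> \<le> \<rho>'" "\<rho>' < 1" "r0 \<le> \<rho>'" "0 \<le> \<rho>'"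
    using K Suc.prems by (auto simp: \<rho>'_def)
  have e: "e = 1 - (1 - \<rho>') / K ^ m" "\<rho>' \<le> e" "e < 1"
  proof -
    show "e = 1 - (1 - \<rho>') / K ^ m"
      by (simp add: e_def \<rho>'_def)
    have "(1 - \<rho>') / K ^ m \<le> (1 - \<rho>') / 1"
      using K \<rho>' by (intro divide_left_mono) auto
    then show "\<rho>' \<le> e"
      unfolding \<open>e = 1 - (1 - \<rho>') / K ^ m\<close> by simp
    show "e < 1"
      using K Suc.prems by (simp add: e_def)
  qed
  have sub: "{\<rho>..<\<rho>'} \<subseteq> {0..<\<rho>'}" "{\<rho>'..<e} \<subseteq> {0..<e}" "{\<rho>..<\<rho>'} \<subseteq> {0..<1}"
    using Suc.prems \<rho>' by auto
  have int: "set_integrable lborel {\<rho>..<\<rho>'} (\<lambda>r. (1 - r) powr (- a) * \<omega> r)"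
      "set_integrable lborel {\<rho>'..<e} (\<lambda>r. (1 - r) powr (- a) * \<omega> r)"
    using sub \<rho>' e a by (auto intro: integrable_truncated_powr)
  have "(LINT r:{\<rho>..<e}|lborel. (1 - r) powr (- a) * \<omega> r)
      = (LINT r:{\<rho>..<\<rho>'} \<union> {\<rho>'..<e}|lborel. (1 - r) powr (- a) * \<omega> r)"
    using \<rho>' e by (simp add: ivl_disj_un)
  also have "\<dots> = (LINT r:{\<rho>..<\<rho>'}|lborel. (1 - r) powr (- a) * \<omega> r) + (LINT r:{\<rho>'..<e}|lborel. (1 - r) powr (- a) * \<omega> r)"
    by (intro set_integral_Un int) auto
  also have "(LINT r:{\<rho>..<\<rho>'}|lborel. (1 - r) powr (- a) * \<omega> r) \<le> K powr a * (1 - \<rho>) powr (- a) * H \<rho>"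
  proof -
    have "(LINT r:{\<rho>..<\<rho>'}|lborel. (1 - r) powr (- a) * \<omega> r)
        \<le> (LINT r:{\<rho>..<1}|lborel. (K powr a * (1 - \<rho>) powr (- a)) * \<omega> r)"
      unfolding set_lebesgue_integral_def
    proof (rule integral_mono)
      show "integrable lborel (\<lambda>r. indicat_real {\<rho>..<\<rho>'} r *\<^sub>R ((1 - r) powr (- a) * \<omega> r))"
        using int(1) by (simp add: set_integrable_def)
      show "integrable lborel (\<lambda>r. indicat_real {\<rho>..<1} r *\<^sub>R ((K powr a * (1 - \<rho>) powr (- a)) * \<omega> r))"
        using integrable_mult[of "{\<rho>..<1}" "\<lambda>_. K powr a * (1 - \<rho>) powr (- a)" "K powr a * (1 - \<rho>) powr (- a)"] Suc.prems
        by (auto simp: set_integrable_def)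
      fix r :: real
      show "indicat_real {\<rho>..<\<rho>'} r *\<^sub>R ((1 - r) powr (- a) * \<omega> r)
          \<le> indicat_real {\<rho>..<1} r *\<^sub>R ((K powr a * (1 - \<rho>) powr (- a)) * \<omega> r)"
      proof (cases "r \<in> {\<rho>..<\<rho>'}")
        case True
        then have "(1 - \<rho>) / K \<le> 1 - r"
          by (auto simp: \<rho>'_def)
        then have "(1 - r) powr (- a) \<le> ((1 - \<rho>) / K) powr (- a)"
          using K Suc.prems a by (intro powr_mono2') auto
        also have "\<dots> = K powr a * (1 - \<rho>) powr (- a)"
          using K Suc.prems by (simp add: powr_divide powr_minus field_simps)
        finally show ?thesis
          using True \<rho>' nonneg by (auto intro: mult_right_mono)
      next
        case False
        then show ?thesis
          using nonneg by (auto simp: indicator_def)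
      qed
    qed
    then show ?thesis
      by (simp add: tail_eq)
  qed
  also have "(LINT r:{\<rho>'..<e}|lborel. (1 - r) powr (- a) * \<omega> r) \<le> M * (1 - \<rho>') powr (- a) * H \<rho>'"
    unfolding e(1) using \<rho>' Suc.prems by (intro Suc.IH) auto
  also have "(1 - \<rho>') powr (- a) = K powr a * (1 - \<rho>) powr (- a)"
    using K Suc.prems by (simp add: \<rho>'_def powr_divide powr_minus field_simps)
  also have "M * (K powr a * (1 - \<rho>) powr (- a)) * H \<rho>' \<le> M * (K powr a * (1 - \<rho>) powr (- a)) * (H \<rho> / L)"
    using tail[of \<rho>] Suc.prems L0 M0 by (intro mult_left_mono) (auto simp: \<rho>'_def field_simps)
  also have "K powr a * (1 - \<rho>) powr (- a) * H \<rho> + M * (K powr a * (1 - \<rho>) powr (- a)) * (H \<rho> / L)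
      = (K powr a + M * (K powr a / L)) * ((1 - \<rho>) powr (- a) * H \<rho>)"
    by (simp add: algebra_simps)
  also have "K powr a + M * (K powr a / L) = M"
  proof -
    define q where "q = K powr a / L"
    have "M * (1 - q) = K powr a"
      using KL unfolding M q_def[symmetric] by simp
    then have "K powr a + M * q = M"
      by (simp add: algebra_simps)
    then show ?thesis
      by (simp add: q_def)
  qed
  finally show ?case
    by (simp only: e_def) (simp add: ac_simps)
qed

lemma D_check_weighted_tail:
  assumes "\<omega> \<in> D_check"
  obtains a M where "0 < a" "a < 1" "0 \<le> M"
    "\<And>\<rho>. 0 \<le> \<rho> \<Longrightarrow> \<rho> < 1 \<Longrightarrow> set_integrable lborel {\<rho>..<1} (\<lambda>r. (1 - r) powr (- a) * \<omega> r)"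
    "\<And>\<rho>. 0 \<le> \<rho> \<Longrightarrow> \<rho> < 1 \<Longrightarrow> (LINT r:{\<rho>..<1}|lborel. (1 - r) powr (- a) * \<omega> r) \<le> M * (1 - \<rho>) powr (- a) * H \<rho>"
proof -
  obtain K L where K: "K > 1" and L: "L > 1"
    and ev: "\<forall>\<^sub>F r in at_left 1. H r \<ge> L * H (1 - (1 - r) / K)"
    using assms by (auto simp: D_check_def)
  then obtain b0 where b0: "b0 < 1" "\<And>r. b0 < r \<Longrightarrow> r < 1 \<Longrightarrow> L * H (1 - (1 - r) / K) \<le> H r"
    by (auto simp: eventually_at_left_field)
  \<comment> \<open>The midpoint lies strictly above \<open>b0\<close>, so the hypothesis, valid for
    \<open>r > b0\<close>, covers the closed range \<open>r0 \<le> \<rho>\<close>.\<close>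
  define r0 where "r0 = max 0 ((1 + b0) / 2)"
  have r0: "0 \<le> r0" "r0 < 1" "b0 < r0" using b0 by (auto simp: r0_def less_max_iff_disj)
  \<comment> \<open>Half of \<open>log K L\<close>, so that
    \<open>K powr a \<le> sqrt L < L\<close>; the cap \<open>1 / 2\<close> keeps
    \<open>a < 1\<close>.\<close>
  define a where "a = min (1 / 2) (ln L / (2 * ln K))"
  have a: "0 < a" "a < 1"
    using K L by (auto simp: a_def)
  have "a * ln K \<le> ln L / (2 * ln K) * ln K"
    using K by (intro mult_right_mono) (auto simp: a_def)
  also have "\<dots> < ln L"
    using K L by simp
  finally have "exp (a * ln K) < exp (ln L)"
    by simp
  then have KL: "K powr a < L"
    using K L by (simp add: powr_def)
  define M0 where "M0 = K powr a / (1 - K powr a / L)"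
  define g where "g r = (1 - r) powr (- a) * \<omega> r" for r
  have g_nonneg: "0 \<le> g r" for r
    using nonneg by (simp add: g_def)
  have [measurable]: "g \<in> borel_measurable borel"
    unfolding g_def by measurable
  have M0: "0 \<le> M0"
    using K L KL by (simp add: M0_def)
  \<comment> \<open>Monotone convergence along the truncations at \<open>e m\<close>, whose bound
    does not depend on \<open>m\<close>, yields integrability and the estimate together.\<close>
  have near: "set_integrable lborel {\<rho>..<1} g" "(LINT r:{\<rho>..<1}|lborel. g r) \<le> M0 * (1 - \<rho>) powr (- a) * H \<rho>"
    if \<rho>: "r0 \<le> \<rho>" "\<rho> < 1" for \<rho>
  proof -
    define e where "e m = 1 - (1 - \<rho>) / K ^ m" for m
    define f where "f m r = indicator {\<rho>..<e m} r *\<^sub>R g r" for m r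
    have e_lim: "e \<longlonglongrightarrow> 1"
    proof -
      have "(\<lambda>m. 1 - (1 - \<rho>) * (1 / K) ^ m) \<longlonglongrightarrow> 1 - (1 - \<rho>) * 0"
        using K by (intro tendsto_intros LIMSEQ_realpow_zero) auto
      then show ?thesis
        by (simp add: e_def[abs_def] divide_inverse power_inverse)
    qed
    have e_mono: "e m \<le> e n" if "m \<le> n" for m n
      using that K \<rho> by (auto simp: e_def intro!: divide_left_mono power_increasing)
    have e_lt: "e m < 1" for m
      using K \<rho> by (simp add: e_def)
    have f_int: "integrable lborel (f m)" for m
      using integrable_truncated_powr[of "{\<rho>..<e m}" "e m" a] e_lt[of m] a r0 \<rho>
      by (auto simp: f_def[abs_def] g_def set_integrable_def)
    have f_le: "integral\<^sup>L lborel (f m) \<le> M0 * (1 - \<rho>) powr (- a) * H \<rho>" for m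
      using truncated_weighted_tail_le[OF K a(1) KL _ M0_def r0(1) \<rho>, of m] b0(2) r0(3)
      by (simp add: f_def[abs_def] e_def g_def set_lebesgue_integral_def)
    have f_mono: "f m r \<le> f n r" if "m \<le> n" for m n r
      using e_mono[OF that] g_nonneg by (auto simp: f_def indicator_def)
    have f_lim: "(\<lambda>m. f m r) \<longlonglongrightarrow> indicator {\<rho>..<1} r *\<^sub>R g r" for r
    proof (cases "r \<in> {\<rho>..<1}")
      case True
      then have "\<forall>\<^sub>F m in sequentially. r < e m"
        using order_tendstoD(1)[OF e_lim] by auto
      then have "\<forall>\<^sub>F m in sequentially. f m r = indicator {\<rho>..<1} r *\<^sub>R g r"
        by eventually_elim (use True in \<open>auto simp: f_def indicator_def\<close>)
      then show ?thesis
        by (rule tendsto_eventually)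
    next
      case False
      then have "f m r = 0" for m
        using e_lt[of m] by (auto simp: f_def indicator_def)
      then show ?thesis
        using False by simp
    qed
    have "incseq (\<lambda>m. integral\<^sup>L lborel (f m))"
      by (intro incseq_SucI integral_mono f_int f_mono) auto
    then obtain l where l: "(\<lambda>m. integral\<^sup>L lborel (f m)) \<longlonglongrightarrow> l"
      using incseq_convergent f_le by metis
    have mono: "AE r in lborel. mono (\<lambda>m. f m r)"
      using f_mono by (auto simp: mono_def)
    have lim: "AE r in lborel. (\<lambda>m. f m r) \<longlonglongrightarrow> indicator {\<rho>..<1} r *\<^sub>R g r"
      using f_lim by simp
    have meas: "(\<lambda>r. indicator {\<rho>..<1} r *\<^sub>R g r) \<in> borel_measurable lborel"
      by measurable
    note conv = integrable_monotone_convergence[OF f_int mono lim l meas]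
      integral_monotone_convergence[OF f_int mono lim l meas]
    show "set_integrable lborel {\<rho>..<1} g"
      using conv(1) by (simp add: set_integrable_def)
    have "l \<le> M0 * (1 - \<rho>) powr (- a) * H \<rho>"
      using l f_le by (intro LIMSEQ_le_const2) auto
    then show "(LINT r:{\<rho>..<1}|lborel. g r) \<le> M0 * (1 - \<rho>) powr (- a) * H \<rho>"
      using conv(2) by (simp add: set_lebesgue_integral_def)
  qed
  \<comment> \<open>For \<open>\<rho> < r0\<close> the part below \<open>r0\<close> contributes at
    most \<open>(1 - r0) powr (- a) * H \<rho>\<close> and the part beyond it at most
    \<open>M0\<close> times the same quantity.\<close>
  define M where "M = (1 + M0) * (1 - r0) powr (- a)"
  have r0_powr: "1 \<le> (1 - \<rho>) powr (- a)" if "0 \<le> \<rho>" "\<rho> < 1" for \<rho>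
    using that a powr_mono2'[of "- a" "1 - \<rho>" 1] by simp
  have "M0 * 1 \<le> (1 + M0) * (1 - r0) powr (- a)"
    using M0 r0_powr[of r0] r0 by (intro mult_mono) auto
  then have M0_le: "M0 \<le> M"
    by (simp add: M_def)
  have main: "set_integrable lborel {\<rho>..<1} g \<and> (LINT r:{\<rho>..<1}|lborel. g r) \<le> M * (1 - \<rho>) powr (- a) * H \<rho>"
    if \<rho>: "0 \<le> \<rho>" "\<rho> < 1" for \<rho>
  proof (cases "r0 \<le> \<rho>")
    case True
    have "M0 * (1 - \<rho>) powr (- a) * H \<rho> \<le> M * (1 - \<rho>) powr (- a) * H \<rho>"
      using M0_le tail_pos[OF \<rho>] by (intro mult_right_mono) auto
    with near[OF True \<rho>(2)] show ?thesis
      by simp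
  next
    case False
    have int: "set_integrable lborel {\<rho>..<r0} g"
      unfolding g_def using \<rho> r0 a by (intro integrable_truncated_powr[of _ r0]) auto
    have un: "{\<rho>..<1} = {\<rho>..<r0} \<union> {r0..<1}"
      using False r0 by auto
    have "(LINT r:{\<rho>..<1}|lborel. g r) = (LINT r:{\<rho>..<r0}|lborel. g r) + (LINT r:{r0..<1}|lborel. g r)"
      unfolding un using r0 by (intro set_integral_Un int near) auto
    also have "(LINT r:{\<rho>..<r0}|lborel. g r) \<le> (1 - r0) powr (- a) * H \<rho>"
    proof -
      have "(LINT r:{\<rho>..<r0}|lborel. g r) \<le> (LINT r:{\<rho>..<1}|lborel. (1 - r0) powr (- a) * \<omega> r)"
        unfolding set_lebesgue_integral_def
      proof (rule integral_mono)
        show "integrable lborel (\<lambda>r. indicat_real {\<rho>..<r0} r *\<^sub>R g r)"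
          using int by (simp add: set_integrable_def)
        show "integrable lborel (\<lambda>r. indicat_real {\<rho>..<1} r *\<^sub>R ((1 - r0) powr (- a) * \<omega> r))"
          using integrable_mult[of "{\<rho>..<1}" "\<lambda>_. (1 - r0) powr (- a)" "(1 - r0) powr (- a)"] \<rho>
          by (auto simp: set_integrable_def)
        fix r :: real
        show "indicat_real {\<rho>..<r0} r *\<^sub>R g r \<le> indicat_real {\<rho>..<1} r *\<^sub>R ((1 - r0) powr (- a) * \<omega> r)"
          using r0 nonneg a by (auto simp: indicator_def g_def intro!: mult_right_mono powr_mono2')
      qed
      then show ?thesis
        by (simp add: tail_eq)
    qed
    also have "(LINT r:{r0..<1}|lborel. g r) \<le> M0 * (1 - r0) powr (- a) * H r0"
      using r0 by (intro near) auto
    also have "\<dots> \<le> M0 * (1 - r0) powr (- a) * H \<rho>"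
      using False M0 \<rho> by (intro mult_left_mono tail_antimono) auto
    also have "(1 - r0) powr (- a) * H \<rho> + M0 * (1 - r0) powr (- a) * H \<rho> = M * 1 * H \<rho>"
      by (simp add: M_def algebra_simps)
    also have "\<dots> \<le> M * (1 - \<rho>) powr (- a) * H \<rho>"
      using r0_powr[OF \<rho>] tail_pos[OF \<rho>] M0 M0_le by (intro mult_right_mono mult_left_mono) auto
    finally have "(LINT r:{\<rho>..<1}|lborel. g r) \<le> M * (1 - \<rho>) powr (- a) * H \<rho>"
      by simp
    moreover have "set_integrable lborel {\<rho>..<1} g"
      unfolding un using r0 by (intro set_integrable_Un int near) auto
    ultimately show ?thesis
      by simp
  qed
  show thesis
  proof (rule that)
    show "0 \<le> M" using M0 M0_le by simp
    show "set_integrable lborel {\<rho>..<1} (\<lambda>r. (1 - r) powr - a * \<omega> r)"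
      "(LINT r:{\<rho>..<1}|lborel. (1 - r) powr (- a) * \<omega> r) \<le> M * (1 - \<rho>) powr (- a) * H \<rho>"
      if "0 \<le> \<rho>" "\<rho> < 1" for \<rho>
      using main[OF that] by (auto simp: g_def[abs_def])
  qed (use a in auto)
qed

end

subsection \<open>Power series of the Bergman kernel\<close>

text \<open>The sum is split where \<open>2 ^ i\<close> passes \<open>1 / (1 - x)\<close>. Below,
  the terms are at most \<open>q ^ i\<close> with \<open>q = 2 powr a > 1\<close>, so the last one
  dominates; above, \<open>2 ^ i * x ^ (2 ^ i) * (1 - x) \<le> 1\<close> bounds them by
  \<open>p ^ i / (1 - x)\<close> with \<open>p = 2 powr (a - 1) < 1\<close>, so the first one
  dominates.\<close>

lemma sum_dyadic_powr_le:
  fixes a x :: real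
  assumes a: "0 < a" "a < 1" and x: "0 \<le> x" "x < 1"
  shows "(\<Sum>i<I. (2 ^ i) powr a * x ^ (2 ^ i))
      \<le> (2 powr a / (2 powr a - 1) + 1 / (1 - 2 powr (a - 1))) * (1 - x) powr (- a)"
proof -
  define t where "t = 1 - x"
  have t: "0 < t" "t \<le> 1" using x by (auto simp: t_def)
  define f where "f i = (2 ^ i) powr a * x ^ (2 ^ i)" for i :: nat
  have f_nonneg: "0 \<le> f i" for i
    using x by (simp add: f_def)
  define q where "q = (2 :: real) powr a"
  define p where "p = (2 :: real) powr (a - 1)"
  have q: "1 < q" and p: "0 < p" "p < 1"
    using a powr_less_mono[of "a - 1" 0 2] by (auto simp: q_def p_def)
  have powq: "(2 ^ i) powr a = q ^ i" and powp: "(2 ^ i) powr (a - 1) = p ^ i" for i :: nat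
    by (simp_all add: q_def p_def powr_powr powr_realpow[symmetric] mult.commute)
  obtain k :: nat where k: "2 ^ k \<le> 1 / t" "1 / t < 2 ^ Suc k"
  proof -
    obtain n :: nat where n: "1 / t < 2 ^ n"
      using real_arch_pow[of 2 "1 / t"] by auto
    define m where "m = (LEAST n. 1 / t < (2 :: real) ^ n)"
    have m: "1 / t < 2 ^ m"
      unfolding m_def using n by (rule LeastI)
    have "m \<noteq> 0"
      using m t by (intro notI) (simp add: field_simps)
    then obtain k where "m = Suc k"
      using not0_implies_Suc by blast
    moreover have "\<not> 1 / t < 2 ^ k"
      using not_less_Least[of k "\<lambda>n. 1 / t < (2 :: real) ^ n"] \<open>m = Suc k\<close> by (auto simp: m_def)
    ultimately show thesis
      using that[of k] m by (simp add: not_less)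
  qed
  have split: "(\<Sum>i<m + n. f i) = (\<Sum>i<m. f i) + (\<Sum>i<n. f (m + i))" for m n
    by (induction n) auto
  have "(\<Sum>i<I. f i) \<le> (\<Sum>i<Suc k + I. f i)"
    using f_nonneg by (intro sum_mono2) auto
  also have "\<dots> = (\<Sum>i<Suc k. f i) + (\<Sum>i<I. f (Suc k + i))"
    by (rule split)
  also have "(\<Sum>i<Suc k. f i) \<le> q / (q - 1) * t powr (- a)"
  proof -
    have "(\<Sum>i<Suc k. f i) \<le> (\<Sum>i<Suc k. q ^ i)"
      using x q by (intro sum_mono) (auto simp: f_def powq intro!: mult_right_le_one_le power_le_one)
    also have "\<dots> = (q ^ Suc k - 1) / (q - 1)"
      using q by (subst geometric_sum) auto
    also have "\<dots> \<le> q ^ Suc k / (q - 1)"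
      using q by (intro divide_right_mono) auto
    also have "\<dots> = q / (q - 1) * (2 ^ k) powr a"
      by (simp add: powq)
    also have "\<dots> \<le> q / (q - 1) * (1 / t) powr a"
      using k a q by (intro mult_left_mono powr_mono2) auto
    also have "(1 / t) powr a = t powr (- a)"
      using t by (simp add: powr_divide powr_minus inverse_eq_divide)
    finally show ?thesis .
  qed
  also have "(\<Sum>i<I. f (Suc k + i)) \<le> 1 / (1 - p) * t powr (- a)"
  proof -
    have f_le: "f i \<le> p ^ i / t" for i
    proof -
      have "real (2 ^ i) * (x ^ (2 ^ i) * t) \<le> 1"
        unfolding t_def using x by (intro power_mult_one_minus_le) auto
      then have "x ^ (2 ^ i) \<le> 1 / (2 ^ i * t)"
        using t by (simp add: field_simps)
      then have "f i \<le> (2 ^ i) powr a * (1 / (2 ^ i * t))"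
        unfolding f_def by (intro mult_left_mono) auto
      also have "\<dots> = (2 ^ i) powr (a - 1) / t"
        by (simp add: powr_diff)
      finally show ?thesis
        by (simp add: powp)
    qed
    have "(\<Sum>i<I. f (Suc k + i)) \<le> (\<Sum>i<I. p ^ (Suc k + i) / t)"
      by (intro sum_mono f_le)
    also have "\<dots> = p ^ Suc k / t * (\<Sum>i<I. p ^ i)"
      by (simp add: power_add sum_distrib_left mult.assoc)
    also have "\<dots> \<le> p ^ Suc k / t * (1 / (1 - p))"
    proof (intro mult_left_mono)
      have "(\<Sum>i<I. p ^ i) \<le> (\<Sum>i. p ^ i)"
        using p by (intro sum_le_suminf) auto
      also have "\<dots> = 1 / (1 - p)"
        using p by (intro suminf_geometric) auto
      finally show "(\<Sum>i<I. p ^ i) \<le> 1 / (1 - p)" .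
    qed (use p t in auto)
    also have "\<dots> \<le> (1 / t) powr (a - 1) / t * (1 / (1 - p))"
    proof (intro mult_right_mono divide_right_mono)
      show "p ^ Suc k \<le> (1 / t) powr (a - 1)"
        unfolding powp[symmetric] using k t a by (intro powr_mono2') auto
    qed (use p t in auto)
    also have "(1 / t) powr (a - 1) / t = t powr (- a)"
      using t by (simp add: powr_divide powr_diff powr_minus field_simps)
    finally show ?thesis
      by (simp add: mult.commute)
  qed
  finally show ?thesis
    by (simp add: f_def q_def p_def t_def algebra_simps)
qed

context borel_weight
begin

definition ker :: "complex \<Rightarrow> complex" where
  "ker w = (\<Sum>n. of_real (coeff n) * w ^ n)"

lemma bergman_kernel_eq: "bergman_kernel \<omega> z \<zeta> = ker (cnj z * \<zeta>)"
proof -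
  have "moment \<omega> (2 * real n + 1) = mom (2 * n + 1)" for n
    using moment_eq[of "2 * n + 1"] by (simp add: add.commute)
  then show ?thesis
    unfolding bergman_kernel_def ker_def by (intro suminf_cong) (simp add: coeff_def)
qed

lemma norm_coeff: "norm (complex_of_real (coeff n) * w ^ n) = coeff n * cmod w ^ n"
  using coeff_pos[of n] by (simp add: norm_mult norm_power)

lemma summable_ker: "cmod w < 1 \<Longrightarrow> summable (\<lambda>n. complex_of_real (coeff n) * w ^ n)"
  by (rule summable_norm_cancel) (simp only: norm_coeff summable_coeff norm_ge_zero)

lemma norm_ker_le:
  assumes "cmod w \<le> s" "s < 1"
  shows "cmod (ker w) \<le> (\<Sum>n. coeff n * s ^ n)"
proof -
  have s: "0 \<le> s"
    using assms norm_ge_zero order.trans by blast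
  have "cmod (ker w) \<le> (\<Sum>n. coeff n * cmod w ^ n)"
    unfolding ker_def using assms
    by (intro order.trans[OF summable_norm]) (simp_all only: norm_coeff summable_coeff norm_ge_zero order.refl le_less_trans)
  also have "\<dots> \<le> (\<Sum>n. coeff n * s ^ n)"
    using assms s coeff_pos
    by (intro suminf_le summable_coeff mult_left_mono power_mono) (auto intro: less_imp_le)
  finally show ?thesis .
qed

lemma cnj_ker:
  assumes "cmod w < 1"
  shows "cnj (ker w) = ker (cnj w)"
proof -
  have "(\<lambda>n. complex_of_real (coeff n) * w ^ n) sums ker w"
    unfolding ker_def using summable_ker[OF assms] by (rule summable_sums)
  then have "(\<lambda>n. cnj (complex_of_real (coeff n) * w ^ n)) sums cnj (ker w)"
    by (simp only: sums_cnj)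
  then show ?thesis
    by (simp add: ker_def sums_iff)
qed

lemma ker_measurable [measurable]: "ker \<in> borel_measurable borel"
  unfolding ker_def[abs_def] by measurable

text \<open>Termwise integration with the majorant \<open>coeff n * |z| ^ n\<close> times
  \<open>|f| \<omega>\<close>. The power series serves twice: it makes the projection holomorphic,
  and it exhibits the Taylor coefficients for which the test function is designed.\<close>

lemma bergman_projection_power_series:
  assumes f [measurable]: "f \<in> borel_measurable disc_area"
    and int: "integrable disc_area (\<lambda>\<zeta>. f \<zeta> * of_real (\<omega> (cmod \<zeta>)))"
    and z: "cmod z < 1"
  shows "integrable disc_area (bergman_integrand \<omega> f z)"
    and "(\<lambda>n. of_real (coeff n) * (LINT \<zeta>|disc_area. f \<zeta> * cnj \<zeta> ^ n * of_real (\<omega> (cmod \<zeta>))) * z ^ n)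
      sums bergman_projection \<omega> f z"
proof -
  define g where "g n \<zeta> = of_real (coeff n) * (z * cnj \<zeta>) ^ n * (f \<zeta> * of_real (\<omega> (cmod \<zeta>)))" for n \<zeta>
  have [measurable]: "(\<lambda>\<zeta>. of_real (\<omega> (cmod \<zeta>)) :: complex) \<in> borel_measurable disc_area"
    by (rule borel_measurable_disc_area) measurable
  have [measurable]: "(\<lambda>\<zeta>. cnj \<zeta>) \<in> borel_measurable disc_area"
    by (intro borel_measurable_disc_area borel_measurable_continuous_onI continuous_intros)
  have bound: "norm (g n \<zeta>) \<le> coeff n * cmod z ^ n * norm (f \<zeta> * of_real (\<omega> (cmod \<zeta>)))" if "cmod \<zeta> < 1" for n \<zeta>
  proof -
    have "cmod (z * cnj \<zeta>) \<le> cmod z"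
      using that by (simp add: norm_mult mult_left_le)
    then have "coeff n * cmod (z * cnj \<zeta>) ^ n \<le> coeff n * cmod z ^ n"
      using coeff_pos[of n] by (intro mult_left_mono power_mono) auto
    then show ?thesis
      unfolding g_def norm_mult[of "of_real (coeff n) * (z * cnj \<zeta>) ^ n"] norm_coeff
      by (intro mult_right_mono) auto
  qed
  have g_eq: "g n \<zeta> = (of_real (coeff n) * z ^ n) * (f \<zeta> * cnj \<zeta> ^ n * of_real (\<omega> (cmod \<zeta>)))" for n \<zeta>
    by (simp add: g_def power_mult_distrib ac_simps)
  have [measurable]: "g n \<in> borel_measurable disc_area" for n
    unfolding g_def[abs_def] by measurable
  have g_int: "integrable disc_area (g n)" for n
  proof (rule Bochner_Integration.integrable_bound)
    show "integrable disc_area (\<lambda>\<zeta>. coeff n * cmod z ^ n * norm (f \<zeta> * of_real (\<omega> (cmod \<zeta>))))"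
      using int by (intro integrable_mult_right integrable_norm)
    show "AE \<zeta> in disc_area. norm (g n \<zeta>) \<le> norm (coeff n * cmod z ^ n * norm (f \<zeta> * of_real (\<omega> (cmod \<zeta>))))"
    proof (rule AE_I2)
      fix \<zeta> assume "\<zeta> \<in> space disc_area"
      then have "cmod \<zeta> < 1" by simp
      from bound[OF this, of n]
      show "norm (g n \<zeta>) \<le> norm (coeff n * cmod z ^ n * norm (f \<zeta> * of_real (\<omega> (cmod \<zeta>))))"
        unfolding real_norm_def by linarith
    qed
  qed simp
  have sum: "summable (\<lambda>n. coeff n * cmod z ^ n)"
    using z by (intro summable_coeff) auto
  have AE_sum: "AE \<zeta> in disc_area. summable (\<lambda>n. norm (g n \<zeta>))"
  proof (intro AE_I2)
    fix \<zeta> assume "\<zeta> \<in> space disc_area"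
    then have "cmod \<zeta> < 1" by simp
    from bound[OF this] show "summable (\<lambda>n. norm (g n \<zeta>))"
      by (intro summable_comparison_test'[where N = 0, OF summable_mult2[OF sum]]) (simp only: real_norm_def abs_norm_cancel)
  qed
  have sum_int: "summable (\<lambda>n. LINT \<zeta>|disc_area. norm (g n \<zeta>))"
  proof (rule summable_comparison_test'[where N = 0])
    show "summable (\<lambda>n. coeff n * cmod z ^ n * (LINT \<zeta>|disc_area. norm (f \<zeta> * of_real (\<omega> (cmod \<zeta>)))))"
      by (rule summable_mult2[OF sum])
    fix n
    have "(LINT \<zeta>|disc_area. norm (g n \<zeta>)) \<le> (LINT \<zeta>|disc_area. coeff n * cmod z ^ n * norm (f \<zeta> * of_real (\<omega> (cmod \<zeta>))))"
      using int bound by (intro integral_mono integrable_norm g_int integrable_mult_right) auto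
    then show "norm (LINT \<zeta>|disc_area. norm (g n \<zeta>)) \<le> coeff n * cmod z ^ n * (LINT \<zeta>|disc_area. norm (f \<zeta> * of_real (\<omega> (cmod \<zeta>))))"
      by simp
  qed
  have eq: "(\<Sum>n. g n \<zeta>) = bergman_integrand \<omega> f z \<zeta>" if "cmod \<zeta> < 1" for \<zeta>
  proof -
    have "cmod z * cmod \<zeta> < 1"
      using mult_strict_mono'[of "cmod z" 1 "cmod \<zeta>" 1] z that by simp
    then have w: "cmod (z * cnj \<zeta>) < 1"
      by (simp add: norm_mult)
    then have "(\<lambda>n. g n \<zeta>) sums (ker (z * cnj \<zeta>) * (f \<zeta> * of_real (\<omega> (cmod \<zeta>))))"
      unfolding g_def ker_def by (intro sums_mult2 summable_sums summable_ker)
    moreover have "cnj (ker (cnj z * \<zeta>)) = ker (z * cnj \<zeta>)"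
      using w by (subst cnj_ker) (auto simp: norm_mult)
    ultimately show ?thesis
      by (simp add: sums_iff bergman_integrand_def bergman_kernel_eq ac_simps)
  qed
  have "integrable disc_area (\<lambda>\<zeta>. \<Sum>n. g n \<zeta>)"
    by (rule integrable_suminf[OF g_int AE_sum sum_int])
  then show "integrable disc_area (bergman_integrand \<omega> f z)"
    by (subst Bochner_Integration.integrable_cong[OF refl, of _ _ "\<lambda>\<zeta>. \<Sum>n. g n \<zeta>"]) (auto simp: eq)
  have "(\<lambda>n. integral\<^sup>L disc_area (g n)) sums (LINT \<zeta>|disc_area. (\<Sum>n. g n \<zeta>))"
    by (rule sums_integral[OF g_int AE_sum sum_int])
  also have "(LINT \<zeta>|disc_area. (\<Sum>n. g n \<zeta>)) = bergman_projection \<omega> f z"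
    unfolding bergman_projection_def by (intro Bochner_Integration.integral_cong) (auto simp: eq)
  also have "(\<lambda>n. integral\<^sup>L disc_area (g n))
      = (\<lambda>n. of_real (coeff n) * (LINT \<zeta>|disc_area. f \<zeta> * cnj \<zeta> ^ n * of_real (\<omega> (cmod \<zeta>))) * z ^ n)"
    unfolding g_eq integral_mult_right_zero by (simp add: ac_simps)
  finally show "(\<lambda>n. of_real (coeff n) * (LINT \<zeta>|disc_area. f \<zeta> * cnj \<zeta> ^ n * of_real (\<omega> (cmod \<zeta>))) * z ^ n)
      sums bergman_projection \<omega> f z" .
qed

lemma bergman_projection_holomorphic:
  assumes "f \<in> borel_measurable disc_area"
    and "integrable disc_area (\<lambda>\<zeta>. f \<zeta> * of_real (\<omega> (cmod \<zeta>)))"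
  shows "bergman_projection \<omega> f holomorphic_on unit_disc"
  by (rule power_series_holomorphic[where a = "\<lambda>n. of_real (coeff n) * (LINT \<zeta>|disc_area. f \<zeta> * cnj \<zeta> ^ n * of_real (\<omega> (cmod \<zeta>)))"])
     (use bergman_projection_power_series(2)[OF assms] in simp)

end

section \<open>Piecewise linear dyadic partition of the coefficients\<close>

definition cutoff :: "real \<Rightarrow> nat \<Rightarrow> real" where
  "cutoff J n = max 0 (min 1 (2 - real n / J))"

lemma cutoff_bounds: "0 \<le> cutoff J n" "cutoff J n \<le> 1"
  by (auto simp: cutoff_def)

lemma cutoff_eq_1: "0 < J \<Longrightarrow> real n \<le> J \<Longrightarrow> cutoff J n = 1"
  by (auto simp: cutoff_def min_def)

lemma cutoff_eq_0: "0 < J \<Longrightarrow> 2 * J \<le> real n \<Longrightarrow> cutoff J n = 0"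
  by (auto simp: cutoff_def max_def min_def field_simps)

lemma cutoff_mono: "0 < I \<Longrightarrow> I \<le> J \<Longrightarrow> cutoff I n \<le> cutoff J n"
  unfolding cutoff_def by (intro max.mono min.mono diff_left_mono divide_left_mono) auto

text \<open>This slope is the reason for the linear ramp from \<open>J\<close> to
  \<open>2 J\<close>: a sharp cutoff would jump by \<open>1\<close>, and the increments of a block
  would no longer be smaller than its coefficients by the factor \<open>1 / j\<close>.\<close>

lemma cutoff_Suc:
  assumes J: "0 < J"
  shows "\<bar>cutoff J (Suc n) - cutoff J n\<bar> \<le> 1 / J"
proof -
  have lip: "\<bar>max 0 (min 1 (2 - (x + d))) - max 0 (min 1 (2 - x))\<bar> \<le> d" if "0 < d" for x d :: real
    using that by (auto simp: max_def min_def abs_if)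
  have "real (Suc n) / J = real n / J + 1 / J"
    by (simp add: add_divide_distrib)
  then show ?thesis
    unfolding cutoff_def using lip[of "1 / J" "real n / J"] J by simp
qed

text \<open>The difference of two consecutive dyadic cutoffs, so that sums over
  \<open>j = 2 ^ i\<close> telescope; for \<open>j > 0\<close> it lives on
  \<open>2 j < n < 8 j\<close>.\<close>

definition hat :: "nat \<Rightarrow> nat \<Rightarrow> real" where
  "hat j n = cutoff (4 * real j) n - cutoff (2 * real j) n"

lemma hat_nonneg: "0 < j \<Longrightarrow> 0 \<le> hat j n"
  using cutoff_mono[of "2 * real j" "4 * real j" n] by (simp add: hat_def)

lemma hat_le_1: "hat j n \<le> 1"
  using cutoff_bounds[of "2 * real j" n] cutoff_bounds[of "4 * real j" n] by (simp add: hat_def)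

lemma hat_eq_0: "0 < j \<Longrightarrow> n \<le> 2 * j \<or> 8 * j \<le> n \<Longrightarrow> hat j n = 0"
  by (auto simp: hat_def cutoff_eq_0 cutoff_eq_1)

lemma hat_Suc: "0 < j \<Longrightarrow> \<bar>hat j (Suc n) - hat j n\<bar> \<le> 1 / real j"
  using cutoff_Suc[of "2 * real j" n] cutoff_Suc[of "4 * real j" n]
  by (auto simp: hat_def field_simps abs_le_iff)

lemma cutoff_eq_sum_hat:
  "cutoff (2 ^ Suc I) n = cutoff 2 n + (\<Sum>i<I. hat (2 ^ i) n)"
  by (induction I) (auto simp: hat_def)

context doubling_weight
begin

text \<open>The shift by \<open>2 * j\<close> reflects that \<open>w ^ (2 * j)\<close> is factored
  out of the block: part of its modulus goes into the radial density, and a polynomial of degree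
  below \<open>6 * j\<close> remains to be estimated.\<close>

definition block_coeff :: "nat \<Rightarrow> nat \<Rightarrow> real" where
  "block_coeff j m = hat j (m + 2 * j) * coeff (m + 2 * j)"

text \<open>A discrete product rule with three contributions: the increment of \<open>hat\<close>,
  the increment of \<open>coeff\<close>, and the \<open>1 / j\<close> in the factor
  \<open>1 - 1 / j\<close>. Each is at most \<open>D ^ 6 * coeff j / j\<close>: comparing
  \<open>coeff n\<close> with \<open>coeff j\<close> takes four powers of \<open>D\<close>, and
  \<open>coeff_diff_le\<close> takes two more.\<close>

lemma block_coeff_diff_le:
  assumes j: "0 < j"
  shows "\<bar>block_coeff j (Suc m) - (1 - 1 / real j) * block_coeff j m\<bar> \<le> 3 * D ^ 6 * coeff j / real j"
proof (cases "m < 6 * j")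
  case False
  then show ?thesis
    using j coeff_pos[of j] D_ge_1 by (simp add: block_coeff_def hat_eq_0)
next
  case True
  define n where "n = m + 2 * j"
  have n: "2 * j \<le> n" "Suc n \<le> 8 * j" "0 < n"
    using True j by (auto simp: n_def)
  have D46: "D ^ 4 \<le> D ^ 6"
    using D_ge_1 by (intro power_increasing) auto
  have cn: "coeff n \<le> D ^ 4 * coeff j" and cSn: "coeff (Suc n) \<le> D ^ 4 * coeff j"
    using n by (auto intro!: coeff_le)
  have D4: "D ^ 4 * coeff j \<le> D ^ 6 * coeff j"
    using D46 coeff_pos[of j] by (intro mult_right_mono) auto
  have "block_coeff j (Suc m) - (1 - 1 / real j) * block_coeff j m
      = (hat j (Suc n) - hat j n) * coeff (Suc n) + hat j n * (coeff (Suc n) - coeff n) + hat j n * coeff n / real j"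
    by (simp add: block_coeff_def n_def algebra_simps)
  also have "\<bar>\<dots>\<bar> \<le> \<bar>(hat j (Suc n) - hat j n) * coeff (Suc n)\<bar> + \<bar>hat j n * (coeff (Suc n) - coeff n)\<bar> + \<bar>hat j n * coeff n / real j\<bar>"
    by linarith
  also have "\<dots> \<le> D ^ 6 * coeff j / real j + D ^ 6 * coeff j / real j + D ^ 6 * coeff j / real j"
  proof (intro add_mono)
    have "\<bar>hat j (Suc n) - hat j n\<bar> * \<bar>coeff (Suc n)\<bar> \<le> 1 / real j * (D ^ 4 * coeff j)"
      using hat_Suc[OF j] cSn coeff_pos[of "Suc n"] by (intro mult_mono) auto
    then show "\<bar>(hat j (Suc n) - hat j n) * coeff (Suc n)\<bar> \<le> D ^ 6 * coeff j / real j"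
      using divide_right_mono[OF D4, of "real j"] by (simp add: abs_mult)
    have "hat j n * coeff n \<le> 1 * (D ^ 4 * coeff j)"
      using hat_nonneg[OF j, of n] hat_le_1[of j n] cn coeff_pos[of n] by (intro mult_mono) auto
    then have "hat j n * coeff n / real j \<le> D ^ 6 * coeff j / real j"
      using D4 by (intro divide_right_mono) auto
    then show "\<bar>hat j n * coeff n / real j\<bar> \<le> D ^ 6 * coeff j / real j"
      using hat_nonneg[OF j, of n] hat_le_1[of j n] coeff_pos[of n] by (simp add: abs_mult)
    have "coeff (Suc n) - coeff n \<le> 2 * D\<^sup>2 * coeff n / real n"
      using n by (intro coeff_diff_le)
    also have "\<dots> \<le> 2 * D\<^sup>2 * (D ^ 4 * coeff j) / real (2 * j)"
      using n j D_ge_1 cn coeff_pos[of j] by (intro frac_le mult_left_mono) auto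
    also have "\<dots> = D ^ 6 * coeff j / real j"
      by (simp add: power_add[symmetric])
    finally have "hat j n * (coeff (Suc n) - coeff n) \<le> 1 * (D ^ 6 * coeff j / real j)"
      using hat_nonneg[OF j, of n] hat_le_1[of j n] coeff_mono[of n "Suc n"] by (intro mult_mono) auto
    then show "\<bar>hat j n * (coeff (Suc n) - coeff n)\<bar> \<le> D ^ 6 * coeff j / real j"
      using hat_nonneg[OF j, of n] hat_le_1[of j n] coeff_mono[of n "Suc n"] by (simp add: abs_mult)
  qed
  finally show ?thesis
    by (simp add: ac_simps)
qed

text \<open>Here \<open>63 = 7 * 3 ^ 2\<close>: after multiplication by \<open>1 - \<rho> w\<close>
  there are at most \<open>7 j\<close> coefficients, each bounded by
  \<open>3 * D ^ 6 * coeff j / j\<close>. The summand \<open>1\<close> belongs to the geometric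
  series, and the halving to \<open>2 x y \<le> \<tau> x^2 + y^2 / \<tau>\<close>.\<close>

definition block_const :: real where
  "block_const = (63 * D ^ 12 + 1) / 2"

lemma block_const_nonneg: "0 \<le> block_const"
  using D_ge_1 by (simp add: block_const_def)

lemma integral_block_le:
  assumes G: "radial_density G" and b: "cmod b \<le> 1" and j: "0 < j"
  shows "(LINT z|disc_area. cmod (\<Sum>m<6 * j. of_real (block_coeff j m) * (b * z) ^ m) * G (cmod z))
     \<le> block_const * coeff j * (LINT z|disc_area. G (cmod z))"
proof -
  interpret radial_density G by (rule G)
  define X where "X = 3 * D ^ 6 * coeff j / real j"
  define \<rho> where "\<rho> = 1 - 1 / real j"
  \<comment> \<open>This choice gives both terms the order \<open>coeff j\<close>:
    \<open>7 j\<close> times \<open>X^2\<close> is a constant times \<open>(coeff j)^2 / j\<close>,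
    and \<open>1 / (1 - \<rho>^2)\<close> is at most \<open>j\<close>.\<close>
  define \<tau> where "\<tau> = real j / coeff j"
  have \<rho>: "0 \<le> \<rho>" "\<rho> < 1" using j by (auto simp: \<rho>_def)
  have \<tau>: "0 < \<tau>" using j coeff_pos by (simp add: \<tau>_def)
  have X: "0 \<le> X" using D_ge_1 coeff_pos[of j] by (simp add: X_def)
  have "(LINT z|disc_area. cmod (\<Sum>m<6 * j. of_real (block_coeff j m) * (b * z) ^ m) * G (cmod z))
     \<le> (\<tau> * (real (Suc (6 * j)) * X\<^sup>2) + 1 / (\<tau> * (1 - \<rho>\<^sup>2))) / 2 * (LINT z|disc_area. G (cmod z))"
  proof (rule integral_norm_poly_le[OF b \<rho> \<tau>])
    show "\<bar>block_coeff j 0\<bar> \<le> X"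
      using X j by (simp add: block_coeff_def hat_eq_0)
    show "\<bar>block_coeff j (Suc m) - \<rho> * block_coeff j m\<bar> \<le> X" for m
      unfolding \<rho>_def X_def by (rule block_coeff_diff_le[OF j])
    show "block_coeff j m = 0" if "6 * j \<le> m" for m
      using that j by (simp add: block_coeff_def hat_eq_0)
  qed
  also have "\<dots> \<le> (63 * D ^ 12 * coeff j + coeff j) / 2 * (LINT z|disc_area. G (cmod z))"
  proof (intro mult_right_mono divide_right_mono add_mono)
    have "\<tau> * (real (Suc (6 * j)) * X\<^sup>2) \<le> \<tau> * (real (7 * j) * X\<^sup>2)"
      using \<tau> j by (intro mult_left_mono mult_right_mono) auto
    also have "\<dots> = 63 * D ^ 12 * coeff j"
      using j coeff_pos[of j] by (simp add: \<tau>_def X_def power_divide power_mult_distrib field_simps)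
        (simp add: power2_eq_square power_add[symmetric])
    finally show "\<tau> * (real (Suc (6 * j)) * X\<^sup>2) \<le> 63 * D ^ 12 * coeff j" .
    have "1 / real j \<le> 1 - \<rho>\<^sup>2"
      using mult_left_le[of \<rho> \<rho>] \<rho> by (simp add: \<rho>_def power2_eq_square)
    moreover have "0 < 1 / real j"
      using j by simp
    ultimately have pos: "0 < 1 - \<rho>\<^sup>2" and "1 / real j \<le> 1 - \<rho>\<^sup>2"
      by linarith+
    then have "\<tau> * (1 / real j) \<le> \<tau> * (1 - \<rho>\<^sup>2)"
      using \<tau> by (intro mult_left_mono) auto
    then have "1 / (\<tau> * (1 - \<rho>\<^sup>2)) \<le> 1 / (\<tau> * (1 / real j))"
      using \<tau> j pos by (intro divide_left_mono mult_pos_pos) auto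
    also have "\<dots> = coeff j"
      using j by (simp add: \<tau>_def)
    finally show "1 / (\<tau> * (1 - \<rho>\<^sup>2)) \<le> coeff j" .
  qed (use G_nonneg in auto)
  also have "\<dots> = block_const * coeff j * (LINT z|disc_area. G (cmod z))"
    by (simp add: block_const_def field_simps)
  finally show ?thesis .
qed

definition block :: "nat \<Rightarrow> complex \<Rightarrow> complex" where
  "block j w = (\<Sum>n<8 * j. of_real (hat j n * coeff n) * w ^ n)"

lemma block_eq:
  assumes "0 < j"
  shows "block j w = w ^ (2 * j) * (\<Sum>m<6 * j. of_real (block_coeff j m) * w ^ m)"
proof -
  have "block j w = (\<Sum>n\<in>{2 * j..<8 * j}. of_real (hat j n * coeff n) * w ^ n)"
    unfolding block_def using assms by (intro sum.mono_neutral_right) (auto simp: hat_eq_0)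
  also have "\<dots> = (\<Sum>m<6 * j. of_real (block_coeff j m) * w ^ (m + 2 * j))"
    using sum.shift_bounds_nat_ivl[of "\<lambda>n. of_real (hat j n * coeff n) * w ^ n" 0 "2 * j" "6 * j"]
    by (simp add: block_coeff_def lessThan_atLeast0)
  finally show ?thesis
    by (simp add: power_add sum_distrib_left ac_simps)
qed

end

section \<open>Integrals of the kernel against the weighted density \<open>\<Omega>\<close>\<close>

locale regular_weight = doubling_weight +
  fixes a M :: real
  assumes a: "0 < a" "a < 1" and M_nonneg: "0 \<le> M"
    and weighted_integrable: "\<And>\<rho>. 0 \<le> \<rho> \<Longrightarrow> \<rho> < 1 \<Longrightarrow> set_integrable lborel {\<rho>..<1} (\<lambda>r. (1 - r) powr (- a) * \<omega> r)"
    and weighted_tail: "\<And>\<rho>. 0 \<le> \<rho> \<Longrightarrow> \<rho> < 1 \<Longrightarrow>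
        (LINT r:{\<rho>..<1}|lborel. (1 - r) powr (- a) * \<omega> r) \<le> M * (1 - \<rho>) powr (- a) * H \<rho>"
begin

text \<open>This majorizes \<open>|f| \<omega>\<close> when \<open>|f|\<close> is at most
  \<open>(1 - r) powr (- a)\<close>; boundedness amounts to integrating the modulus of the kernel
  against it.\<close>

definition \<Omega> :: "real \<Rightarrow> real" where
  "\<Omega> r = (1 - r) powr (- a) * \<omega> r"

lemma \<Omega>_borel [measurable]: "\<Omega> \<in> borel_measurable borel"
  unfolding \<Omega>_def[abs_def] by measurable

lemma \<Omega>_nonneg: "0 \<le> \<Omega> r"
  using nonneg by (simp add: \<Omega>_def)

lemma integrable_power_\<Omega>:
  assumes "A \<subseteq> {0..<1}" "A \<in> sets borel"
  shows "set_integrable lborel A (\<lambda>r. r ^ n * \<Omega> r)"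
proof (rule set_integrable_subset)
  show "set_integrable lborel {0..<1} (\<lambda>r. r ^ n * \<Omega> r)"
  proof (rule set_integrable_bound)
    show "set_integrable lborel {0..<1} \<Omega>"
      using weighted_integrable[of 0] by (simp add: \<Omega>_def[abs_def])
    show "set_borel_measurable lborel {0..<1} (\<lambda>r. r ^ n * \<Omega> r)"
      unfolding set_borel_measurable_def by measurable
    show "AE r in lborel. r \<in> {0..<1} \<longrightarrow> norm (r ^ n * \<Omega> r) \<le> norm (\<Omega> r)"
      using \<Omega>_nonneg by (intro AE_I2) (auto simp: abs_mult intro!: mult_left_le_one_le power_le_one)
  qed
qed (use assms in auto)

text \<open>Cut at \<open>1 - 1 / n\<close>: below,
  \<open>(1 - r) powr (- a) \<le> n powr a\<close>; beyond, \<open>weighted_tail\<close> applies and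
  \<open>tail_le_mom\<close> turns the tail back into a moment.\<close>

lemma weighted_moment_le:
  assumes n: "0 < n"
  shows "(LINT r:{0..<1}|lborel. r ^ n * \<Omega> r) \<le> (1 + 4 * C * M) * real n powr a * mom n"
proof -
  define \<rho> where "\<rho> = 1 - 1 / real n"
  have \<rho>: "0 \<le> \<rho>" "\<rho> < 1" using n by (auto simp: \<rho>_def)
  have powr_eq: "(1 - \<rho>) powr (- a) = real n powr a"
    using n by (simp add: \<rho>_def powr_minus powr_divide)
  have "(LINT r:{0..<1}|lborel. r ^ n * \<Omega> r)
      \<le> (LINT r|lborel. real n powr a * (indicat_real {0..<1} r *\<^sub>R (r ^ n * \<omega> r)) + indicat_real {\<rho>..<1} r *\<^sub>R \<Omega> r)"
    unfolding set_lebesgue_integral_def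
  proof (rule integral_mono)
    show "integrable lborel (\<lambda>r. indicat_real {0..<1} r *\<^sub>R (r ^ n * \<Omega> r))"
      using integrable_power_\<Omega>[of "{0..<1}" n] by (simp add: set_integrable_def)
    show "integrable lborel (\<lambda>r. real n powr a * (indicat_real {0..<1} r *\<^sub>R (r ^ n * \<omega> r)) + indicat_real {\<rho>..<1} r *\<^sub>R \<Omega> r)"
      using integrable_power[of "{0..<1}" n] weighted_integrable[OF \<rho>]
      by (intro Bochner_Integration.integrable_add integrable_mult_right) (auto simp: set_integrable_def \<Omega>_def)
    fix r :: real
    show "indicat_real {0..<1} r *\<^sub>R (r ^ n * \<Omega> r)
       \<le> real n powr a * (indicat_real {0..<1} r *\<^sub>R (r ^ n * \<omega> r)) + indicat_real {\<rho>..<1} r *\<^sub>R \<Omega> r"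
    proof (cases "r \<in> {0..<1}")
      case True
      show ?thesis
      proof (cases "r < \<rho>")
        case less: True
        then have "(1 - r) powr (- a) \<le> (1 - \<rho>) powr (- a)"
          using a \<rho> by (intro powr_mono2') auto
        then have "(1 - r) powr (- a) * (r ^ n * \<omega> r) \<le> real n powr a * (r ^ n * \<omega> r)"
          unfolding powr_eq using True nonneg by (intro mult_right_mono) auto
        then show ?thesis
          using True less by (simp add: \<Omega>_def ac_simps)
      next
        case False
        then have "r ^ n * \<Omega> r \<le> \<Omega> r"
          using True \<Omega>_nonneg by (auto intro!: mult_left_le_one_le power_le_one)
        moreover have "0 \<le> real n powr a * (r ^ n * \<omega> r)"
          using True nonneg by auto
        ultimately show ?thesis
          using True False by simp
      qed
    qed (use \<Omega>_nonneg in \<open>auto simp: indicator_def\<close>)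
  qed
  also have "\<dots> = real n powr a * mom n + (LINT r:{\<rho>..<1}|lborel. \<Omega> r)"
    using integrable_power[of "{0..<1}" n] weighted_integrable[OF \<rho>]
    unfolding mom_def set_lebesgue_integral_def set_integrable_def \<Omega>_def
    by (subst Bochner_Integration.integral_add) auto
  also have "(LINT r:{\<rho>..<1}|lborel. \<Omega> r) \<le> M * (1 - \<rho>) powr (- a) * H \<rho>"
    unfolding \<Omega>_def by (rule weighted_tail[OF \<rho>])
  also have "\<dots> \<le> M * (1 - \<rho>) powr (- a) * (4 * C * mom n)"
  proof (intro mult_left_mono)
    have "H \<rho> \<le> 4 * C * mom (2 * n)"
      unfolding \<rho>_def by (rule tail_le_mom[OF n])
    also have "\<dots> \<le> 4 * C * mom n"
      using C_ge_1 by (intro mult_left_mono mom_antimono) auto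
    finally show "H \<rho> \<le> 4 * C * mom n" .
  qed (use M_nonneg in auto)
  also have "real n powr a * mom n + M * (1 - \<rho>) powr (- a) * (4 * C * mom n) = (1 + 4 * C * M) * real n powr a * mom n"
    unfolding powr_eq by (simp add: algebra_simps)
  finally show ?thesis
    by simp
qed

text \<open>The absolute value keeps the density nonnegative at negative arguments, as
  \<open>radial_density\<close> demands; on \<open>[0,1)\<close> it changes nothing.\<close>

lemma radial_density_power_\<Omega>: "radial_density (\<lambda>r. \<bar>r\<bar> ^ n * \<Omega> r)"
proof
  show "(\<lambda>r. \<bar>r\<bar> ^ n * \<Omega> r) \<in> borel_measurable borel"
    by measurable
  show "0 \<le> \<bar>r\<bar> ^ n * \<Omega> r" for r
    using \<Omega>_nonneg by simp
  show "integrable disc_area (\<lambda>z. \<bar>cmod z\<bar> ^ n * \<Omega> (cmod z))"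
  proof (subst integrable_disc_area_radial_iff)
    have "set_integrable lborel {0..<1} (\<lambda>r. 2 * (r ^ Suc n * \<Omega> r))"
      by (intro set_integrable_mult_right integrable_power_\<Omega>) auto
    then show "set_integrable lborel {0..<1} (\<lambda>r. 2 * r * (\<bar>r\<bar> ^ n * \<Omega> r))"
      by (rule set_integrable_cong[THEN iffD1, rotated 3]) auto
  qed measurable
qed

text \<open>The factor \<open>2 r\<close> of the radial measure raises the exponent
  \<open>2 j\<close> to \<open>2 j + 1\<close>, the one in \<open>coeff j\<close>. The moment
  cancels, and only the growth caused by the power weight is left.\<close>

lemma integral_power_\<Omega>_le:
  "coeff j * (LINT z|disc_area. cmod z ^ (2 * j) * \<Omega> (cmod z)) \<le> (1 + 4 * C * M) * real (2 * j + 1) powr a"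
proof -
  have "(LINT z|disc_area. cmod z ^ (2 * j) * \<Omega> (cmod z)) = (LINT r:{0..<1}|lborel. 2 * r * (r ^ (2 * j) * \<Omega> r))"
    by (rule integral_disc_area_radial) measurable
  also have "\<dots> = 2 * (LINT r:{0..<1}|lborel. r ^ (2 * j + 1) * \<Omega> r)"
    by (simp add: ac_simps flip: set_integral_mult_right)
  also have "\<dots> \<le> 2 * ((1 + 4 * C * M) * real (2 * j + 1) powr a * mom (2 * j + 1))"
    by (intro mult_left_mono weighted_moment_le) auto
  finally have "coeff j * (LINT z|disc_area. cmod z ^ (2 * j) * \<Omega> (cmod z))
      \<le> coeff j * (2 * ((1 + 4 * C * M) * real (2 * j + 1) powr a * mom (2 * j + 1)))"
    using coeff_pos[of j] by (intro mult_left_mono) auto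
  also have "\<dots> = (1 + 4 * C * M) * real (2 * j + 1) powr a"
    using mom_pos[of "2 * j + 1"] by (simp add: coeff_def)
  finally show ?thesis .
qed

text \<open>In \<open>|b z| ^ (2 j)\<close> the part \<open>|z| ^ (2 j)\<close> joins the density
  and supplies the cancelling moment, whereas \<open>|b| ^ (2 j)\<close> stays outside. It is
  weakened to \<open>|b| ^ j\<close> to fit \<open>sum_dyadic_powr_le\<close> at
  \<open>j = 2 ^ i\<close>; the factor \<open>3\<close> comes from \<open>2 j + 1 \<le> 3 j\<close>
  and \<open>3 powr a \<le> 3\<close>.\<close>

lemma integral_norm_block_le:
  assumes b: "cmod b \<le> 1" and j: "0 < j"
  shows "(LINT z|disc_area. cmod (block j (b * z)) * \<Omega> (cmod z))
     \<le> 3 * block_const * (1 + 4 * C * M) * (real j powr a * cmod b ^ j)"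
proof -
  define R where "R w = (\<Sum>m<6 * j. complex_of_real (block_coeff j m) * w ^ m)" for w
  have "(LINT z|disc_area. cmod (block j (b * z)) * \<Omega> (cmod z))
      = (LINT z|disc_area. cmod b ^ (2 * j) * (cmod (R (b * z)) * (\<bar>cmod z\<bar> ^ (2 * j) * \<Omega> (cmod z))))"
    by (simp add: block_eq[OF j] R_def norm_mult norm_power power_mult_distrib ac_simps)
  also have "\<dots> = cmod b ^ (2 * j) * (LINT z|disc_area. cmod (R (b * z)) * (\<bar>cmod z\<bar> ^ (2 * j) * \<Omega> (cmod z)))"
    by (rule integral_mult_right_zero)
  also have "\<dots> \<le> cmod b ^ (2 * j) * (block_const * coeff j * (LINT z|disc_area. \<bar>cmod z\<bar> ^ (2 * j) * \<Omega> (cmod z)))"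
    unfolding R_def by (intro mult_left_mono integral_block_le[OF radial_density_power_\<Omega> b j]) auto
  also have "\<dots> = cmod b ^ (2 * j) * (block_const * (coeff j * (LINT z|disc_area. cmod z ^ (2 * j) * \<Omega> (cmod z))))"
    by simp
  also have "\<dots> \<le> cmod b ^ j * (block_const * ((1 + 4 * C * M) * (3 * real j powr a)))"
  proof (rule mult_mono, goal_cases)
    case 1
    show "cmod b ^ (2 * j) \<le> cmod b ^ j"
      using b by (intro power_decreasing) auto
  next
    case 2
    have "coeff j * (LINT z|disc_area. cmod z ^ (2 * j) * \<Omega> (cmod z)) \<le> (1 + 4 * C * M) * real (2 * j + 1) powr a"
      by (rule integral_power_\<Omega>_le)
    also have "\<dots> \<le> (1 + 4 * C * M) * (3 * real j powr a)"
    proof (intro mult_left_mono)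
      have "real (2 * j + 1) powr a \<le> (3 * real j) powr a"
        using a j by (intro powr_mono2) auto
      also have "\<dots> = 3 powr a * real j powr a"
        by (simp add: powr_mult)
      also have "\<dots> \<le> 3 powr 1 * real j powr a"
        using a by (intro mult_right_mono powr_mono) auto
      finally show "real (2 * j + 1) powr a \<le> 3 * real j powr a"
        by simp
    qed (use C_ge_1 M_nonneg in auto)
    finally show ?case
      using block_const_nonneg by (rule mult_left_mono)
  next
    case 4
    have "0 \<le> (LINT z|disc_area. cmod z ^ (2 * j) * \<Omega> (cmod z))"
      using \<Omega>_nonneg by (intro integral_nonneg_AE AE_I2) auto
    then show "0 \<le> block_const * (coeff j * (LINT z|disc_area. cmod z ^ (2 * j) * \<Omega> (cmod z)))"
      using block_const_nonneg coeff_pos[of j] by auto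
  qed simp
  also have "\<dots> = 3 * block_const * (1 + 4 * C * M) * (real j powr a * cmod b ^ j)"
    by (simp add: ac_simps)
  finally show ?thesis .
qed

sublocale \<Omega>: radial_density \<Omega>
  using radial_density_power_\<Omega>[of 0] by simp

text \<open>The smoothed partial sums of the kernel telescope into dyadic blocks.\<close>

lemma norm_ker_le_blocks:
  assumes w: "cmod w \<le> s" and s: "0 \<le> s" "s < 1"
  shows "cmod (ker w) \<le> (\<Sum>n<4. coeff n) + (\<Sum>i<I. cmod (block (2 ^ i) w)) + (\<Sum>n. coeff (n + 2 ^ I) * s ^ (n + 2 ^ I))"
proof -
  define c where "c n = of_real (coeff n) * w ^ n" for n
  \<comment> \<open>This is \<open>2 * 2 ^ Suc I\<close>, the index from which on the cutoff
    vanishes.\<close>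
  define N :: nat where "N = 2 ^ (I + 2)"
  have sum_c: "summable c"
    unfolding c_def using w s by (intro summable_ker) auto
  have "2 * 2 ^ Suc I \<le> real n" if "N \<le> n" for n
    using of_nat_mono[OF that, where 'a = real] by (simp add: N_def)
  then have cut_c: "(\<lambda>n. of_real (cutoff (2 ^ Suc I) n) * c n) sums (\<Sum>n<N. of_real (cutoff (2 ^ Suc I) n) * c n)"
    by (intro sums_finite) (auto simp: not_less cutoff_eq_0)
  have "ker w - (\<Sum>n<N. of_real (cutoff (2 ^ Suc I) n) * c n) = (\<Sum>n. c n - of_real (cutoff (2 ^ Suc I) n) * c n)"
    using sums_diff[OF summable_sums[OF sum_c] cut_c] unfolding ker_def c_def[symmetric] by (simp only: sums_iff)
  also have "cmod \<dots> \<le> (\<Sum>n. coeff (n + 2 ^ I) * s ^ (n + 2 ^ I))"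
  proof -
    define d where "d n = c n - of_real (cutoff (2 ^ Suc I) n) * c n" for n
    have d_le: "norm (d n) \<le> coeff n * s ^ n" for n
    proof -
      have "d n = of_real (1 - cutoff (2 ^ Suc I) n) * c n"
        by (simp add: d_def algebra_simps)
      then have "norm (d n) = (1 - cutoff (2 ^ Suc I) n) * (coeff n * cmod w ^ n)"
        unfolding c_def using cutoff_bounds[of "2 ^ Suc I" n]
        by (simp only: norm_mult[of "of_real (1 - cutoff (2 ^ Suc I) n)"] norm_coeff norm_of_real abs_of_nonneg diff_ge_0_iff_ge)
      also have "\<dots> \<le> 1 * (coeff n * s ^ n)"
        using cutoff_bounds[of "2 ^ Suc I" n] coeff_pos[of n] w by (intro mult_mono mult_left_mono power_mono) auto
      finally show ?thesis by simp
    qed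
    have sum_s: "summable (\<lambda>n. coeff (n + 2 ^ I) * s ^ (n + 2 ^ I))"
      using summable_ignore_initial_segment[OF summable_coeff[OF s], of "2 ^ I"] .
    have d_sum: "summable d"
      by (rule summable_comparison_test'[where N = 0, OF summable_coeff[OF s] d_le])
    \<comment> \<open>The cutoff equals \<open>1\<close> up to \<open>2 ^ Suc I\<close>, so the
      remainder has no terms below \<open>2 ^ I\<close>.\<close>
    have "d n = 0" if "n < 2 ^ I" for n
    proof -
      have "real n < 2 ^ I"
        using that by (metis of_nat_less_iff of_nat_numeral of_nat_power)
      moreover have "(2 :: real) ^ I \<le> 2 ^ Suc I"
        by simp
      ultimately have "real n \<le> 2 ^ Suc I"
        by linarith
      then have "cutoff (2 ^ Suc I) n = 1"
        by (intro cutoff_eq_1) auto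
      then show ?thesis
        by (simp add: d_def)
    qed
    then have "suminf d = (\<Sum>n. d (n + 2 ^ I))"
      using suminf_split_initial_segment[OF d_sum, of "2 ^ I"] by simp
    also have "norm \<dots> \<le> (\<Sum>n. coeff (n + 2 ^ I) * s ^ (n + 2 ^ I))"
      by (intro norm_suminf_le d_le sum_s)
    finally show ?thesis
      by (simp only: d_def[abs_def])
  qed
  finally have 1: "cmod (ker w) \<le> cmod (\<Sum>n<N. of_real (cutoff (2 ^ Suc I) n) * c n) + (\<Sum>n. coeff (n + 2 ^ I) * s ^ (n + 2 ^ I))"
    using norm_triangle_sub[of "ker w" "\<Sum>n<N. of_real (cutoff (2 ^ Suc I) n) * c n"] by simp
  have "(\<Sum>n<N. of_real (cutoff (2 ^ Suc I) n) * c n)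
      = (\<Sum>n<N. of_real (cutoff 2 n) * c n) + (\<Sum>n<N. \<Sum>i<I. of_real (hat (2 ^ i) n) * c n)"
    unfolding cutoff_eq_sum_hat by (simp add: algebra_simps sum.distrib sum_distrib_left sum_distrib_right)
  also have "(\<Sum>n<N. \<Sum>i<I. of_real (hat (2 ^ i) n) * c n) = (\<Sum>i<I. \<Sum>n<N. of_real (hat (2 ^ i) n) * c n)"
    by (rule sum.swap)
  also have "\<dots> = (\<Sum>i<I. block (2 ^ i) w)"
  proof (intro sum.cong refl)
    fix i assume "i \<in> {..<I}"
    then have "Suc i \<le> I" by simp
    then have "(2 :: nat) ^ Suc i \<le> 2 ^ I"
      by (intro power_increasing) auto
    then have le: "8 * 2 ^ i \<le> N"
      by (simp add: N_def)
    have "(\<Sum>n<N. of_real (hat (2 ^ i) n) * c n) = (\<Sum>n<8 * 2 ^ i. of_real (hat (2 ^ i) n) * c n)"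
      using le by (intro sum.mono_neutral_right) (auto simp: hat_eq_0)
    then show "(\<Sum>n<N. of_real (hat (2 ^ i) n) * c n) = block (2 ^ i) w"
      by (simp add: block_def c_def mult.assoc)
  qed
  \<comment> \<open>\<open>cutoff 2\<close> vanishes from \<open>n = 4\<close> on, so the lower end
    of the telescope costs only four coefficients.\<close>
  also have "(\<Sum>n<N. of_real (cutoff 2 n) * c n) = (\<Sum>n<4. of_real (cutoff 2 n) * c n)"
  proof (intro sum.mono_neutral_right)
    have "(2 :: nat) ^ 2 \<le> 2 ^ (I + 2)"
      by (intro power_increasing) auto
    then show "{..<4} \<subseteq> {..<N}"
      by (auto simp: N_def)
  qed (auto simp: cutoff_eq_0)
  also have "cmod (\<dots> + (\<Sum>i<I. block (2 ^ i) w)) \<le> cmod (\<Sum>n<4. of_real (cutoff 2 n) * c n) + cmod (\<Sum>i<I. block (2 ^ i) w)"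
    by (rule norm_triangle_ineq)
  also have "\<dots> \<le> (\<Sum>n<4. coeff n) + (\<Sum>i<I. cmod (block (2 ^ i) w))"
  proof (intro add_mono sum_norm_le)
    fix n
    have "norm (of_real (cutoff 2 n) * c n) = cutoff 2 n * (coeff n * cmod w ^ n)"
      unfolding c_def norm_mult[of "of_real (cutoff 2 n)"] norm_coeff using cutoff_bounds[of 2 n] by simp
    also have "\<dots> \<le> 1 * (coeff n * 1)"
      using cutoff_bounds[of 2 n] coeff_pos[of n] w s by (intro mult_mono mult_left_mono power_le_one) auto
    finally show "norm (of_real (cutoff 2 n) * c n) \<le> coeff n"
      by simp
  qed simp
  finally show ?thesis
    using 1 by simp
qed

definition kernel_const :: real where
  "kernel_const = (\<Sum>n<4. coeff n) * (LINT z|disc_area. \<Omega> (cmod z))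
     + 3 * block_const * (1 + 4 * C * M) * (2 powr a / (2 powr a - 1) + 1 / (1 - 2 powr (a - 1)))"

text \<open>Only finitely many blocks are integrated at a time. The remainder
  \<open>\<delta> I\<close> is uniform on \<open>|w| \<le> s\<close> and tends to \<open>0\<close>,
  while the bound for the blocks does not depend on their number. The contribution of the first four
  coefficients is absorbed because \<open>(1 - s) powr (- a) \<ge> 1\<close>.\<close>

lemma kernel_integral:
  assumes b: "cmod b < 1"
  shows "integrable disc_area (\<lambda>z. cmod (ker (b * z)) * \<Omega> (cmod z))"
    and "(LINT z|disc_area. cmod (ker (b * z)) * \<Omega> (cmod z)) \<le> kernel_const * (1 - cmod b) powr (- a)"
proof -
  define s where "s = cmod b"
  have s: "0 \<le> s" "s < 1" using b by (auto simp: s_def)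
  have bz: "cmod (b * z) \<le> s" if "cmod z < 1" for z
    using that by (simp add: s_def norm_mult mult_left_le)
  have [measurable]: "(\<lambda>z. cmod (ker (b * z))) \<in> borel_measurable disc_area"
    by (rule borel_measurable_disc_area) measurable
  show int: "integrable disc_area (\<lambda>z. cmod (ker (b * z)) * \<Omega> (cmod z))"
  proof -
    have "AE z in disc_area. norm (cmod (ker (b * z))) \<le> (\<Sum>n. coeff n * s ^ n)"
      by (intro AE_I2) (simp add: norm_ker_le[OF bz s(2)])
    then show ?thesis
      using \<Omega>.integrable_mult_G[of "\<lambda>z. cmod (ker (b * z))"] by simp
  qed
  define I0 where "I0 = (LINT z|disc_area. \<Omega> (cmod z))"
  have I0: "0 \<le> I0"
    unfolding I0_def using \<Omega>_nonneg by (intro integral_nonneg_AE AE_I2) auto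
  define \<delta> where "\<delta> I = (\<Sum>n. coeff (n + 2 ^ I) * s ^ (n + 2 ^ I))" for I :: nat
  define c where "c = 3 * block_const * (1 + 4 * C * M)"
  define S where "S = 2 powr a / (2 powr a - 1) + 1 / (1 - 2 powr (a - 1))"
  have c: "0 \<le> c"
    using block_const_nonneg C_ge_1 M_nonneg by (simp add: c_def)
  have block_int: "integrable disc_area (\<lambda>z. cmod (block j (b * z)) * \<Omega> (cmod z))" for j
    using \<Omega>.integrable_continuous_mult_G[of "\<lambda>z. cmod (block j (b * z))"]
    by (simp add: block_def continuous_intros)
  have le: "(LINT z|disc_area. cmod (ker (b * z)) * \<Omega> (cmod z))
      \<le> (\<Sum>n<4. coeff n) * I0 + c * (S * (1 - s) powr (- a)) + \<delta> I * I0" for I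
  proof -
    have "(LINT z|disc_area. cmod (ker (b * z)) * \<Omega> (cmod z))
       \<le> (LINT z|disc_area. ((\<Sum>n<4. coeff n) + \<delta> I) * \<Omega> (cmod z) + (\<Sum>i<I. cmod (block (2 ^ i) (b * z)) * \<Omega> (cmod z)))"
    proof (rule integral_mono[OF int])
      show "integrable disc_area (\<lambda>z. ((\<Sum>n<4. coeff n) + \<delta> I) * \<Omega> (cmod z) + (\<Sum>i<I. cmod (block (2 ^ i) (b * z)) * \<Omega> (cmod z)))"
        by (intro Bochner_Integration.integrable_add Bochner_Integration.integrable_sum block_int
            integrable_mult_right \<Omega>.G_integrable)
      fix z assume "z \<in> space disc_area"
      then have "cmod (ker (b * z)) * \<Omega> (cmod z)
          \<le> ((\<Sum>n<4. coeff n) + (\<Sum>i<I. cmod (block (2 ^ i) (b * z))) + \<delta> I) * \<Omega> (cmod z)"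
        unfolding \<delta>_def using \<Omega>_nonneg by (intro mult_right_mono norm_ker_le_blocks bz s) auto
      then show "cmod (ker (b * z)) * \<Omega> (cmod z)
          \<le> ((\<Sum>n<4. coeff n) + \<delta> I) * \<Omega> (cmod z) + (\<Sum>i<I. cmod (block (2 ^ i) (b * z)) * \<Omega> (cmod z))"
        by (simp add: algebra_simps sum_distrib_left sum_distrib_right)
    qed
    also have "\<dots> = ((\<Sum>n<4. coeff n) + \<delta> I) * I0 + (\<Sum>i<I. LINT z|disc_area. cmod (block (2 ^ i) (b * z)) * \<Omega> (cmod z))"
      unfolding I0_def
      using block_int \<Omega>.G_integrable by (simp add: Bochner_Integration.integral_add Bochner_Integration.integral_sum)
    also have "(\<Sum>i<I. LINT z|disc_area. cmod (block (2 ^ i) (b * z)) * \<Omega> (cmod z))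
        \<le> (\<Sum>i<I. c * ((2 ^ i) powr a * s ^ (2 ^ i)))"
    proof (intro sum_mono)
      fix i
      show "(LINT z|disc_area. cmod (block (2 ^ i) (b * z)) * \<Omega> (cmod z)) \<le> c * ((2 ^ i) powr a * s ^ (2 ^ i))"
        using integral_norm_block_le[of b "2 ^ i"] b by (simp add: c_def s_def)
    qed
    also have "\<dots> = c * (\<Sum>i<I. (2 ^ i) powr a * s ^ (2 ^ i))"
      by (simp add: sum_distrib_left)
    also have "\<dots> \<le> c * (S * (1 - s) powr (- a))"
      unfolding S_def by (intro mult_left_mono sum_dyadic_powr_le a s c)
    finally show ?thesis
      by (simp add: algebra_simps)
  qed
  have \<delta>_lim: "\<delta> \<longlonglongrightarrow> 0"
  proof (rule LIMSEQ_I)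
    fix e :: real assume "e > 0"
    then obtain N where N: "\<And>n. n \<ge> N \<Longrightarrow> norm (\<Sum>i. coeff (i + n) * s ^ (i + n)) < e"
      using suminf_exist_split[OF _ summable_coeff[OF s]] by metis
    show "\<exists>no. \<forall>I\<ge>no. norm (\<delta> I - 0) < e"
    proof (intro exI allI impI)
      fix I assume "N \<le> I"
      then have "N \<le> 2 ^ I"
        using less_exp[of I] by linarith
      then show "norm (\<delta> I - 0) < e"
        using N by (simp add: \<delta>_def)
    qed
  qed
  have "(LINT z|disc_area. cmod (ker (b * z)) * \<Omega> (cmod z))
      \<le> (\<Sum>n<4. coeff n) * I0 + c * (S * (1 - s) powr (- a)) + 0 * I0"
  proof (rule LIMSEQ_le_const)
    show "(\<lambda>I. (\<Sum>n<4. coeff n) * I0 + c * (S * (1 - s) powr (- a)) + \<delta> I * I0)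
        \<longlonglongrightarrow> (\<Sum>n<4. coeff n) * I0 + c * (S * (1 - s) powr (- a)) + 0 * I0"
      by (intro tendsto_add[OF tendsto_const] tendsto_mult \<delta>_lim tendsto_const)
  qed (use le in auto)
  also have "\<dots> \<le> (\<Sum>n<4. coeff n) * I0 * (1 - s) powr (- a) + c * (S * (1 - s) powr (- a))"
  proof -
    have "1 \<le> (1 - s) powr (- a)"
      using s a powr_mono2'[of "- a" "1 - s" 1] by simp
    moreover have "0 \<le> (\<Sum>n<4. coeff n) * I0"
      using I0 coeff_pos by (intro mult_nonneg_nonneg sum_nonneg) (auto intro: less_imp_le)
    ultimately show ?thesis
      by (simp add: mult_le_cancel_left1 mult_left_mono[of 1 _ "(\<Sum>n<4. coeff n) * I0", simplified])
  qed
  finally show "(LINT z|disc_area. cmod (ker (b * z)) * \<Omega> (cmod z)) \<le> kernel_const * (1 - cmod b) powr (- a)"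
    unfolding kernel_const_def c_def[symmetric] S_def[symmetric] I0_def[symmetric] s_def[symmetric]
    by (simp only: algebra_simps)
qed

end

subsection \<open>Boundedness on power weights\<close>

lemma emeasure_disc_area_space: "emeasure disc_area unit_disc = 1"
  by (subst emeasure_disc_area) (auto simp: emeasure_ball unit_ball_vol_2 ennreal_mult[symmetric])

text \<open>Over a null measure an essential supremum in \<open>ereal\<close> would be
  \<open>-\<infinity>\<close>. The positive mass of the disc rules this out, so a finite norm can be
  handled as a real number.\<close>

lemma weighted_sup_norm_nonneg:
  assumes f [measurable]: "f \<in> borel_measurable disc_area" and "weighted_sup_norm \<nu> f < \<infinity>"
    and tail: "\<And>r. 0 \<le> r \<Longrightarrow> r < 1 \<Longrightarrow> 0 \<le> tail_integral \<nu> r"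
  obtains n where "0 \<le> n" "weighted_sup_norm \<nu> f = ereal n"
    "AE z in disc_area. cmod (f z) * tail_integral \<nu> (cmod z) \<le> n"
proof -
  have ae: "AE z in disc_area. ereal (cmod (f z) * tail_integral \<nu> (cmod z)) \<le> weighted_sup_norm \<nu> f"
    unfolding weighted_sup_norm_def by (rule esssup_AE)
  have nonneg: "0 \<le> weighted_sup_norm \<nu> f"
  proof (rule ccontr)
    assume neg: "\<not> 0 \<le> weighted_sup_norm \<nu> f"
    have "AE z in disc_area. False"
      using ae
    proof (rule AE_mp, intro AE_I2 impI)
      fix z assume "z \<in> space disc_area" and le: "ereal (cmod (f z) * tail_integral \<nu> (cmod z)) \<le> weighted_sup_norm \<nu> f"
      then have "0 \<le> cmod (f z) * tail_integral \<nu> (cmod z)"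
        using tail by auto
      then have "0 \<le> ereal (cmod (f z) * tail_integral \<nu> (cmod z))"
        by simp
      then show False
        using le neg order.trans by blast
    qed
    then have "emeasure disc_area (space disc_area) = 0"
      unfolding ae_filter_eq_bot_iff[symmetric] trivial_limit_def .
    then show False
      by (simp add: emeasure_disc_area_space)
  qed
  with assms(2) obtain n where n: "weighted_sup_norm \<nu> f = ereal n" "0 \<le> n"
    by (cases "weighted_sup_norm \<nu> f") auto
  show thesis
    using that[OF n(2,1)] ae n(1) by simp
qed

lemma holomorphic_measurable_disc_area:
  assumes "f holomorphic_on unit_disc"
  shows "f \<in> borel_measurable disc_area"
proof -
  have "f \<in> borel_measurable (lebesgue_on unit_disc)"
    by (intro continuous_imp_measurable_on_sets_lebesgue holomorphic_on_imp_continuous_on assms) auto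
  then show ?thesis
    by (simp add: disc_area_def)
qed

definition power_weight :: "real \<Rightarrow> real \<Rightarrow> real" where
  "power_weight a r = a * (1 - r) powr (a - 1)"

lemma power_weight_integral:
  assumes a: "0 < a" and r: "r < 1"
  shows "set_integrable lebesgue {r..<1} (power_weight a)"
    and "tail_integral (power_weight a) r = (1 - r) powr a"
proof -
  define F where "F s = - ((1 - s) powr a)" for s :: real
  have "(power_weight a has_integral (F 1 - F r)) {r..1}"
  \<comment> \<open>For \<open>a < 1\<close> the derivative is unbounded at \<open>1\<close>; at the
    endpoints only continuity of \<open>F\<close> is used.\<close>
  proof (rule fundamental_theorem_of_calculus_interior)
    show "continuous_on {r..1} F"
      unfolding F_def using a by (intro continuous_intros continuous_on_powr') auto
    fix s :: real assume "s \<in> {r<..<1}"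
    then show "(F has_vector_derivative power_weight a s) (at s)"
      unfolding F_def power_weight_def has_real_derivative_iff_has_vector_derivative[symmetric]
      by (auto intro!: derivative_eq_intros simp: powr_diff field_simps)
  qed (use r in auto)
  then have "(power_weight a has_integral (1 - r) powr a) {r..1}"
    by (simp add: F_def)
  then have hi: "(power_weight a has_integral (1 - r) powr a) {r..<1}"
    by (subst has_integral_spike_set_eq[of _ "{r..1}"]) (auto intro: negligible_subset[of "{1}"])
  show int: "set_integrable lebesgue {r..<1} (power_weight a)"
    using hi a by (intro nonnegative_absolutely_integrable_1) (auto simp: integrable_on_def power_weight_def)
  show "tail_integral (power_weight a) r = (1 - r) powr a"
    unfolding tail_integral_def using set_lebesgue_integral_eq_integral(2)[OF int] hi
    by (simp add: integral_unique)
qed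

lemma radial_weight_power: "0 < a \<Longrightarrow> radial_weight (power_weight a)"
  using power_weight_integral[of a] by (auto simp: radial_weight_def power_weight_def)

text \<open>If \<open>f\<close> has norm \<open>n\<close>, then
  \<open>|f| \<omega> \<le> n * \<Omega>\<close> almost everywhere, and the growth
  \<open>(1 - |z|) powr (- a)\<close> of the kernel integral is compensated exactly by the tail of
  the power weight. Hence \<open>kernel_const\<close> bounds the operator.\<close>

lemma (in regular_weight) bergman_projection_bounded_power_weight:
  "bergman_projection_bounded \<omega> (power_weight a)"
proof -
  define \<nu> where "\<nu> = power_weight a"
  have tail: "tail_integral \<nu> r = (1 - r) powr a" if "r < 1" for r
    unfolding \<nu>_def using a that by (intro power_weight_integral) auto
  \<comment> \<open>The sign is read off from the kernel estimate at \<open>b = 0\<close>, where the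
    power of \<open>1 - |b|\<close> is \<open>1\<close>.\<close>
  have const_nonneg: "0 \<le> kernel_const"
  proof -
    have "0 \<le> (LINT z|disc_area. cmod (ker (0 * z)) * \<Omega> (cmod z))"
      using \<Omega>_nonneg by (intro integral_nonneg_AE AE_I2) auto
    also have "\<dots> \<le> kernel_const * (1 - cmod 0) powr (- a)"
      by (rule kernel_integral(2)) simp
    finally show ?thesis
      by simp
  qed
  have main: "(\<forall>z\<in>unit_disc. integrable disc_area (bergman_integrand \<omega> f z)) \<and>
      bergman_projection \<omega> f \<in> H_inf \<nu> \<and>
      weighted_sup_norm \<nu> (bergman_projection \<omega> f) \<le> ereal kernel_const * weighted_sup_norm \<nu> f"
    if f_in: "f \<in> L_inf \<nu>" for f
  proof -
    have f [measurable]: "f \<in> borel_measurable disc_area"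
      using f_in by (simp add: L_inf_def)
    obtain n where n: "0 \<le> n" "weighted_sup_norm \<nu> f = ereal n"
      and ae: "AE z in disc_area. cmod (f z) * tail_integral \<nu> (cmod z) \<le> n"
      using f_in tail by (auto simp: L_inf_def intro: weighted_sup_norm_nonneg[OF f])
    have ae_le: "AE z in disc_area. cmod (f z) * \<omega> (cmod z) \<le> n * \<Omega> (cmod z)"
      using ae
    proof (rule AE_mp, intro AE_I2 impI)
      fix z assume "z \<in> space disc_area" and le: "cmod (f z) * tail_integral \<nu> (cmod z) \<le> n"
      then have z: "cmod z < 1" by simp
      then have "cmod (f z) \<le> n * (1 - cmod z) powr (- a)"
        using le tail by (simp add: powr_minus field_simps)
      then have "cmod (f z) * \<omega> (cmod z) \<le> n * (1 - cmod z) powr (- a) * \<omega> (cmod z)"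
        using nonneg by (intro mult_right_mono)
      then show "cmod (f z) * \<omega> (cmod z) \<le> n * \<Omega> (cmod z)"
        by (simp add: \<Omega>_def mult.assoc)
    qed
    have [measurable]: "(\<lambda>z. of_real (\<omega> (cmod z)) :: complex) \<in> borel_measurable disc_area"
      by (rule borel_measurable_disc_area) measurable
    have f_int: "integrable disc_area (\<lambda>\<zeta>. f \<zeta> * of_real (\<omega> (cmod \<zeta>)))"
    proof (rule Bochner_Integration.integrable_bound)
      show "integrable disc_area (\<lambda>z. n * \<Omega> (cmod z))"
        using \<Omega>.G_integrable by simp
      show "AE z in disc_area. norm (f z * of_real (\<omega> (cmod z))) \<le> norm (n * \<Omega> (cmod z))"
        using ae_le by (rule AE_mp) (use nonneg n(1) \<Omega>_nonneg in \<open>auto simp: norm_mult\<close>)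
    qed measurable
    have integrand: "integrable disc_area (bergman_integrand \<omega> f z)" if "cmod z < 1" for z
      by (rule bergman_projection_power_series(1)[OF f f_int that])
    have hol: "bergman_projection \<omega> f holomorphic_on unit_disc"
      by (rule bergman_projection_holomorphic[OF f f_int])
    then have [measurable]: "bergman_projection \<omega> f \<in> borel_measurable disc_area"
      by (rule holomorphic_measurable_disc_area)
    have pointwise: "cmod (bergman_projection \<omega> f z) * tail_integral \<nu> (cmod z) \<le> kernel_const * n" if z: "cmod z < 1" for z
    proof -
      have "cmod (bergman_projection \<omega> f z) \<le> (LINT \<zeta>|disc_area. cmod (bergman_integrand \<omega> f z \<zeta>))"
        unfolding bergman_projection_def by (rule integral_norm_bound)
      also have "\<dots> \<le> (LINT \<zeta>|disc_area. n * (cmod (ker (cnj z * \<zeta>)) * \<Omega> (cmod \<zeta>)))"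
      proof (rule integral_mono_AE)
        show "integrable disc_area (\<lambda>\<zeta>. n * (cmod (ker (cnj z * \<zeta>)) * \<Omega> (cmod \<zeta>)))"
          using kernel_integral(1)[of "cnj z"] z by simp
        show "AE \<zeta> in disc_area. cmod (bergman_integrand \<omega> f z \<zeta>) \<le> n * (cmod (ker (cnj z * \<zeta>)) * \<Omega> (cmod \<zeta>))"
          using ae_le
        proof (rule AE_mp, intro AE_I2 impI)
          fix \<zeta> assume "cmod (f \<zeta>) * \<omega> (cmod \<zeta>) \<le> n * \<Omega> (cmod \<zeta>)"
          then have "cmod (ker (cnj z * \<zeta>)) * (cmod (f \<zeta>) * \<omega> (cmod \<zeta>)) \<le> cmod (ker (cnj z * \<zeta>)) * (n * \<Omega> (cmod \<zeta>))"
            by (rule mult_left_mono) simp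
          then show "cmod (bergman_integrand \<omega> f z \<zeta>) \<le> n * (cmod (ker (cnj z * \<zeta>)) * \<Omega> (cmod \<zeta>))"
            using nonneg[of "cmod \<zeta>"] by (simp add: bergman_integrand_def bergman_kernel_eq norm_mult ac_simps)
        qed
      qed (use integrand[OF z] in simp)
      also have "\<dots> = n * (LINT \<zeta>|disc_area. cmod (ker (cnj z * \<zeta>)) * \<Omega> (cmod \<zeta>))"
        by simp
      also have "\<dots> \<le> n * (kernel_const * (1 - cmod z) powr (- a))"
        using kernel_integral(2)[of "cnj z"] z n(1) by (intro mult_left_mono) auto
      finally have "cmod (bergman_projection \<omega> f z) \<le> n * (kernel_const * (1 - cmod z) powr (- a))" .
      then show ?thesis
        using z tail[of "cmod z"] by (simp add: powr_minus field_simps)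
    qed
    have norm_le: "weighted_sup_norm \<nu> (bergman_projection \<omega> f) \<le> ereal (kernel_const * n)"
      unfolding weighted_sup_norm_def
    proof (rule esssup_I)
      have "(\<lambda>z. (1 - cmod z) powr a) \<in> borel_measurable disc_area"
        by (rule borel_measurable_disc_area) measurable
      then have [measurable]: "(\<lambda>z. tail_integral \<nu> (cmod z)) \<in> borel_measurable disc_area"
        by (subst measurable_cong[where g = "\<lambda>z. (1 - cmod z) powr a"]) (auto simp: tail)
      show "(\<lambda>z. ereal (cmod (bergman_projection \<omega> f z) * tail_integral \<nu> (cmod z))) \<in> borel_measurable disc_area"
        by measurable
      show "AE z in disc_area. ereal (cmod (bergman_projection \<omega> f z) * tail_integral \<nu> (cmod z)) \<le> ereal (kernel_const * n)"
        using pointwise by (intro AE_I2) auto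
    qed
    then have "weighted_sup_norm \<nu> (bergman_projection \<omega> f) < \<infinity>"
      by (auto simp: le_less_trans)
    then show ?thesis
      using integrand hol norm_le n(2) by (auto simp: H_inf_def L_inf_def)
  qed
  then show ?thesis
    unfolding bergman_projection_bounded_def \<nu>_def[symmetric] using const_nonneg by blast
qed

subsection \<open>Necessity of the reverse doubling condition\<close>

lemma AE_disc_area_iff: "(AE z in disc_area. P z) \<longleftrightarrow> (AE z in lebesgue. z \<in> unit_disc \<longrightarrow> P z)"
  unfolding disc_area_def by (simp add: AE_density AE_restrict_space_iff)

lemma radial_weight_tail_antimono:
  assumes \<nu>: "radial_weight \<nu>" and "0 \<le> r" "r \<le> s"
  shows "tail_integral \<nu> s \<le> tail_integral \<nu> r"
  unfolding tail_integral_def set_lebesgue_integral_def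
proof (rule integral_mono)
  show "integrable lebesgue (\<lambda>x. indicat_real {s..<1} x *\<^sub>R \<nu> x)"
      "integrable lebesgue (\<lambda>x. indicat_real {r..<1} x *\<^sub>R \<nu> x)"
    using \<nu> assms set_integrable_subset[of lebesgue "{0..<1}" \<nu>]
    unfolding set_integrable_def[symmetric] radial_weight_def by auto
qed (use assms in \<open>auto simp: radial_weight_def indicator_def\<close>)

text \<open>Monotone functions are Borel. \<open>max 0\<close> is inserted because antitonicity of
  the tail is available for nonnegative arguments.\<close>

lemma tail_integral_cmod_measurable:
  assumes "radial_weight \<nu>"
  shows "(\<lambda>z. tail_integral \<nu> (cmod z)) \<in> borel_measurable disc_area"
proof -
  have "mono (\<lambda>r. - tail_integral \<nu> (max 0 r))"
    using radial_weight_tail_antimono[OF assms] by (intro monoI) auto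
  then have [measurable]: "(\<lambda>r. - tail_integral \<nu> (max 0 r)) \<in> borel_measurable borel"
    by (rule borel_measurable_mono)
  have "(\<lambda>z. - (- tail_integral \<nu> (max 0 (cmod z)))) \<in> borel_measurable borel"
    by measurable
  then show ?thesis
    by (intro borel_measurable_disc_area) simp
qed

text \<open>An odd bounded function on the circle with Fourier coefficients \<open>1 / n\<close>; testing the kernel
  against it replaces Hardy's inequality.\<close>

definition sawtooth :: "complex \<Rightarrow> complex" where
  "sawtooth u = cnj (Ln (1 - u)) - Ln (1 - u)"

text \<open>Only the imaginary part of the principal logarithm survives, and it lies in
  \<open>[-pi, pi]\<close>; the real part, unbounded near \<open>u = 1\<close>, cancels.\<close>

lemma norm_sawtooth_le:
  assumes "cmod u < 1"
  shows "cmod (sawtooth u) \<le> 2 * pi"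
proof -
  have ne: "1 - u \<noteq> 0"
    using assms by auto
  have "sawtooth u = of_real (- 2 * Im (Ln (1 - u))) * \<i>"
    by (simp add: sawtooth_def complex_eq_iff)
  then have "cmod (sawtooth u) = 2 * \<bar>Im (Ln (1 - u))\<bar>"
    by (simp add: norm_mult)
  also have "\<bar>Im (Ln (1 - u))\<bar> \<le> pi"
    using mpi_less_Im_Ln[OF ne] Im_Ln_le_pi[OF ne] by auto
  finally show ?thesis
    by simp
qed

lemma sawtooth_sums:
  assumes "cmod u < 1"
  shows "(\<lambda>m. (u ^ m - cnj u ^ m) / of_nat m) sums sawtooth u"
proof -
  have "(\<lambda>m. - ((- (- u)) ^ m) / of_nat m) sums Ln (1 + (- u))"
    using assms by (intro Ln_series') auto
  then have *: "(\<lambda>m. - (u ^ m) / of_nat m) sums Ln (1 - u)"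
    by simp
  then have "(\<lambda>m. cnj (- (u ^ m) / of_nat m)) sums cnj (Ln (1 - u))"
    by (simp only: sums_cnj)
  from sums_diff[OF this *] show ?thesis
    by (simp add: sawtooth_def diff_divide_distrib)
qed

text \<open>For \<open>n = 0\<close> both sides vanish, the right one because \<open>x / 0 = 0\<close>.\<close>

lemma (in radial_density) integral_sawtooth:
  assumes \<rho>: "0 \<le> \<rho>" "\<rho> < 1"
  shows "(LINT z|disc_area. sawtooth (of_real \<rho> * z) * cnj z ^ n * of_real (G (cmod z)))
    = of_real (\<rho> ^ n / real n * (LINT z|disc_area. cmod z ^ (2 * n) * G (cmod z)))"
proof -
  define I where "I p q = (LINT z|disc_area. z ^ p * cnj z ^ q * complex_of_real (G (cmod z)))" for p q
  have I_int: "integrable disc_area (\<lambda>z. z ^ p * cnj z ^ q * complex_of_real (G (cmod z)))" for p q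
    by (intro integrable_continuous_mult_G continuous_intros)
  \<comment> \<open>Split into monomials: orthogonality leaves from the first part only
    \<open>m = n\<close>. The second part contributes nothing, since \<open>m + n > 0\<close> for
    \<open>m > 0\<close>, and for \<open>m = 0\<close> its coefficient is
    \<open>1 / 0 = 0\<close>.\<close>
  define g where "g m z = of_real (\<rho> ^ m / real m) * (z ^ m * cnj z ^ n * complex_of_real (G (cmod z)))
      - of_real (\<rho> ^ m / real m) * (z ^ 0 * cnj z ^ (m + n) * complex_of_real (G (cmod z)))" for m z
  have g_eq: "g m z = ((of_real \<rho> * z) ^ m - cnj (of_real \<rho> * z) ^ m) / of_nat m * (cnj z ^ n * complex_of_real (G (cmod z)))" for m z
    by (simp add: g_def power_mult_distrib power_add field_simps diff_divide_distrib)
  have g_int: "integrable disc_area (g m)" for m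
    unfolding g_def[abs_def] by (intro Bochner_Integration.integrable_diff integrable_mult_right I_int)
  have g_norm: "norm (g m z) \<le> 2 * \<rho> ^ m * G (cmod z)" if z: "cmod z < 1" for m z
  proof (cases "m = 0")
    case True
    then show ?thesis
      using G_nonneg by (simp add: g_def)
  next
    case False
    have "cmod (of_real \<rho> * z) \<le> \<rho>"
      using z \<rho> by (simp add: norm_mult mult_left_le)
    then have "cmod ((of_real \<rho> * z) ^ m - cnj (of_real \<rho> * z) ^ m) \<le> \<rho> ^ m + \<rho> ^ m"
      by (intro order.trans[OF norm_triangle_ineq4] add_mono) (simp_all only: norm_power complex_mod_cnj norm_ge_zero power_mono complex_cnj_power[symmetric])
    moreover have "cmod ((of_real \<rho> * z) ^ m - cnj (of_real \<rho> * z) ^ m) / real m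
        \<le> cmod ((of_real \<rho> * z) ^ m - cnj (of_real \<rho> * z) ^ m) / 1"
      using False by (intro divide_left_mono) auto
    ultimately have "cmod (((of_real \<rho> * z) ^ m - cnj (of_real \<rho> * z) ^ m) / of_nat m) \<le> 2 * \<rho> ^ m"
      by (simp add: norm_divide)
    moreover have "cmod (cnj z ^ n * complex_of_real (G (cmod z))) \<le> 1 * G (cmod z)"
      unfolding norm_mult using z G_nonneg[of "cmod z"] by (intro mult_mono) (auto simp: norm_power intro: power_le_one)
    ultimately have "cmod (((of_real \<rho> * z) ^ m - cnj (of_real \<rho> * z) ^ m) / of_nat m)
        * cmod (cnj z ^ n * complex_of_real (G (cmod z))) \<le> 2 * \<rho> ^ m * (1 * G (cmod z))"
      using \<rho> by (intro mult_mono) auto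
    then show ?thesis
      unfolding g_eq by (simp only: norm_mult[of "_ / _"] mult_1)
  qed
  have sum: "summable (\<lambda>m. 2 * \<rho> ^ m)"
    using \<rho> by (intro summable_mult summable_geometric) auto
  have AE_sum: "AE z in disc_area. summable (\<lambda>m. norm (g m z))"
  proof (intro AE_I2)
    fix z assume "z \<in> space disc_area"
    then have "cmod z < 1" by simp
    from g_norm[OF this] show "summable (\<lambda>m. norm (g m z))"
      by (intro summable_comparison_test'[where N = 0, OF summable_mult2[OF sum]]) (simp only: real_norm_def abs_norm_cancel)
  qed
  have sum_int: "summable (\<lambda>m. LINT z|disc_area. norm (g m z))"
  proof (rule summable_comparison_test'[where N = 0, OF summable_mult2[OF sum]])
    fix m
    have "(LINT z|disc_area. norm (g m z)) \<le> (LINT z|disc_area. 2 * \<rho> ^ m * G (cmod z))"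
      using g_norm G_integrable by (intro integral_mono integrable_norm g_int integrable_mult_right) auto
    then show "norm (LINT z|disc_area. norm (g m z)) \<le> 2 * \<rho> ^ m * (LINT z|disc_area. G (cmod z))"
      by simp
  qed
  have "(\<lambda>m. integral\<^sup>L disc_area (g m)) sums (LINT z|disc_area. (\<Sum>m. g m z))"
    by (rule sums_integral[OF g_int AE_sum sum_int])
  also have "(LINT z|disc_area. (\<Sum>m. g m z)) = (LINT z|disc_area. sawtooth (of_real \<rho> * z) * cnj z ^ n * of_real (G (cmod z)))"
  proof (intro Bochner_Integration.integral_cong refl)
    fix z assume "z \<in> space disc_area"
    then have "cmod (of_real \<rho> * z) < 1"
      using \<rho> mult_strict_mono'[of \<rho> 1 "cmod z" 1] by (simp add: norm_mult)
    then have "(\<lambda>m. g m z) sums (sawtooth (of_real \<rho> * z) * (cnj z ^ n * of_real (G (cmod z))))"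
      unfolding g_eq by (intro sums_mult2 sawtooth_sums)
    then show "(\<Sum>m. g m z) = sawtooth (of_real \<rho> * z) * cnj z ^ n * of_real (G (cmod z))"
      by (simp add: sums_iff mult.assoc)
  qed
  finally have sums: "(\<lambda>m. integral\<^sup>L disc_area (g m)) sums (LINT z|disc_area. sawtooth (of_real \<rho> * z) * cnj z ^ n * of_real (G (cmod z)))" .
  have g_integral: "integral\<^sup>L disc_area (g m) = (if m = n then of_real (\<rho> ^ n / real n) * I n n else 0)" for m
  proof -
    have "integral\<^sup>L disc_area (g m) = of_real (\<rho> ^ m / real m) * I m n - of_real (\<rho> ^ m / real m) * I 0 (m + n)"
      unfolding g_def I_def
      by (subst Bochner_Integration.integral_diff) (intro integrable_mult_right I_int | simp only: integral_mult_right_zero)+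
    moreover have "I m n = 0" if "m \<noteq> n"
      unfolding I_def using G_borel that by (rule integral_disc_area_orthogonal)
    moreover have "I 0 (m + n) = 0" if "m \<noteq> 0"
      unfolding I_def using that by (intro integral_disc_area_orthogonal G_borel) auto
    ultimately show ?thesis
      by (cases "m = 0") auto
  qed
  have "(\<lambda>m. integral\<^sup>L disc_area (g m)) sums (of_real (\<rho> ^ n / real n) * I n n)"
    unfolding g_integral by (rule sums_single)
  with sums have "(LINT z|disc_area. sawtooth (of_real \<rho> * z) * cnj z ^ n * of_real (G (cmod z))) = of_real (\<rho> ^ n / real n) * I n n"
    by (rule sums_unique2)
  moreover have "I n n = of_real (LINT z|disc_area. cmod z ^ (2 * n) * G (cmod z))"
    unfolding I_def integral_complex_of_real[symmetric]
    by (intro Bochner_Integration.integral_cong)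
       (simp_all add: power_mult_distrib[symmetric] complex_norm_square[symmetric] power_mult)
  ultimately show ?thesis
    by simp
qed

section \<open>Testing a bounded projection at one point\<close>

context borel_weight
begin

text \<open>The set where \<open>|F| > B\<close> is open. If it contained the boundary point
  \<open>\<rho>\<close>, it would meet the disc of radius \<open>\<rho>\<close> in a nonempty open
  set, which is not null.\<close>

lemma bounded_at_boundary_of_sublevel:
  fixes F :: "complex \<Rightarrow> complex"
  assumes F: "F holomorphic_on unit_disc" and \<rho>: "0 < \<rho>" "\<rho> < 1"
    and ae: "AE z in disc_area. cmod z < \<rho> \<longrightarrow> cmod (F z) \<le> B"
  shows "cmod (F (of_real \<rho>)) \<le> B"
proof (rule ccontr)
  assume "\<not> cmod (F (of_real \<rho>)) \<le> B"
  then have gt: "B < cmod (F (of_real \<rho>))" by simp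
  have "continuous_on unit_disc (\<lambda>z. cmod (F z))"
    using F by (intro continuous_intros holomorphic_on_imp_continuous_on)
  then have op: "open (unit_disc \<inter> (\<lambda>z. cmod (F z)) -` {B<..})"
    by (intro continuous_open_preimage open_ball open_greaterThan)
  define U where "U = (unit_disc \<inter> (\<lambda>z. cmod (F z)) -` {B<..}) \<inter> ball 0 \<rho>"
  have "open U"
    unfolding U_def by (rule open_Int[OF op open_ball])
  moreover have "U \<noteq> {}"
  proof -
    have "of_real \<rho> \<in> unit_disc \<inter> (\<lambda>z. cmod (F z)) -` {B<..}"
      using gt \<rho> by auto
    from openE[OF op this] obtain e where e: "e > 0" "ball (of_real \<rho>) e \<subseteq> unit_disc \<inter> (\<lambda>z. cmod (F z)) -` {B<..}"
      by blast
    define t where "t = \<rho> - min (e / 2) \<rho>"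
    have t: "0 \<le> t" "t < \<rho>" "\<rho> - t < e"
      using e(1) \<rho> by (auto simp: t_def min_def)
    have "dist (complex_of_real \<rho>) (of_real t) = \<bar>\<rho> - t\<bar>"
      by (metis dist_norm norm_of_real of_real_diff)
    then have "complex_of_real t \<in> ball (of_real \<rho>) e"
      using t by auto
    with e(2) have "of_real t \<in> unit_disc \<inter> (\<lambda>z. cmod (F z)) -` {B<..}"
      by (rule subsetD)
    moreover have "complex_of_real t \<in> ball 0 \<rho>"
      using t by auto
    ultimately have "of_real t \<in> U"
      unfolding U_def by (rule IntI)
    then show ?thesis by auto
  qed
  ultimately have "\<not> negligible U"
    by (rule open_not_negligible)
  moreover have "AE z in lebesgue. z \<notin> U"
    using ae unfolding AE_disc_area_iff
    by (rule AE_mp) (auto intro!: AE_I2 simp: U_def)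
  then have "U \<in> null_sets lebesgue"
    using \<open>open U\<close> by (subst AE_iff_null_sets) auto
  then have "negligible U"
    by (simp add: negligible_iff_null_sets)
  ultimately show False by simp
qed

text \<open>The radius \<open>\<rho>\<close> separates test function and observation point: the
  former lives where the tail of \<open>\<nu>\<close> is at most its value at \<open>\<rho>\<close>,
  the latter are taken where it is at least that value, so the value cancels. Finite sums suffice
  because all Taylor terms at \<open>\<rho>\<close> are nonnegative.\<close>

lemma bounded_projection_tail_le:
  assumes \<nu>: "radial_weight \<nu>" and bd: "bergman_projection_bounded \<omega> \<nu>"
  obtains B where "0 \<le> B"
    "\<And>\<rho> S. 0 < \<rho> \<Longrightarrow> \<rho> < 1 \<Longrightarrow> finite S \<Longrightarrow> H \<rho> * (2 * \<rho> * (\<Sum>n\<in>S. coeff n * \<rho> ^ (4 * n) / real n)) \<le> B"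
proof -
  obtain K where K: "0 \<le> K"
    and norm_le: "\<And>f. f \<in> L_inf \<nu> \<Longrightarrow> weighted_sup_norm \<nu> (bergman_projection \<omega> f) \<le> ereal K * weighted_sup_norm \<nu> f"
    and in_H: "\<And>f. f \<in> L_inf \<nu> \<Longrightarrow> bergman_projection \<omega> f \<in> H_inf \<nu>"
    using bd unfolding bergman_projection_bounded_def by blast
  note [measurable] = tail_integral_cmod_measurable[OF \<nu>]
  have main: "H \<rho> * (2 * \<rho> * (\<Sum>n\<in>S. coeff n * \<rho> ^ (4 * n) / real n)) \<le> K * (2 * pi)"
    if \<rho>: "0 < \<rho>" "\<rho> < 1" and S: "finite S" for \<rho> S
  proof -
    define f where "f z = indicator (- ball 0 \<rho>) z *\<^sub>R sawtooth (of_real \<rho> * z)" for z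
    define G where "G r = indicator {\<rho>..<1} r * \<omega> r" for r
    have "0 < tail_integral \<nu> \<rho>"
      using \<nu> \<rho> by (simp add: radial_weight_def)
    have \<rho>z: "cmod (of_real \<rho> * z) < 1" if "cmod z < 1" for z
      using that \<rho> mult_strict_mono'[of \<rho> 1 "cmod z" 1] by (simp add: norm_mult)
    have saw [measurable]: "(\<lambda>z. sawtooth (of_real \<rho> * z)) \<in> borel_measurable disc_area"
    proof -
      have "1 - of_real \<rho> * z \<notin> \<real>\<^sub>\<le>\<^sub>0" if "z \<in> unit_disc" for z
      proof -
        have "cmod (of_real \<rho> * z) < 1"
          using \<rho>z that by simp
        then have "\<bar>Re (of_real \<rho> * z)\<bar> < 1"
          using abs_Re_le_cmod le_less_trans by blast
        then have "0 < Re (1 - of_real \<rho> * z)"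
          by auto
        then show ?thesis
          using complex_nonpos_Reals_iff by fastforce
      qed
      then have "continuous_on unit_disc (\<lambda>z. sawtooth (of_real \<rho> * z))"
        unfolding sawtooth_def by (intro continuous_intros) auto
      then have "(\<lambda>z. sawtooth (of_real \<rho> * z)) \<in> borel_measurable (lebesgue_on unit_disc)"
        by (intro continuous_imp_measurable_on_sets_lebesgue) auto
      then show ?thesis
        by (simp add: disc_area_def)
    qed
    have [measurable]: "(\<lambda>z. indicat_real (- ball 0 \<rho>) z) \<in> borel_measurable disc_area"
      by (intro borel_measurable_disc_area borel_measurable_indicator) auto
    have f_meas [measurable]: "f \<in> borel_measurable disc_area"
      unfolding f_def[abs_def] by measurable
    have f_bound: "cmod (f z) \<le> 2 * pi" if "cmod z < 1" for z
      using norm_sawtooth_le[OF \<rho>z[OF that]] by (simp add: f_def indicator_def)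
    have f_norm: "weighted_sup_norm \<nu> f \<le> ereal (2 * pi * tail_integral \<nu> \<rho>)"
      unfolding weighted_sup_norm_def
    proof (rule esssup_I)
      show "AE z in disc_area. ereal (cmod (f z) * tail_integral \<nu> (cmod z)) \<le> ereal (2 * pi * tail_integral \<nu> \<rho>)"
      proof (rule AE_I2)
        fix z assume "z \<in> space disc_area"
        then have z: "cmod z < 1" by simp
        show "ereal (cmod (f z) * tail_integral \<nu> (cmod z)) \<le> ereal (2 * pi * tail_integral \<nu> \<rho>)"
        proof (cases "cmod z < \<rho>")
          case True
          then show ?thesis
            using \<open>0 < tail_integral \<nu> \<rho>\<close> by (simp add: f_def)
        next
          case False
          then have "cmod (f z) * tail_integral \<nu> (cmod z) \<le> 2 * pi * tail_integral \<nu> \<rho>"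
            using \<rho> z f_bound[OF z] \<nu>
            by (intro mult_mono radial_weight_tail_antimono) (auto simp: radial_weight_def less_imp_le)
          then show ?thesis by simp
        qed
      qed
    qed measurable
    have f_in: "f \<in> L_inf \<nu>"
      using f_norm by (auto simp: L_inf_def intro: le_less_trans)
    define F where "F = bergman_projection \<omega> f"
    have F_hol: "F holomorphic_on unit_disc"
      using in_H[OF f_in] by (simp add: H_inf_def F_def)
    have "weighted_sup_norm \<nu> F \<le> ereal K * weighted_sup_norm \<nu> f"
      unfolding F_def by (rule norm_le[OF f_in])
    also have "\<dots> \<le> ereal K * ereal (2 * pi * tail_integral \<nu> \<rho>)"
      using K f_norm by (intro ereal_mult_left_mono) auto
    finally have F_norm: "weighted_sup_norm \<nu> F \<le> ereal (K * (2 * pi * tail_integral \<nu> \<rho>))"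
      by simp
    have "AE z in disc_area. ereal (cmod (F z) * tail_integral \<nu> (cmod z)) \<le> weighted_sup_norm \<nu> F"
      unfolding weighted_sup_norm_def by (rule esssup_AE)
    then have "AE z in disc_area. cmod z < \<rho> \<longrightarrow> cmod (F z) \<le> K * (2 * pi)"
    proof (rule AE_mp, intro AE_I2 impI)
      fix z assume z: "cmod z < \<rho>" and "ereal (cmod (F z) * tail_integral \<nu> (cmod z)) \<le> weighted_sup_norm \<nu> F"
      then have "cmod (F z) * tail_integral \<nu> (cmod z) \<le> K * (2 * pi) * tail_integral \<nu> \<rho>"
        using F_norm order.trans by fastforce
      moreover have "cmod (F z) * tail_integral \<nu> \<rho> \<le> cmod (F z) * tail_integral \<nu> (cmod z)"
        using z by (intro mult_left_mono radial_weight_tail_antimono[OF \<nu>]) auto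
      ultimately have "cmod (F z) * tail_integral \<nu> \<rho> \<le> K * (2 * pi) * tail_integral \<nu> \<rho>"
        by linarith
      then show "cmod (F z) \<le> K * (2 * pi)"
        using \<open>0 < tail_integral \<nu> \<rho>\<close> by (rule mult_right_le_imp_le)
    qed
    then have F_le: "cmod (F (of_real \<rho>)) \<le> K * (2 * pi)"
      by (rule bounded_at_boundary_of_sublevel[OF F_hol \<rho>])
    interpret G: radial_density G
    proof
      show "G \<in> borel_measurable borel"
        unfolding G_def[abs_def] by measurable
      show "0 \<le> G r" for r
        using nonneg by (simp add: G_def)
      show "integrable disc_area (\<lambda>z. G (cmod z))"
      proof (subst integrable_disc_area_radial_iff)
        have "set_integrable lborel {0..<1} (\<lambda>r. (2 * r * indicator {\<rho>..<1} r) * \<omega> r)"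
          by (intro integrable_mult[where B = 2]) (auto simp: indicator_def)
        then show "set_integrable lborel {0..<1} (\<lambda>r. 2 * r * G r)"
          by (simp add: G_def mult.assoc)
      qed (unfold G_def[abs_def], measurable)
    qed
    define g where "g n = (LINT z|disc_area. cmod z ^ (2 * n) * G (cmod z))" for n
    have fG: "f z * of_real (\<omega> (cmod z)) = sawtooth (of_real \<rho> * z) * of_real (G (cmod z))" if "cmod z < 1" for z
      using that by (simp add: f_def G_def indicator_def)
    have f_int: "integrable disc_area (\<lambda>z. f z * of_real (\<omega> (cmod z)))"
    proof (subst Bochner_Integration.integrable_cong[OF refl])
      show "integrable disc_area (\<lambda>z. sawtooth (of_real \<rho> * z) * of_real (G (cmod z)))"
        using norm_sawtooth_le[OF \<rho>z] by (intro G.integrable_mult_G[OF saw, of "2 * pi"] AE_I2) auto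
    qed (auto simp: fG)
    have coefficient: "(LINT z|disc_area. f z * cnj z ^ n * of_real (\<omega> (cmod z))) = of_real (\<rho> ^ n / real n * g n)" for n
    proof -
      have "(LINT z|disc_area. f z * cnj z ^ n * of_real (\<omega> (cmod z)))
          = (LINT z|disc_area. sawtooth (of_real \<rho> * z) * cnj z ^ n * of_real (G (cmod z)))"
        by (intro Bochner_Integration.integral_cong) (auto simp: f_def G_def indicator_def)
      also have "\<dots> = of_real (\<rho> ^ n / real n * g n)"
        unfolding g_def using \<rho> by (intro G.integral_sawtooth) auto
      finally show ?thesis .
    qed
    \<comment> \<open>One power \<open>\<rho> ^ n\<close> stems from the coefficient of
      \<open>sawtooth\<close>, one from the evaluation at \<open>\<rho>\<close>. The lower bound for
      \<open>g n\<close> adds two more, whence the exponent \<open>4 * n\<close>.\<close>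
    define T where "T n = coeff n * (\<rho> ^ n / real n * g n) * \<rho> ^ n" for n
    have "(\<lambda>n. complex_of_real (T n)) sums F (of_real \<rho>)"
      using bergman_projection_power_series(2)[OF f_meas f_int, of "of_real \<rho>"] \<rho>
      unfolding coefficient F_def T_def by simp
    then have "T sums Re (F (of_real \<rho>))"
      using sums_Re by fastforce
    then have T: "summable T" "suminf T = Re (F (of_real \<rho>))"
      by (auto simp: sums_iff)
    have g_ge: "\<rho> ^ (2 * n) * (2 * \<rho> * H \<rho>) \<le> g n" for n
    proof -
      have int1: "integrable lborel (\<lambda>r. indicator {0..<1} r *\<^sub>R (2 * r * (r ^ (2 * n) * G r)))"
      proof -
        have "\<bar>2 * r * (r ^ (2 * n) * indicator {\<rho>..<1} r)\<bar> \<le> 2" if "r \<in> {0..<1}" for r :: real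
        proof -
          have "2 * r * (r ^ (2 * n) * indicator {\<rho>..<1} r) \<le> 2 * (1 * 1)"
            using that unfolding mult.assoc by (intro mult_mono power_le_one) (auto simp: indicator_def mult_le_one power_le_one)
          then show ?thesis
            using that by (simp add: abs_mult)
        qed
        then have "set_integrable lborel {0..<1} (\<lambda>r. 2 * r * (r ^ (2 * n) * indicator {\<rho>..<1} r) * \<omega> r)"
          by (intro integrable_mult[where B = 2]) auto
        then show ?thesis
          by (simp add: set_integrable_def G_def mult.assoc)
      qed
      have int2: "integrable lborel (\<lambda>r. indicator {\<rho>..<1} r *\<^sub>R (\<rho> ^ (2 * n) * (2 * \<rho>) * \<omega> r))"
        using integrable_mult[of "{\<rho>..<1}" "\<lambda>r. \<rho> ^ (2 * n) * (2 * \<rho>)" "\<rho> ^ (2 * n) * (2 * \<rho>)"] \<rho>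
        by (auto simp: set_integrable_def)
      have "\<rho> ^ (2 * n) * (2 * \<rho> * H \<rho>) = (LINT r:{\<rho>..<1}|lborel. \<rho> ^ (2 * n) * (2 * \<rho>) * \<omega> r)"
        by (simp add: tail_eq)
      also have "\<dots> \<le> (LINT r:{0..<1}|lborel. 2 * r * (r ^ (2 * n) * G r))"
        unfolding set_lebesgue_integral_def
      proof (rule integral_mono[OF int2 int1])
        fix r :: real
        show "indicat_real {\<rho>..<1} r *\<^sub>R (\<rho> ^ (2 * n) * (2 * \<rho>) * \<omega> r) \<le> indicat_real {0..<1} r *\<^sub>R (2 * r * (r ^ (2 * n) * G r))"
        proof (cases "r \<in> {\<rho>..<1}")
          case True
          then have "\<rho> ^ (2 * n) * (2 * \<rho>) \<le> r ^ (2 * n) * (2 * r)"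
            using \<rho> by (intro mult_mono power_mono) auto
          then have "\<rho> ^ (2 * n) * (2 * \<rho>) * \<omega> r \<le> r ^ (2 * n) * (2 * r) * \<omega> r"
            using nonneg by (rule mult_right_mono)
          then show ?thesis
            using True \<rho> by (simp add: G_def ac_simps)
        qed (auto simp: G_def)
      qed
      also have "\<dots> = g n"
        unfolding g_def by (rule integral_disc_area_radial[symmetric]) measurable
      finally show ?thesis .
    qed
    have T_ge: "H \<rho> * (2 * \<rho> * (coeff n * \<rho> ^ (4 * n) / real n)) \<le> T n" for n
    proof -
      have "(coeff n * \<rho> ^ n / real n * \<rho> ^ n) * (\<rho> ^ (2 * n) * (2 * \<rho> * H \<rho>)) \<le> (coeff n * \<rho> ^ n / real n * \<rho> ^ n) * g n"
        using coeff_pos[of n] \<rho> by (intro mult_left_mono g_ge) auto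
      moreover have "\<rho> ^ (4 * n) = \<rho> ^ n * \<rho> ^ n * \<rho> ^ (2 * n)"
        by (simp add: power_add[symmetric])
      ultimately show ?thesis
        by (simp add: T_def ac_simps)
    qed
    have "0 \<le> H \<rho> * (2 * \<rho> * (coeff n * \<rho> ^ (4 * n) / real n))" for n
      using tail_pos[of \<rho>] coeff_pos[of n] \<rho> by auto
    then have T_nonneg: "0 \<le> T n" for n
      using T_ge order.trans by blast
    have "H \<rho> * (2 * \<rho> * (\<Sum>n\<in>S. coeff n * \<rho> ^ (4 * n) / real n)) = (\<Sum>n\<in>S. H \<rho> * (2 * \<rho> * (coeff n * \<rho> ^ (4 * n) / real n)))"
      by (simp add: sum_distrib_left)
    also have "\<dots> \<le> (\<Sum>n\<in>S. T n)"
      by (intro sum_mono T_ge)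
    also have "\<dots> \<le> suminf T"
      using T(1) S T_nonneg by (intro sum_le_suminf) auto
    also have "\<dots> \<le> cmod (F (of_real \<rho>))"
      unfolding T(2) by (rule complex_Re_le_cmod)
    finally show ?thesis
      using F_le by linarith
  qed
  show thesis
    using that[of "K * (2 * pi)"] main K by auto
qed

end


section \<open>Reverse doubling from a harmonic sum\<close>

lemma ln_le_sum_inverse:
  assumes m: "0 < m"
  shows "ln (real (m + k) / real m) \<le> (\<Sum>n\<in>{m..<m + k}. 1 / real n)"
proof (induction k)
  case (Suc k)
  define x where "x = real (m + k)"
  have x: "0 < x" "real (m + Suc k) = x + 1"
    using m by (auto simp: x_def)
  have "(x + 1) / real m = x / real m * (1 + 1 / x)"
    using x(1) by (simp add: distrib_left add_divide_distrib)
  then have "ln (real (m + Suc k) / real m) = ln (x / real m * (1 + 1 / x))"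
    unfolding x(2) by (rule arg_cong)
  also have "\<dots> = ln (x / real m) + ln (1 + 1 / x)"
    using x(1) m by (intro ln_mult_pos) (auto intro: add_pos_pos)
  also have "ln (1 + 1 / x) \<le> 1 / x"
    using x by (intro ln_add_one_self_le_self) auto
  finally show ?case
    using Suc by (simp add: x_def)
qed (use m in simp)

context doubling_weight
begin

lemma D_check_if_bounded:
  assumes \<nu>: "radial_weight \<nu>" and bd: "bergman_projection_bounded \<omega> \<nu>"
  shows "\<omega> \<in> D_check"
proof -
  obtain B where B: "0 \<le> B"
    and le_B: "\<And>\<rho> S. 0 < \<rho> \<Longrightarrow> \<rho> < 1 \<Longrightarrow> finite S \<Longrightarrow> H \<rho> * (2 * \<rho> * (\<Sum>n\<in>S. coeff n * \<rho> ^ (4 * n) / real n)) \<le> B"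
    using bounded_projection_tail_le[OF \<nu> bd] by metis
  \<comment> \<open>The factor \<open>32\<close> collects \<open>1 / 16\<close> from the lower bound
    for \<open>\<rho> ^ (4 * n)\<close> and \<open>1 / 2\<close> from \<open>coeff\<close>; the
    remaining factor \<open>2 * \<rho>\<close> is at least \<open>1\<close>.\<close>
  define q where "q = 32 * B * mom_const"
  have q: "0 \<le> q" using B mom_const_ge_1 by (simp add: q_def)
  \<comment> \<open>Since \<open>m \<le> 2 / x\<close> and
    \<open>Suc N \<ge> 1 / (2 t) = K / (2 x)\<close>, the quotient \<open>Suc N / m\<close> is at
    least \<open>K / 4\<close>. This choice thus pushes the harmonic sum above
    \<open>2 q + 1\<close>.\<close>
  define K where "K = 4 * exp (2 * q + 1)"
  have "1 \<le> exp (2 * q + 1)" using q by simp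
  then have K: "4 \<le> K" by (simp add: K_def)
  have main: "2 * H (1 - (1 - r) / K) \<le> H r" if r: "0 < r" "r < 1" for r
  proof -
    define x where "x = 1 - r"
    define t where "t = x / K"
    define \<rho> where "\<rho> = 1 - t"
    have x: "0 < x" "x < 1" using r by (auto simp: x_def)
    have "x / K \<le> x / 4"
      using K x by (intro divide_left_mono) auto
    then have t: "0 < t" "t \<le> 1 / 4"
      using x K by (auto simp: t_def)
    then have \<rho>: "1 / 2 \<le> \<rho>" "\<rho> < 1"
      by (auto simp: \<rho>_def)
    \<comment> \<open>The range starts at about \<open>1 / (1 - r)\<close>, where
      \<open>coeff\<close> has reached a constant times \<open>1 / H r\<close>, and ends at about
      \<open>1 / (2 t)\<close>, up to which \<open>\<rho> ^ n\<close> stays above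
      \<open>1 / 2\<close>.\<close>
    define m where "m = nat \<lceil>1 / x\<rceil>"
    define N where "N = nat \<lfloor>1 / (2 * t)\<rfloor>"
    have m: "1 / x \<le> real m" "real m \<le> 2 / x" "0 < m"
    proof -
      show "1 / x \<le> real m" unfolding m_def by (rule real_nat_ceiling_ge)
      have "real m \<le> 1 / x + 1"
        using x by (simp add: m_def)
      also have "\<dots> \<le> 2 / x"
        using x by (simp add: field_simps)
      finally show "real m \<le> 2 / x" .
      show "0 < m"
        using x by (simp add: m_def)
    qed
    have N: "real N * t \<le> 1 / 2" "1 / (2 * t) \<le> real (Suc N)"
    proof -
      have "real N \<le> 1 / (2 * t)"
        using t by (simp add: N_def)
      then show "real N * t \<le> 1 / 2"
        using t by (simp add: field_simps)
      show "1 / (2 * t) \<le> real (Suc N)"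
        unfolding N_def using t by linarith
    qed
    have pow: "1 / 16 \<le> \<rho> ^ (4 * n)" if "n \<le> N" for n
    proof -
      have "real n * t \<le> real N * t"
        using that t by (intro mult_right_mono) auto
      then have "1 / 2 \<le> 1 + real n * (- t)"
        using N(1) by simp
      also have "\<dots> \<le> (1 + (- t)) ^ n"
        using t by (intro Bernoulli_inequality) auto
      finally have "1 / 2 \<le> \<rho> ^ n"
        by (simp add: \<rho>_def)
      then have "(1 / 2) ^ 4 \<le> (\<rho> ^ n) ^ 4"
        by (intro power_mono) auto
      then show ?thesis
        by (simp add: power_mult[symmetric] mult.commute power_divide)
    qed
    have "real m * exp (2 * q + 1) \<le> 2 / x * exp (2 * q + 1)"
      using m by (intro mult_right_mono) auto
    also have "\<dots> = 1 / (2 * t)"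
      using x by (simp add: t_def K_def)
    also have "\<dots> \<le> real (Suc N)"
      by (rule N(2))
    finally have mN: "real m * exp (2 * q + 1) \<le> real (Suc N)" .
    have "exp (2 * q + 1) \<le> real (Suc N) / real m"
      using mN m(3) by (simp add: field_simps)
    then have "2 * q + 1 \<le> ln (real (Suc N) / real m)"
      using m(3) by (subst ln_ge_iff) auto
    also have "\<dots> \<le> (\<Sum>n\<in>{m..N}. 1 / real n)"
    proof -
      have "real m * 1 \<le> real m * exp (2 * q + 1)"
        using q by (intro mult_left_mono) auto
      then have "m \<le> Suc N"
        using mN by simp
      then show ?thesis
        using ln_le_sum_inverse[OF m(3), of "Suc N - m"] by (simp add: atLeastLessThanSuc_atLeastAtMost)
    qed
    finally have harm: "2 * q + 1 \<le> (\<Sum>n\<in>{m..N}. 1 / real n)" .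
    have H_pos: "0 < H \<rho>" "0 < H r"
      using \<rho> r by (auto intro!: tail_pos)
    have coeff_ge: "1 / (2 * (mom_const * H r)) \<le> coeff m"
    proof -
      have "mom (2 * m + 1) \<le> mom_const * H (1 - 1 / real (2 * m + 1))"
        by (rule mom_le_tail) simp
      also have "\<dots> \<le> mom_const * H r"
      proof (intro mult_left_mono tail_antimono)
        have "1 / real (2 * m + 1) \<le> 1 / real m"
          using m by (intro divide_left_mono) auto
        also have "\<dots> \<le> x"
          using m x by (simp add: field_simps)
        finally show "r \<le> 1 - 1 / real (2 * m + 1)"
          by (simp add: x_def)
      qed (use r mom_const_ge_1 in auto)
      finally show ?thesis
        unfolding coeff_def using mom_pos[of "2 * m + 1"] mom_const_ge_1 H_pos
        by (intro divide_left_mono mult_pos_pos) auto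
    qed
    have c0: "0 \<le> 1 / (2 * (mom_const * H r)) / 16"
      using mom_const_ge_1 H_pos by auto
    have "H \<rho> * (2 * (1 / 2) * (1 / (2 * (mom_const * H r)) / 16 * (2 * q + 1))) \<le> H \<rho> * (2 * \<rho> * (\<Sum>n\<in>{m..N}. coeff n * \<rho> ^ (4 * n) / real n))"
    proof (intro mult_left_mono mult_mono)
      have "1 / (2 * (mom_const * H r)) / 16 * (2 * q + 1) \<le> 1 / (2 * (mom_const * H r)) / 16 * (\<Sum>n\<in>{m..N}. 1 / real n)"
        using harm c0 by (rule mult_left_mono)
      also have "\<dots> = (\<Sum>n\<in>{m..N}. 1 / (2 * (mom_const * H r)) * (1 / 16) / real n)"
        by (simp add: sum_distrib_left)
      also have "\<dots> \<le> (\<Sum>n\<in>{m..N}. coeff n * \<rho> ^ (4 * n) / real n)"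
      proof (intro sum_mono divide_right_mono mult_mono pow)
        fix n assume "n \<in> {m..N}"
        then show "1 / (2 * (mom_const * H r)) \<le> coeff n"
          using coeff_ge coeff_mono[of m n] by auto
        show "0 \<le> coeff n"
          using coeff_pos[of n] by simp
      qed auto
      finally show "1 / (2 * (mom_const * H r)) / 16 * (2 * q + 1) \<le> (\<Sum>n\<in>{m..N}. coeff n * \<rho> ^ (4 * n) / real n)" .
    qed (use \<rho> q c0 H_pos in auto)
    also have "\<dots> \<le> B"
      using \<rho> by (intro le_B) auto
    finally have "H \<rho> * (2 * q + 1) \<le> 32 * B * mom_const * H r"
      using mom_const_ge_1 H_pos by (simp add: field_simps)
    \<comment> \<open>The harmonic sum was made larger than \<open>2 q\<close> so that doubling the
      inequality yields the constant \<open>2\<close> of the reverse doubling condition.\<close>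
    then have "2 * H \<rho> * (2 * q + 1) \<le> 2 * q * H r"
      by (simp add: q_def)
    also have "\<dots> \<le> H r * (2 * q + 1)"
      using H_pos by (simp add: algebra_simps)
    finally have "2 * H \<rho> \<le> H r"
      by (rule mult_right_le_imp_le) (use q in simp)
    then show ?thesis
      by (simp add: \<rho>_def t_def x_def)
  qed
  have "\<forall>\<^sub>F r in at_left 1. H r \<ge> 2 * H (1 - (1 - r) / K)"
    unfolding eventually_at_left_field by (intro exI[of _ 0] conjI allI impI main) simp_all
  then show ?thesis
    using radial K unfolding D_check_def mem_Collect_eq
    by (intro conjI exI[of _ K] exI[of _ "2 :: real"]) auto
qed

end

subsection \<open>Reduction to Borel weights\<close>

text \<open>A Lebesgue measurable profile agrees almost everywhere with a Borel one;
  \<open>max 0\<close> restores nonnegativity on the exceptional set and outside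
  \<open>[0,1)\<close>.\<close>

lemma radial_weight_borel_version:
  assumes "radial_weight \<omega>"
  obtains \<omega>' where "\<omega>' \<in> borel_measurable borel" "\<And>r. 0 \<le> \<omega>' r"
    "AE r in lebesgue. r \<in> {0..<1} \<longrightarrow> \<omega>' r = \<omega> r"
proof -
  have "(\<lambda>r. indicat_real {0..<1} r *\<^sub>R \<omega> r) \<in> borel_measurable lebesgue"
    using assms unfolding radial_weight_def set_integrable_def by (blast intro: borel_measurable_integrable)
  then obtain g where g: "g \<in> borel_measurable lborel" "AE r in lborel. indicat_real {0..<1} r *\<^sub>R \<omega> r = g r"
    using completion_ex_borel_measurable_real by blast
  show thesis
  proof
    show "(\<lambda>r. max 0 (g r)) \<in> borel_measurable borel"
      using g(1) by simp
    have "AE r in lebesgue. indicat_real {0..<1} r *\<^sub>R \<omega> r = g r"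
      using g(2) by (rule AE_completion)
    then show "AE r in lebesgue. r \<in> {0..<1} \<longrightarrow> max 0 (g r) = \<omega> r"
    proof (rule AE_mp, intro AE_I2 impI)
      fix r :: real assume eq: "indicat_real {0..<1} r *\<^sub>R \<omega> r = g r" and r: "r \<in> {0..<1}"
      have "g r = \<omega> r"
        using eq r by simp
      then show "max 0 (g r) = \<omega> r"
        using assms r by (simp add: radial_weight_def)
    qed
  qed simp
qed

text \<open>Apart from pointwise nonnegativity, the notions of the theorem see a weight only through
  integrals, so they do not distinguish the two profiles.\<close>

locale borel_version =
  fixes \<omega> \<omega>' :: "real \<Rightarrow> real"
  assumes \<omega>: "radial_weight \<omega>"
    and borel': "\<omega>' \<in> borel_measurable borel"
    and nonneg': "\<And>r. 0 \<le> \<omega>' r"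
    and AE_eq: "AE r in lebesgue. r \<in> {0..<1} \<longrightarrow> \<omega>' r = \<omega> r"
begin

lemma set_integral_eq:
  assumes A: "A \<subseteq> {0..<1}" "A \<in> sets borel" and g: "g \<in> borel_measurable borel"
  shows "set_integrable lebesgue A (\<lambda>r. g r * \<omega>' r) \<longleftrightarrow> set_integrable lebesgue A (\<lambda>r. g r * \<omega> r)"
    and "(LINT r:A|lebesgue. g r * \<omega>' r) = (LINT r:A|lebesgue. g r * \<omega> r)"
proof -
  have [measurable]: "A \<in> sets lebesgue" "g \<in> borel_measurable lebesgue" "\<omega>' \<in> borel_measurable lebesgue"
    using A(2) g borel' by (auto simp: measurable_completion)
  have [measurable]: "(\<lambda>r. indicat_real {0..<1} r *\<^sub>R \<omega> r) \<in> borel_measurable lebesgue"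
    using \<omega> unfolding radial_weight_def set_integrable_def by (blast intro: borel_measurable_integrable)
  have eq: "indicat_real A r *\<^sub>R (g r * \<omega> r) = indicat_real A r * g r * (indicat_real {0..<1} r *\<^sub>R \<omega> r)" for r
    using A(1) by (auto simp: indicator_def)
  have m: "(\<lambda>r. indicat_real A r *\<^sub>R (g r * \<omega> r)) \<in> borel_measurable lebesgue"
    unfolding eq by measurable
  have m': "(\<lambda>r. indicat_real A r *\<^sub>R (g r * \<omega>' r)) \<in> borel_measurable lebesgue"
    by measurable
  have ae: "AE r in lebesgue. indicat_real A r *\<^sub>R (g r * \<omega>' r) = indicat_real A r *\<^sub>R (g r * \<omega> r)"
    using AE_eq by (rule AE_mp) (use A(1) in \<open>auto intro!: AE_I2 simp: indicator_def\<close>)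
  show "set_integrable lebesgue A (\<lambda>r. g r * \<omega>' r) \<longleftrightarrow> set_integrable lebesgue A (\<lambda>r. g r * \<omega> r)"
    unfolding set_integrable_def by (rule integrable_cong_AE[OF m' m ae])
  show "(LINT r:A|lebesgue. g r * \<omega>' r) = (LINT r:A|lebesgue. g r * \<omega> r)"
    unfolding set_lebesgue_integral_def by (rule integral_cong_AE[OF m' m ae])
qed

lemma tail_integral_eq: "0 \<le> r \<Longrightarrow> tail_integral \<omega>' r = tail_integral \<omega> r"
  using set_integral_eq(2)[of "{r..<1}" "\<lambda>_. 1"] by (auto simp: tail_integral_def)

lemma moment_borel_version: "moment \<omega>' x = moment \<omega> x"
  unfolding moment_def by (rule set_integral_eq(2)) auto

lemma radial_weight': "radial_weight \<omega>'"
  using \<omega> set_integral_eq(1)[of "{0..<1}" "\<lambda>_. 1"] nonneg' tail_integral_eq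
  by (simp add: radial_weight_def)

sublocale borel_weight \<omega>'
  by unfold_locales (use borel' nonneg' radial_weight' in auto)

text \<open>The tails of the two profiles are compared for nonnegative arguments only, and the
  conditions at \<open>1\<close> may be restricted to those.\<close>

lemma eventually_at_left_nonneg: "\<forall>\<^sub>F r in at_left (1 :: real). 0 \<le> r \<and> r < 1"
  unfolding eventually_at_left_field by (intro exI[of _ 0]) auto

lemma D_hat_iff: "\<omega>' \<in> D_hat \<longleftrightarrow> \<omega> \<in> D_hat"
proof -
  have "(\<forall>\<^sub>F r in at_left 1. tail_integral \<omega>' r \<le> C * tail_integral \<omega>' ((1 + r) / 2))
      \<longleftrightarrow> (\<forall>\<^sub>F r in at_left 1. tail_integral \<omega> r \<le> C * tail_integral \<omega> ((1 + r) / 2))" for C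
    by (rule eventually_cong[OF eventually_at_left_nonneg]) (simp add: tail_integral_eq)
  then show ?thesis
    using \<omega> radial_weight' by (simp add: D_hat_def)
qed

lemma D_check_iff: "\<omega>' \<in> D_check \<longleftrightarrow> \<omega> \<in> D_check"
proof -
  have "(\<forall>\<^sub>F r in at_left 1. tail_integral \<omega>' r \<ge> C * tail_integral \<omega>' (1 - (1 - r) / K))
      \<longleftrightarrow> (\<forall>\<^sub>F r in at_left 1. tail_integral \<omega> r \<ge> C * tail_integral \<omega> (1 - (1 - r) / K))" if "K > 1" for C K
  proof (rule eventually_cong[OF eventually_at_left_nonneg])
    fix r :: real assume r: "0 \<le> r \<and> r < 1"
    then have "(1 - r) / K \<le> 1"
      using that by (simp add: field_simps)
    then show "(tail_integral \<omega>' r \<ge> C * tail_integral \<omega>' (1 - (1 - r) / K))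
        = (tail_integral \<omega> r \<ge> C * tail_integral \<omega> (1 - (1 - r) / K))"
      using r by (simp add: tail_integral_eq)
  qed
  then show ?thesis
    using \<omega> radial_weight' unfolding D_check_def by auto
qed

text \<open>Composing a Lebesgue measurable function with \<open>cmod\<close> does not preserve
  measurability on formal grounds. Here the composition agrees almost everywhere with a Borel one,
  and completeness of Lebesgue measure gives the rest.\<close>

lemma cmod_measurable: "(\<lambda>z. \<omega> (cmod z)) \<in> borel_measurable disc_area"
proof -
  define h h' where "h z = indicat_real unit_disc z * \<omega> (cmod z)"
    and "h' z = indicat_real unit_disc z * \<omega>' (cmod z)" for z
  have "h' \<in> borel_measurable borel"
  proof -
    note borel' [measurable]
    have [measurable]: "unit_disc \<in> sets borel" by simp
    show ?thesis
      unfolding h'_def[abs_def] by measurable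
  qed
  then have "h' \<in> borel_measurable lebesgue"
    by (simp add: measurable_completion)
  moreover have "AE z in disc_area. \<omega>' (cmod z) = \<omega> (cmod z)"
    by (rule AE_disc_area_cmod[OF AE_eq])
  then have "AE z in lebesgue. h' z = h z"
    unfolding AE_disc_area_iff by (rule AE_mp) (auto intro!: AE_I2 simp: h_def h'_def indicator_def)
  ultimately have "h \<in> borel_measurable lebesgue"
    by (rule borel_measurable_AE)
  then have "h \<in> borel_measurable (lebesgue_on unit_disc)"
    by (rule measurable_restrict_space1)
  then have "h \<in> borel_measurable disc_area"
    by (simp add: disc_area_def)
  then show ?thesis
    by (rule measurable_cong[THEN iffD1, rotated]) (simp add: h_def)
qed

lemma bergman_integrand_AE:
  assumes [measurable]: "f \<in> borel_measurable disc_area"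
  shows "bergman_integrand \<omega> f z \<in> borel_measurable disc_area"
    and "bergman_integrand \<omega>' f z \<in> borel_measurable disc_area"
    and "AE \<zeta> in disc_area. bergman_integrand \<omega>' f z \<zeta> = bergman_integrand \<omega> f z \<zeta>"
proof -
  note cmod_measurable [measurable]
  have kernel: "bergman_kernel \<omega> z \<zeta> = ker (cnj z * \<zeta>)" for \<zeta>
    unfolding bergman_kernel_eq[symmetric] bergman_kernel_def moment_borel_version ..
  have [measurable]: "(\<lambda>\<zeta>. cnj (ker (cnj z * \<zeta>))) \<in> borel_measurable disc_area"
  proof (rule borel_measurable_disc_area)
    have [measurable]: "cnj \<in> borel_measurable borel"
      by (intro borel_measurable_continuous_onI continuous_intros)
    show "(\<lambda>\<zeta>. cnj (ker (cnj z * \<zeta>))) \<in> borel_measurable borel"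
      by measurable
  qed
  have [measurable]: "(\<lambda>\<zeta>. \<omega>' (cmod \<zeta>)) \<in> borel_measurable disc_area"
    using borel' by (intro borel_measurable_disc_area) measurable
  show "bergman_integrand \<omega> f z \<in> borel_measurable disc_area"
    unfolding bergman_integrand_def[abs_def] kernel by measurable
  show "bergman_integrand \<omega>' f z \<in> borel_measurable disc_area"
    unfolding bergman_integrand_def[abs_def] bergman_kernel_eq by measurable
  show "AE \<zeta> in disc_area. bergman_integrand \<omega>' f z \<zeta> = bergman_integrand \<omega> f z \<zeta>"
    using AE_disc_area_cmod[OF AE_eq]
    by (rule AE_mp) (auto intro!: AE_I2 simp: bergman_integrand_def bergman_kernel_eq kernel)
qed

lemma bergman_projection_bounded_iff:
  "bergman_projection_bounded \<omega>' \<nu> \<longleftrightarrow> bergman_projection_bounded \<omega> \<nu>"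
proof -
  have "integrable disc_area (bergman_integrand \<omega>' f z) \<longleftrightarrow> integrable disc_area (bergman_integrand \<omega> f z)"
    and "bergman_projection \<omega>' f = bergman_projection \<omega> f" if "f \<in> L_inf \<nu>" for f z
  proof -
    have f: "f \<in> borel_measurable disc_area"
      using that by (simp add: L_inf_def)
    show "integrable disc_area (bergman_integrand \<omega>' f z) \<longleftrightarrow> integrable disc_area (bergman_integrand \<omega> f z)"
      by (rule integrable_cong_AE) (use bergman_integrand_AE[OF f] in auto)
    show "bergman_projection \<omega>' f = bergman_projection \<omega> f"
      unfolding bergman_projection_def
      by (rule ext, rule integral_cong_AE) (use bergman_integrand_AE[OF f] in auto)
  qed
  then show ?thesis
    unfolding bergman_projection_bounded_def by (simp cong: ball_cong)
qed

end

lemma bounded_iff_D_check: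
  assumes "\<omega> \<in> D_hat"
  shows "(\<exists>\<nu>. radial_weight \<nu> \<and> bergman_projection_bounded \<omega> \<nu>) \<longleftrightarrow> \<omega> \<in> D_check"
proof -
  have \<omega>: "radial_weight \<omega>"
    using assms by (simp add: D_hat_def)
  obtain \<omega>' where "\<omega>' \<in> borel_measurable borel" "\<And>r. 0 \<le> \<omega>' r"
      "AE r in lebesgue. r \<in> {0..<1} \<longrightarrow> \<omega>' r = \<omega> r"
    using radial_weight_borel_version[OF \<omega>] by metis
  then interpret borel_version \<omega> \<omega>'
    by unfold_locales (use \<omega> in auto)
  obtain C where "doubling_weight \<omega>' C"
    using assms doubling_weightI unfolding D_hat_iff by blast
  then interpret doubling_weight \<omega>' C .
  show ?thesis
  proof
    assume "\<exists>\<nu>. radial_weight \<nu> \<and> bergman_projection_bounded \<omega> \<nu>"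
    then show "\<omega> \<in> D_check"
      using D_check_if_bounded unfolding bergman_projection_bounded_iff D_check_iff by blast
  next
    assume "\<omega> \<in> D_check"
    then have "\<omega>' \<in> D_check"
      unfolding D_check_iff .
    then obtain a M where "0 < a" "a < 1" "0 \<le> M"
      "\<And>\<rho>. 0 \<le> \<rho> \<Longrightarrow> \<rho> < 1 \<Longrightarrow> set_integrable lborel {\<rho>..<1} (\<lambda>r. (1 - r) powr (- a) * \<omega>' r)"
      "\<And>\<rho>. 0 \<le> \<rho> \<Longrightarrow> \<rho> < 1 \<Longrightarrow> (LINT r:{\<rho>..<1}|lborel. (1 - r) powr (- a) * \<omega>' r) \<le> M * (1 - \<rho>) powr (- a) * H \<rho>"
      using D_check_weighted_tail by blast
    then interpret regular_weight \<omega>' C a M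
      by unfold_locales auto
    show "\<exists>\<nu>. radial_weight \<nu> \<and> bergman_projection_bounded \<omega> \<nu>"
      using radial_weight_power[OF \<open>0 < a\<close>] bergman_projection_bounded_power_weight
      unfolding bergman_projection_bounded_iff by blast
  qed
qed

theorem corollary4:
  fixes \<omega> :: "real \<Rightarrow> real"
  assumes "\<omega> \<in> D_hat"
  shows "((\<exists>\<nu>. radial_weight \<nu> \<and> bergman_projection_bounded \<omega> \<nu>) \<longleftrightarrow> \<omega> \<in> D_check) \<and>
         (\<omega> \<notin> D_check \<longrightarrow> (\<forall>\<nu>. radial_weight \<nu> \<longrightarrow> \<not> bergman_projection_bounded \<omega> \<nu>))"
  using bounded_iff_D_check[OF assms] by blast

end
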